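(* Let $\mathcal{H}$ be a separable complex Hilbert space, let $\mathcal{A} \subseteq \mathcal{B}(\mathcal{H})$ be a norm-closed algebra and let $\mathcal{D} \subseteq \mathcal{B}(\mathcal{H})$ be a masa such that $(I-P)TP \in \mathcal{F}(\mathcal{H})$ for all $T \in \mathcal{A}$ and all $P \in \mathcal{P}(\mathcal{D})$. Then there exists $k \in \mathbb{N}$ such that $\mathcal{A} \subseteq \mathcal{D} + \mathcal{F}_k(\mathcal{H})$, where $\mathcal{F}_k(\mathcal{H}) = \{T \in \mathcal{B}(\mathcal{H}) : \mathrm{rank}\, T \le k\}$.
   Context: $\mathcal{B}(\mathcal{H})$ denotes the bounded linear operators on $\mathcal{H}$ and $\mathcal{F}(\mathcal{H})$ the finite-rank operators in $\mathcal{B}(\mathcal{H})$. A masa is a maximal abelian self-adjoint subalgebra of $\mathcal{B}(\mathcal{H})$. A projection is an operator $P$ with $P = P^2 = P^*$; $\mathcal{P}(\mathcal{D})$ denotes the set of projections in $\mathcal{D}$. *)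

theory Defs
  imports "HOL-Analysis.Analysis" "HOL-Library.Set_Algebras"
begin

section \<open>Complex Hilbert spaces\<close>

class complex_vector = real_vector +
  fixes scaleC :: "complex \<Rightarrow> 'a \<Rightarrow> 'a"  (infixr \<open>*\<^sub>C\<close> 75)
  assumes scaleC_add_right: "a *\<^sub>C (x + y) = a *\<^sub>C x + a *\<^sub>C y"
    and scaleC_add_left: "(a + b) *\<^sub>C x = a *\<^sub>C x + b *\<^sub>C x"
    and scaleC_scaleC: "a *\<^sub>C b *\<^sub>C x = (a * b) *\<^sub>C x"
    and scaleC_of_real: "complex_of_real r *\<^sub>C x = r *\<^sub>R x"

lemma scaleC_one [simp]: "1 *\<^sub>C x = (x :: 'a::complex_vector)"
  using scaleC_of_real[of 1 x] by simp

global_interpretation complex_vector: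
  vector_space "scaleC :: complex \<Rightarrow> 'a \<Rightarrow> 'a::complex_vector"
  by unfold_locales (simp_all add: scaleC_add_right scaleC_add_left scaleC_scaleC)

text \<open>
  The inner product is linear in the first argument. Its real part is the inner product of
  the underlying real space, so the norm, metric and topology of \<^class>\<open>real_inner\<close>
  are those induced by the complex inner product.
\<close>

class complex_inner = real_inner + complex_vector +
  fixes cinner :: "'a \<Rightarrow> 'a \<Rightarrow> complex"
  assumes cinner_commute: "cinner x y = cnj (cinner y x)"
    and cinner_add_left: "cinner (x + y) z = cinner x z + cinner y z"
    and cinner_scaleC_left: "cinner (a *\<^sub>C x) y = a * cinner x y"
    and Re_cinner: "Re (cinner x y) = inner x y"

class chilbert_space = complex_inner + banach

lemma cinner_self: "cinner x x = complex_of_real ((norm x)\<^sup>2)"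
proof (rule complex_eqI)
  show "Im (cinner x x) = Im (complex_of_real ((norm x)\<^sup>2))"
    using arg_cong[OF cinner_commute[of x x], of Im] by simp
qed (simp add: Re_cinner power2_norm_eq_inner)

lemma norm_scaleC: "norm (a *\<^sub>C x) = cmod a * norm (x :: 'a::complex_inner)"
proof -
  have "cinner (a *\<^sub>C x) (a *\<^sub>C x) = a * cnj a * cinner x x"
    by (metis cinner_commute cinner_scaleC_left complex_cnj_mult mult.assoc)
  also have "\<dots> = complex_of_real ((cmod a * norm x)\<^sup>2)"
    by (simp add: cinner_self complex_norm_square power_mult_distrib flip: of_real_power)
  finally have "(norm (a *\<^sub>C x))\<^sup>2 = (cmod a * norm x)\<^sup>2"
    by (simp only: cinner_self of_real_eq_iff)
  then show ?thesis
    by (simp add: power2_eq_iff_nonneg)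
qed

lemma bounded_linear_scaleC_right: "bounded_linear (\<lambda>x :: 'a::complex_inner. a *\<^sub>C x)"
proof (rule bounded_linear_intro[where K = "cmod a"])
  fix r :: real and x :: 'a
  show "a *\<^sub>C (r *\<^sub>R x) = r *\<^sub>R (a *\<^sub>C x)"
    by (simp add: scaleC_scaleC mult.commute flip: scaleC_of_real)
qed (simp_all add: scaleC_add_right norm_scaleC)

instantiation complex :: chilbert_space
begin

definition "scaleC a (z :: complex) = a * z"

definition "cinner (w :: complex) z = w * cnj z"

instance
  by standard (auto simp: scaleC_complex_def cinner_complex_def inner_complex_def
      algebra_simps scaleR_conv_of_real)

end


section \<open>Bounded operators\<close>

text \<open>
  The type \<open>'a \<Rightarrow>\<^sub>L 'a\<close> consists of the bounded \<^emph>\<open>real\<close>-linear maps with the operator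
  norm; the algebra of bounded operators on the complex space is cut out of it by
  complex homogeneity.
\<close>

instantiation blinfun :: (real_normed_vector, complex_inner) complex_vector
begin

lift_definition scaleC_blinfun :: "complex \<Rightarrow> ('a \<Rightarrow>\<^sub>L 'b) \<Rightarrow> 'a \<Rightarrow>\<^sub>L 'b"
  is "\<lambda>a T x. a *\<^sub>C T x"
  by (rule bounded_linear_compose[OF bounded_linear_scaleC_right])

instance
  by standard (transfer; simp add: scaleC_add_right scaleC_add_left scaleC_scaleC scaleC_of_real)+

end

definition bounded_ops :: "('a::chilbert_space \<Rightarrow>\<^sub>L 'a) set" where
  "bounded_ops = {T. \<forall>a x. blinfun_apply T (a *\<^sub>C x) = a *\<^sub>C blinfun_apply T x}"

definition cadjoint :: "('a::chilbert_space \<Rightarrow>\<^sub>L 'a) \<Rightarrow> ('a \<Rightarrow>\<^sub>L 'a)" where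
  "cadjoint T = (THE S. \<forall>x y. cinner (blinfun_apply T x) y = cinner x (blinfun_apply S y))"

lemma cadjoint_eqI:
  assumes "\<And>x y. cinner (blinfun_apply T x) y = cinner x (blinfun_apply S y)"
  shows "cadjoint T = S"
  unfolding cadjoint_def
proof (rule the_equality)
  fix R
  assume R: "\<forall>x y. cinner (blinfun_apply T x) y = cinner x (blinfun_apply R y)"
  have "inner x (blinfun_apply R y) = inner x (blinfun_apply S y)" for x y
    using R assms by (metis Re_cinner)
  then show "R = S"
    by (metis blinfun_eqI vector_eq_ldot)
qed (use assms in blast)


section \<open>Finite-rank operators\<close>

definition finite_rank_ops :: "('a::chilbert_space \<Rightarrow>\<^sub>L 'a) set" where
  "finite_rank_ops =
    {T \<in> bounded_ops. \<exists>B. finite B \<and> range (blinfun_apply T) \<subseteq> complex_vector.span B}"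

text \<open>
  Since \<^const>\<open>complex_vector.dim\<close> is \<open>0\<close> on infinite-dimensional subspaces, finiteness of
  the rank has to be required separately.
\<close>

definition rank_le_ops :: "nat \<Rightarrow> ('a::chilbert_space \<Rightarrow>\<^sub>L 'a) set" where
  "rank_le_ops k = {T \<in> finite_rank_ops. complex_vector.dim (range (blinfun_apply T)) \<le> k}"


section \<open>Operator algebras\<close>

text \<open>Algebras of operators are not assumed to contain the identity.\<close>

definition operator_algebra :: "('a::chilbert_space \<Rightarrow>\<^sub>L 'a) set \<Rightarrow> bool" where
  "operator_algebra A \<longleftrightarrow> A \<subseteq> bounded_ops \<and> complex_vector.subspace A \<and>
    (\<forall>S\<in>A. \<forall>T\<in>A. S o\<^sub>L T \<in> A)"

definition abelian_sa_algebra :: "('a::chilbert_space \<Rightarrow>\<^sub>L 'a) set \<Rightarrow> bool" where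
  "abelian_sa_algebra D \<longleftrightarrow> operator_algebra D \<and>
    (\<forall>S\<in>D. \<forall>T\<in>D. S o\<^sub>L T = T o\<^sub>L S) \<and> (\<forall>T\<in>D. cadjoint T \<in> D)"

definition masa :: "('a::chilbert_space \<Rightarrow>\<^sub>L 'a) set \<Rightarrow> bool" where
  "masa D \<longleftrightarrow> abelian_sa_algebra D \<and> (\<forall>E. abelian_sa_algebra E \<and> D \<subseteq> E \<longrightarrow> E = D)"

definition projections :: "('a::chilbert_space \<Rightarrow>\<^sub>L 'a) set \<Rightarrow> ('a \<Rightarrow>\<^sub>L 'a) set" where
  "projections D = {P \<in> D. P o\<^sub>L P = P \<and> cadjoint P = P}"

end

theory Submission
  imports Defs
begin

text \<open>
  The projections of \<open>D\<close> form a closed subset of a complete metric space for the strong operator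
  topology (\<open>H\<close> is separable), so Baire's theorem on \<open>A \<times> P(D)\<close> bounds the rank of \<open>(I - P)TP\<close> for all \<open>T\<close>
  and for \<open>P\<close> in a strong neighbourhood of some \<open>Q\<close>. To pass to an arbitrary \<open>P\<close>, cut \<open>I\<close> into finitely
  many projections of \<open>D\<close> that either have rank at most one or are small on the finitely many vectors
  describing the neighbourhood: on two small pieces, \<open>P\<close> can be exchanged for a projection agreeing with
  \<open>Q\<close> elsewhere.

  Now let \<open>rank ((I - P)TP) \<le> R\<close> for all \<open>P\<close>, let \<open>r\<close> be the maximal such rank, attained at \<open>P\<close>, and let \<open>L\<close>
  be a projection of \<open>D\<close> such that \<open>(I - L)(I - P)TP(I - L)\<close> still has rank \<open>r\<close>. As in a bordered minor of
  maximal order, maximality forces \<open>ETF\<close>, for every splitting \<open>L = E + F\<close> in \<open>D\<close>, to coincide with \<open>EGF\<close> for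
  one operator \<open>G\<close> of rank at most \<open>r\<close>; hence \<open>LTL - G\<close> commutes with the projections of \<open>D\<close>, and so lies
  in \<open>D\<close>. All small pieces of a fine partition are of this kind, and so is the complement of at most
  \<open>2r\<close> pieces chosen to carry a nonsingular \<open>r \<times> r\<close> minor. These \<open>2r + 1\<close> blocks decompose \<open>T\<close>, their
  off-diagonal parts having rank at most \<open>R\<close>.
\<close>

section \<open>Hilbert space preliminaries\<close>

text \<open>Distinct commuting projections are at norm distance 1, so the norm topology on the
  projections of \<open>D\<close> is discrete and Baire's theorem would yield nothing beyond single
  projections; this forces the strong topology. A projection is encoded by its values along a dense
  sequence, which turns the strong topology into a product topology. The rank is only lower
  semicontinuous, so lower bounds are certified by biorthogonal systems, which tolerate small
  errors. The restriction on \<open>T\<close> in Baire's theorem disappears because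
  \<open>(I - P)TP\<close> is linear in \<open>T\<close>.

  Membership in \<open>D\<close> is detected by commutation with its projections alone. Behind this
  is a bisection: a self-adjoint element is cut by sign projections, obtained from absolute values,
  until its commutator is arbitrarily small. The pieces of rank one in a fine partition are atoms of
  \<open>D\<close>, which cannot be subdivided further. The count \<open>2r\<close> consists of
  \<open>r\<close> pieces for the columns of a nonsingular minor and \<open>r\<close> for its
  rows.\<close>

lemma Cauchy_square_boundI:
  fixes f :: "nat \<Rightarrow> 'a::real_normed_vector"
  assumes "\<And>m n. (norm (f n - f m))\<^sup>2 \<le> 2 / real (Suc n) + 2 / real (Suc m)"
  shows "Cauchy f"
proof (rule CauchyI)
  fix e :: real assume e: "e > 0"
  obtain N where N: "4 / e\<^sup>2 < real N"
    using reals_Archimedean2 by blast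
  have "norm (f m - f n) < e" if "m \<ge> N" "n \<ge> N" for m n
  proof -
    have *: "2 / real (Suc k) < e\<^sup>2 / 2" if "k \<ge> N" for k
    proof -
      have "4 / e\<^sup>2 < real (Suc k)" using N that by simp
      then show ?thesis using e by (simp add: field_simps)
    qed
    have "(norm (f m - f n))\<^sup>2 < e\<^sup>2"
      using assms[of m n] *[OF that(1)] *[OF that(2)] by simp
    then show ?thesis using e by (simp add: power_less_imp_less_base)
  qed
  then show "\<exists>M. \<forall>m\<ge>M. \<forall>n\<ge>M. norm (f m - f n) < e" by blast
qed

text \<open>By the parallelogram law a minimizing sequence for the distance to \<open>S\<close> is
  Cauchy, and its limit is a nearest point; minimality along lines through that point gives
  orthogonality.\<close>

lemma closed_subspace_projection:
  fixes S :: "'a::{real_inner,banach} set"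
  assumes "subspace S" "closed S"
  obtains y where "y \<in> S" "\<And>z. z \<in> S \<Longrightarrow> inner (x - y) z = 0"
proof -
  define d where "d = (INF z\<in>S. (norm (x - z))\<^sup>2)"
  have bdd: "bdd_below ((\<lambda>z. (norm (x - z))\<^sup>2) ` S)"
    by (rule bdd_belowI2[of _ 0]) simp
  have ne: "S \<noteq> {}"
    using assms(1) subspace_0 by blast
  have d_le: "d \<le> (norm (x - z))\<^sup>2" if "z \<in> S" for z
    unfolding d_def using bdd that by (rule cINF_lower)
  have "\<exists>z\<in>S. (norm (x - z))\<^sup>2 < d + 1 / real (Suc n)" for n
    using cINF_less_iff[OF ne bdd, of "d + 1 / real (Suc n)"] unfolding d_def[symmetric] by simp
  then obtain f where f: "\<And>n. f n \<in> S" "\<And>n. (norm (x - f n))\<^sup>2 < d + 1 / real (Suc n)"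
    by metis
  have para: "(norm (f n - f m))\<^sup>2 \<le> 2 / real (Suc n) + 2 / real (Suc m)" for m n
  proof -
    have "(1/2) *\<^sub>R (f n + f m) \<in> S"
      by (intro subspace_scale subspace_add assms f)
    from d_le[OF this] have "d \<le> (norm (x - (1/2) *\<^sub>R (f n + f m)))\<^sup>2" .
    moreover have "(norm (f n - f m))\<^sup>2 = 2 * (norm (x - f n))\<^sup>2 + 2 * (norm (x - f m))\<^sup>2
        - 4 * (norm (x - (1/2) *\<^sub>R (f n + f m)))\<^sup>2"
      by (simp add: power2_norm_eq_inner inner_simps inner_commute algebra_simps)
    ultimately show ?thesis
      using f(2)[of n] f(2)[of m] by simp
  qed
  have "Cauchy f"
    by (rule Cauchy_square_boundI) (rule para)
  then obtain y where y: "f \<longlonglongrightarrow> y"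
    using Cauchy_convergent convergent_def by blast
  have yS: "y \<in> S"
    using closed_sequentially[OF assms(2)] f(1) y by blast
  have "(\<lambda>n. (norm (x - f n))\<^sup>2) \<longlonglongrightarrow> (norm (x - y))\<^sup>2"
    by (intro tendsto_intros y)
  moreover have "(\<lambda>n. d + 1 / real (Suc n)) \<longlonglongrightarrow> d + 0"
    by (intro tendsto_add tendsto_const LIMSEQ_Suc[OF lim_1_over_n])
  ultimately have "(norm (x - y))\<^sup>2 \<le> d + 0"
    by (rule LIMSEQ_le) (use f(2) less_imp_le in blast)
  then have yd: "(norm (x - y))\<^sup>2 \<le> d" by simp
  show thesis
  proof (rule that[OF yS])
    fix z assume z: "z \<in> S"
    show "inner (x - y) z = 0"
    proof (cases "z = 0")
      case False
      \<comment> \<open>The minimizer of the squared distance from \<open>x\<close> to the line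
        through \<open>y\<close> in direction \<open>z\<close>.\<close>
      define t where "t = inner (x - y) z / inner z z"
      have pos: "inner z z > 0" using False by simp
      have "y + t *\<^sub>R z \<in> S"
        by (intro subspace_scale subspace_add assms yS z)
      from d_le[OF this] yd have "(norm (x - y))\<^sup>2 \<le> (norm (x - (y + t *\<^sub>R z)))\<^sup>2"
        by linarith
      also have "\<dots> = (norm (x - y))\<^sup>2 - 2 * t * inner (x - y) z + t * t * inner z z"
        by (simp add: power2_norm_eq_inner inner_simps inner_commute algebra_simps)
      also have "t * t * inner z z = t * inner (x - y) z"
        using pos by (simp add: t_def)
      finally have "t * inner (x - y) z \<le> 0" by simp
      then have "inner (x - y) z * inner (x - y) z \<le> 0"
        using pos by (simp add: t_def divide_le_0_iff)
      then show ?thesis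
        by (metis dual_order.antisym mult_eq_0_iff zero_le_square)
    qed simp
  qed
qed

text \<open>The kernel of a nonzero \<open>f\<close> has a nonzero normal vector \<open>w\<close>,
  and every \<open>v\<close> differs from a multiple of \<open>w\<close> by a vector of the
  kernel.\<close>

lemma riesz_representation:
  fixes f :: "'a::{real_inner,banach} \<Rightarrow> real"
  assumes "bounded_linear f"
  obtains y where "\<And>x. f x = inner x y"
proof (cases "\<forall>x. f x = 0")
  case True
  then show ?thesis using that[of 0] by simp
next
  case False
  then obtain x where x: "f x \<noteq> 0" by blast
  interpret f: bounded_linear f by fact
  define S where "S = {z. f z = 0}"
  have "subspace S"
    by (auto simp: S_def subspace_def f.add f.zero f.scaleR)
  moreover have "closed S"
    unfolding S_def by (intro closed_Collect_eq f.continuous_on continuous_intros)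
  ultimately obtain p where p: "p \<in> S" "\<And>z. z \<in> S \<Longrightarrow> inner (x - p) z = 0"
    using closed_subspace_projection by blast
  define w where "w = x - p"
  have fw: "f w = f x" using p(1) by (simp add: w_def f.diff S_def)
  then have "w \<noteq> 0" using x f.zero by auto
  have "f v = inner v ((f w / inner w w) *\<^sub>R w)" for v
  proof -
    have "v - (f v / f w) *\<^sub>R w \<in> S"
      using x fw by (simp add: S_def f.diff f.scaleR)
    then have "inner w (v - (f v / f w) *\<^sub>R w) = 0" using p(2) by (simp add: w_def)
    then have "inner v w * f w = f v * inner w w"
      using x fw by (simp add: inner_diff_right inner_commute field_simps)
    then show ?thesis using \<open>w \<noteq> 0\<close> by (simp add: field_simps)
  qed
  then show ?thesis by (rule that)
qed

lemma real_adjoint_exists: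
  fixes T :: "'a::{real_inner,banach} \<Rightarrow>\<^sub>L 'a"
  obtains S :: "'a \<Rightarrow>\<^sub>L 'a" where "\<And>x y. inner (blinfun_apply T x) y = inner x (blinfun_apply S y)"
proof -
  have "\<exists>z. \<forall>x. inner (T x) y = inner x z" for y
  proof -
    have "bounded_linear (\<lambda>x. inner (T x) y)"
      by (rule bounded_linear_compose[OF bounded_linear_inner_left blinfun.bounded_linear_right])
    then show ?thesis using riesz_representation by blast
  qed
  then obtain S where S: "\<And>x y. inner (T x) y = inner x (S y)" by metis
  have "bounded_linear S"
  proof (rule bounded_linear_intro[where K = "norm T"])
    show "S (x + y) = S x + S y" for x y
      by (rule vector_eq_ldot[THEN iffD1]) (simp add: S[symmetric] inner_add_right)
    show "S (r *\<^sub>R x) = r *\<^sub>R S x" for x r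
      by (rule vector_eq_ldot[THEN iffD1]) (simp add: S[symmetric])
    show "norm (S y) \<le> norm y * norm T" for y
    proof -
      have "(norm (S y))\<^sup>2 = inner (T (S y)) y" by (simp add: S power2_norm_eq_inner)
      also have "\<dots> \<le> norm (T (S y)) * norm y" by (rule norm_cauchy_schwarz)
      also have "\<dots> \<le> norm T * norm (S y) * norm y"
        by (intro mult_right_mono norm_blinfun) simp
      finally have "norm (S y) * norm (S y) \<le> norm (S y) * (norm y * norm T)"
        by (simp add: power2_eq_square mult_ac)
      then show ?thesis
        by (cases "norm (S y) = 0") auto
    qed
  qed
  then show thesis
    using that[of "Blinfun S"] S by (simp add: bounded_linear_Blinfun_apply)
qed

section \<open>The complex inner product and complex linearity in terms of the real
  structure\<close>

lemma cinner_eq_Complex: "cinner x y = Complex (inner x y) (inner x (\<i> *\<^sub>C y))"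
proof (rule complex_eqI)
  have "cinner x (\<i> *\<^sub>C y) = - \<i> * cinner x y"
    by (metis cinner_commute cinner_scaleC_left complex_cnj_i complex_cnj_mult)
  from arg_cong[OF this, of Re] show "Im (cinner x y) = Im (Complex (inner x y) (inner x (\<i> *\<^sub>C y)))"
    by (simp add: Re_cinner)
qed (simp add: Re_cinner)

lemma scaleC_Complex: "Complex a b *\<^sub>C x = a *\<^sub>R x + b *\<^sub>R (\<i> *\<^sub>C (x::'a::complex_vector))"
proof -
  have "Complex a b = complex_of_real a + complex_of_real b * \<i>"
    by (simp add: Complex_eq)
  then show ?thesis
    by (simp only: scaleC_add_left scaleC_of_real flip: scaleC_scaleC)
qed

lemma inner_scaleC_i_left: "inner (\<i> *\<^sub>C x) y = - inner x (\<i> *\<^sub>C (y::'a::complex_inner))"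
proof -
  have "cinner (\<i> *\<^sub>C x) y = \<i> * cinner x y" by (rule cinner_scaleC_left)
  from arg_cong[OF this, of Re] show ?thesis
    by (simp add: cinner_eq_Complex)
qed

lemma cinner_add_right: "cinner x (y + z) = cinner x y + cinner x z"
  by (metis cinner_add_left cinner_commute complex_cnj_add)

lemma cinner_scaleC_right: "cinner x (a *\<^sub>C y) = cnj a * cinner x y"
  by (metis cinner_commute cinner_scaleC_left complex_cnj_mult)

lemma cinner_zero_left [simp]: "cinner 0 x = 0"
  by (metis add_cancel_right_left cinner_add_left)

lemma cinner_diff_left: "cinner (x - y) z = cinner x z - cinner y z"
  by (metis add_diff_cancel_right' cinner_add_left diff_add_cancel)

lemma cinner_diff_right: "cinner x (y - z) = cinner x y - cinner x z"
  by (metis add_diff_cancel_right' cinner_add_right diff_add_cancel)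

lemma cinner_sum_left: "cinner (sum f I) y = (\<Sum>i\<in>I. cinner (f i) y)"
  by (induction I rule: infinite_finite_induct) (simp_all add: cinner_add_left)

lemma norm_cinner_le: "cmod (cinner x y) \<le> norm x * norm y"
proof (cases "cinner x y = 0")
  case False
  define c where "c = cnj (cinner x y) / cmod (cinner x y)"
  have "cmod c = 1" using False by (simp add: c_def norm_divide)
  have "c * cinner x y = cmod (cinner x y)"
  proof -
    have "cnj (cinner x y) * cinner x y = complex_of_real (cmod (cinner x y)) * cmod (cinner x y)"
      by (metis complex_norm_square mult.commute of_real_power power2_eq_square)
    then show ?thesis using False by (simp add: c_def)
  qed
  then have "cinner (c *\<^sub>C x) y = cmod (cinner x y)"
    by (simp add: cinner_scaleC_left)
  then have "inner (c *\<^sub>C x) y = cmod (cinner x y)"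
    using Re_cinner[of "c *\<^sub>C x" y] by simp
  then show ?thesis
    using norm_cauchy_schwarz[of "c *\<^sub>C x" y] \<open>cmod c = 1\<close> by (simp add: norm_scaleC)
qed simp

lemma tendsto_cinner [tendsto_intros]:
  assumes "(f \<longlongrightarrow> x) F" "(g \<longlongrightarrow> y) F"
  shows "((\<lambda>n. cinner (f n) (g n)) \<longlongrightarrow> cinner x y) F"
  unfolding cinner_eq_Complex
  by (intro tendsto_Complex tendsto_inner assms bounded_linear.tendsto[OF bounded_linear_scaleC_right])

lemma bounded_opsD: "T \<in> bounded_ops \<Longrightarrow> blinfun_apply T (a *\<^sub>C x) = a *\<^sub>C blinfun_apply T x"
  by (simp add: bounded_ops_def)

lemma bounded_opsI_i:
  assumes "\<And>x. blinfun_apply T (\<i> *\<^sub>C x) = \<i> *\<^sub>C blinfun_apply T x"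
  shows "T \<in> bounded_ops"
proof -
  have "blinfun_apply T (a *\<^sub>C x) = a *\<^sub>C blinfun_apply T x" for a x
    by (cases a) (simp add: scaleC_Complex blinfun.add_right blinfun.scaleR_right assms)
  then show ?thesis by (simp add: bounded_ops_def)
qed

text \<open>An adjoint for the real inner product is one for the complex inner product: the
  imaginary part of \<open>cinner x y\<close> is the real inner product of \<open>x\<close> with
  \<open>\<i> *\<^sub>C y\<close>, and the adjoint inherits commutation with
  \<open>\<i>\<close>.\<close>

lemma bounded_ops_adjoint:
  assumes "\<And>x y. inner (blinfun_apply T x) y = inner x (blinfun_apply S y)" and "T \<in> bounded_ops"
  shows "S \<in> bounded_ops" "cinner (blinfun_apply T x) y = cinner x (blinfun_apply S y)"
proof -
  have S: "S (\<i> *\<^sub>C y) = \<i> *\<^sub>C S y" for y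
  proof (rule vector_eq_ldot[THEN iffD1], intro allI)
    fix x
    have "inner x (S (\<i> *\<^sub>C y)) = inner (T x) (\<i> *\<^sub>C y)" by (simp add: assms)
    also have "\<dots> = - inner (T (\<i> *\<^sub>C x)) y"
      using inner_scaleC_i_left[of "T x" y] by (simp add: bounded_opsD[OF assms(2)])
    also have "\<dots> = inner x (\<i> *\<^sub>C S y)"
      using inner_scaleC_i_left[of x "S y"] by (simp add: assms)
    finally show "inner x (S (\<i> *\<^sub>C y)) = inner x (\<i> *\<^sub>C S y)" .
  qed
  then show "S \<in> bounded_ops" by (rule bounded_opsI_i)
  show "cinner (T x) y = cinner x (S y)"
    by (simp add: cinner_eq_Complex assms S)
qed

lemma adjoint_exists:
  assumes "T \<in> bounded_ops"
  shows "cadjoint T \<in> bounded_ops"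
    and "cinner (blinfun_apply T x) y = cinner x (blinfun_apply (cadjoint T) y)"
    and "inner (blinfun_apply T x) y = inner x (blinfun_apply (cadjoint T) y)"
proof -
  obtain S where S: "\<And>x y. inner (blinfun_apply T x) y = inner x (blinfun_apply S y)"
    using real_adjoint_exists by blast
  note * = bounded_ops_adjoint[OF S assms]
  have "cadjoint T = S"
    by (rule cadjoint_eqI) (rule *)
  then show "cadjoint T \<in> bounded_ops"
    "cinner (blinfun_apply T x) y = cinner x (blinfun_apply (cadjoint T) y)"
    "inner (blinfun_apply T x) y = inner x (blinfun_apply (cadjoint T) y)"
    using * S by auto
qed

lemma cadjoint_eqI_inner:
  assumes "T \<in> bounded_ops" "\<And>x y. inner (blinfun_apply T x) y = inner x (blinfun_apply S y)"
  shows "cadjoint T = S"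
  by (rule cadjoint_eqI) (rule bounded_ops_adjoint[OF assms(2,1)])

text \<open>The nearest point is characterized by orthogonality, so linearity and every other
  identity for the map reduce to \<open>uniq\<close>.\<close>

lemma closed_subspace_projector:
  fixes S :: "'a::chilbert_space set"
  assumes "complex_vector.subspace S" "closed S"
  obtains P :: "'a \<Rightarrow>\<^sub>L 'a" where "P \<in> bounded_ops" "\<And>x y. inner (P x) y = inner x (P y)"
    "\<And>x. P x \<in> S" "\<And>x. x \<in> S \<Longrightarrow> P x = x"
proof -
  have S_i: "\<i> *\<^sub>C x \<in> S" if "x \<in> S" for x
    using assms(1) that complex_vector.subspace_scale by blast
  have sub: "subspace S"
    using assms(1) unfolding subspace_def complex_vector.subspace_def
    by (metis scaleC_of_real)
  have "\<exists>y\<in>S. \<forall>z\<in>S. inner (x - y) z = 0" for x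
    using closed_subspace_projection[OF sub assms(2)] by metis
  then obtain P where P: "\<And>x. P x \<in> S" "\<And>x z. z \<in> S \<Longrightarrow> inner (x - P x) z = 0"
    by metis
  have uniq: "P x = y" if y: "y \<in> S" and orth: "\<And>z. z \<in> S \<Longrightarrow> inner (x - y) z = 0" for x y
  proof -
    have "P x - y \<in> S" using P(1) y sub by (simp add: subspace_diff)
    then have "inner (P x - y) (P x - y) = 0"
      using P(2)[of "P x - y" x] orth[of "P x - y"] by (simp add: inner_diff_left)
    then show ?thesis by simp
  qed
  have "bounded_linear P"
  proof (rule bounded_linear_intro[where K = 1])
    show "P (x + y) = P x + P y" for x y
    proof (rule uniq)
      show "inner (x + y - (P x + P y)) z = 0" if "z \<in> S" for z
        using P(2)[OF that, of x] P(2)[OF that, of y] by (simp add: inner_simps)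
    qed (use P sub subspace_add in blast)
    show "P (r *\<^sub>R x) = r *\<^sub>R P x" for r x
    proof (rule uniq)
      show "inner (r *\<^sub>R x - r *\<^sub>R P x) z = 0" if "z \<in> S" for z
        using P(2)[OF that, of x] by (simp flip: scaleR_diff_right)
    qed (use P sub subspace_scale in blast)
    show "norm (P x) \<le> norm x * 1" for x
    proof -
      have "inner x (P x) = inner (P x) (P x)"
        using P(2)[OF P(1), of x x] by (simp add: inner_diff_left)
      then have "(norm (P x))\<^sup>2 \<le> norm x * norm (P x)"
        using norm_cauchy_schwarz[of x "P x"] by (simp add: power2_norm_eq_inner)
      then show ?thesis by (cases "P x = 0") (auto simp: power2_eq_square)
    qed
  qed
  then have app: "blinfun_apply (Blinfun P) = P"
    by (rule bounded_linear_Blinfun_apply)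
  show thesis
  proof (rule that[of "Blinfun P"], unfold app)
    show "Blinfun P \<in> bounded_ops"
    proof (rule bounded_opsI_i, unfold app, rule uniq)
      fix x z assume "z \<in> S"
      then have "inner (x - P x) (\<i> *\<^sub>C z) = 0" using P(2) S_i by blast
      then show "inner (\<i> *\<^sub>C x - \<i> *\<^sub>C P x) z = 0"
        using inner_scaleC_i_left[of "x - P x" z] by (simp add: complex_vector.scale_right_diff_distrib)
    qed (use P(1) S_i in blast)
    show "inner (P x) y = inner x (P y)" for x y
      using P(2)[OF P(1), of x y] P(2)[OF P(1), of y x]
      by (simp add: inner_diff_left inner_diff_right inner_commute)
    show "P x = x" if "x \<in> S" for x
      using that by (intro uniq) auto
  qed (rule P(1))
qed

section \<open>Commutants and masas\<close>

lemma bounded_ops_add: "X \<in> bounded_ops \<Longrightarrow> Y \<in> bounded_ops \<Longrightarrow> X + Y \<in> bounded_ops"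
  by (simp add: bounded_ops_def blinfun.add_left scaleC_add_right)

lemma bounded_ops_diff: "X \<in> bounded_ops \<Longrightarrow> Y \<in> bounded_ops \<Longrightarrow> X - Y \<in> bounded_ops"
  by (simp add: bounded_ops_def blinfun.diff_left complex_vector.scale_right_diff_distrib)

lemma bounded_ops_scaleC: "X \<in> bounded_ops \<Longrightarrow> a *\<^sub>C X \<in> bounded_ops"
  by (simp add: bounded_ops_def scaleC_blinfun.rep_eq scaleC_scaleC mult.commute)

lemma bounded_ops_compose: "X \<in> bounded_ops \<Longrightarrow> Y \<in> bounded_ops \<Longrightarrow> X o\<^sub>L Y \<in> bounded_ops"
  by (simp add: bounded_ops_def)

lemma bounded_ops_zero [simp]: "0 \<in> bounded_ops"
  by (simp add: bounded_ops_def)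

lemma bounded_ops_id [simp]: "id_blinfun \<in> bounded_ops"
  by (simp add: bounded_ops_def)

lemma bounded_ops_sum: "(\<And>i. i \<in> I \<Longrightarrow> f i \<in> bounded_ops) \<Longrightarrow> sum f I \<in> bounded_ops"
  by (induction I rule: infinite_finite_induct) (auto intro: bounded_ops_add)

lemma cadjoint_cadjoint [simp]:
  assumes "T \<in> bounded_ops"
  shows "cadjoint (cadjoint T) = T"
proof (rule cadjoint_eqI_inner)
  show "inner (cadjoint T x) y = inner x (T y)" for x y
    using adjoint_exists(3)[OF assms, of y x] by (simp add: inner_commute)
qed (rule adjoint_exists[OF assms])

lemma cadjoint_compose:
  "X \<in> bounded_ops \<Longrightarrow> Y \<in> bounded_ops \<Longrightarrow> cadjoint (X o\<^sub>L Y) = cadjoint Y o\<^sub>L cadjoint X"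
  by (rule cadjoint_eqI_inner) (simp_all add: adjoint_exists bounded_ops_compose)

lemma cadjoint_add:
  "X \<in> bounded_ops \<Longrightarrow> Y \<in> bounded_ops \<Longrightarrow> cadjoint (X + Y) = cadjoint X + cadjoint Y"
  by (rule cadjoint_eqI_inner)
    (simp_all add: adjoint_exists bounded_ops_add blinfun.add_left inner_simps)

lemma cadjoint_diff:
  "X \<in> bounded_ops \<Longrightarrow> Y \<in> bounded_ops \<Longrightarrow> cadjoint (X - Y) = cadjoint X - cadjoint Y"
  by (rule cadjoint_eqI_inner)
    (simp_all add: adjoint_exists bounded_ops_diff blinfun.diff_left inner_simps)

lemma cadjoint_scaleC:
  "X \<in> bounded_ops \<Longrightarrow> cadjoint (a *\<^sub>C X) = cnj a *\<^sub>C cadjoint X"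
  by (rule cadjoint_eqI)
    (simp add: adjoint_exists scaleC_blinfun.rep_eq cinner_scaleC_left cinner_scaleC_right)

lemma cadjoint_eq_selfD:
  assumes "T \<in> bounded_ops" "cadjoint T = T"
  shows "inner (blinfun_apply T x) y = inner x (blinfun_apply T y)"
  using adjoint_exists(3)[OF assms(1)] assms(2) by metis

lemma cartesian_decomposition:
  assumes "X \<in> bounded_ops"
  defines "H \<equiv> X + cadjoint X" and "K \<equiv> \<i> *\<^sub>C (X - cadjoint X)"
  shows "cadjoint H = H" "cadjoint K = K" "X = (1/2) *\<^sub>C (H + (- \<i>) *\<^sub>C K)"
proof -
  show "cadjoint H = H"
    using assms(1) by (simp add: H_def cadjoint_add adjoint_exists add.commute)
  have "cadjoint K = (- \<i>) *\<^sub>C (cadjoint X - X)"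
    using assms(1) by (simp add: K_def cadjoint_diff adjoint_exists cadjoint_scaleC bounded_ops_diff)
  then show "cadjoint K = K"
    by (simp add: K_def complex_vector.scale_right_diff_distrib)
  have "H + (- \<i>) *\<^sub>C K = X + X"
    by (simp add: H_def K_def scaleC_scaleC)
  also have "\<dots> = 2 *\<^sub>C X"
    by (metis scaleC_add_left scaleC_one one_add_one)
  finally show "X = (1/2) *\<^sub>C (H + (- \<i>) *\<^sub>C K)"
    by (simp add: scaleC_scaleC)
qed

definition commutant :: "('a::chilbert_space \<Rightarrow>\<^sub>L 'a) set \<Rightarrow> ('a \<Rightarrow>\<^sub>L 'a) set" where
  "commutant S = {X \<in> bounded_ops. \<forall>Y\<in>S. X o\<^sub>L Y = Y o\<^sub>L X}"

lemma operator_algebra_commutant: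
  assumes "S \<subseteq> bounded_ops"
  shows "operator_algebra (commutant S)"
proof -
  have ext: "X o\<^sub>L Y = Y o\<^sub>L X \<longleftrightarrow> (\<forall>x. X (Y x) = Y (X x))" for X Y :: "'a \<Rightarrow>\<^sub>L 'a"
    by (metis blinfun_apply_blinfun_compose blinfun_eqI)
  have "complex_vector.subspace (commutant S)"
    using assms unfolding complex_vector.subspace_def commutant_def ext
    by (auto simp: bounded_ops_add bounded_ops_scaleC blinfun.add_left blinfun.add_right
        scaleC_blinfun.rep_eq bounded_opsD subset_iff)
  then show ?thesis
    unfolding operator_algebra_def
    by (auto simp: commutant_def ext bounded_ops_compose)
qed

lemma cadjoint_commutant:
  assumes S: "S \<subseteq> bounded_ops" "\<And>Y. Y \<in> S \<Longrightarrow> cadjoint Y \<in> S" and X: "X \<in> commutant S"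
  shows "cadjoint X \<in> commutant S"
proof -
  have Xb: "X \<in> bounded_ops" using X by (simp add: commutant_def)
  have "cadjoint X o\<^sub>L Y = Y o\<^sub>L cadjoint X" if Y: "Y \<in> S" for Y
  proof -
    have Yb: "Y \<in> bounded_ops" using Y S by blast
    have "X o\<^sub>L cadjoint Y = cadjoint Y o\<^sub>L X"
      using X S(2)[OF Y] by (simp add: commutant_def)
    from arg_cong[OF this, of cadjoint] show ?thesis
      by (simp add: cadjoint_compose Xb Yb adjoint_exists)
  qed
  then show ?thesis by (simp add: commutant_def adjoint_exists Xb)
qed

locale masa_algebra =
  fixes D :: "('a::chilbert_space \<Rightarrow>\<^sub>L 'a) set"
  assumes masa: "masa D"
begin

lemma D_bounded: "d \<in> D \<Longrightarrow> d \<in> bounded_ops"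
  and D_subspace: "complex_vector.subspace D"
  and D_compose: "d \<in> D \<Longrightarrow> e \<in> D \<Longrightarrow> d o\<^sub>L e \<in> D"
  and D_comm: "d \<in> D \<Longrightarrow> e \<in> D \<Longrightarrow> d o\<^sub>L e = e o\<^sub>L d"
  and D_cadjoint: "d \<in> D \<Longrightarrow> cadjoint d \<in> D"
  using masa by (auto simp: masa_def abelian_sa_algebra_def operator_algebra_def)

lemma D_comm_apply: "d \<in> D \<Longrightarrow> e \<in> D \<Longrightarrow> d (e x) = e (d x)"
  using D_comm[of d e] by (metis blinfun_apply_blinfun_compose)

lemma D_add: "d \<in> D \<Longrightarrow> e \<in> D \<Longrightarrow> d + e \<in> D"
  using D_subspace by (rule complex_vector.subspace_add)

lemma D_diff: "d \<in> D \<Longrightarrow> e \<in> D \<Longrightarrow> d - e \<in> D"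
  using D_subspace by (rule complex_vector.subspace_diff)

lemma D_scaleC: "d \<in> D \<Longrightarrow> a *\<^sub>C d \<in> D"
  using D_subspace by (rule complex_vector.subspace_scale)

lemma D_scaleR: "d \<in> D \<Longrightarrow> r *\<^sub>R d \<in> D"
  using D_scaleC[of d "complex_of_real r"] by (simp add: scaleC_of_real)

lemma D_zero: "0 \<in> D"
  using D_subspace by (rule complex_vector.subspace_0)

text \<open>Adjoining \<open>B\<close> to \<open>D\<close> gives a commuting self-adjoint set, in
  general not an algebra. Its double commutant is an abelian self-adjoint algebra containing it, so
  maximality makes that algebra equal to \<open>D\<close>.\<close>

lemma self_adjoint_commutant_subset:
  assumes B: "B \<in> commutant D" "cadjoint B = B"
  shows "B \<in> D"
proof -
  define S where "S = insert B D"
  have Sb: "S \<subseteq> bounded_ops"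
    using B D_bounded by (auto simp: S_def commutant_def)
  have Sadj: "cadjoint Y \<in> S" if "Y \<in> S" for Y
    using that B D_cadjoint by (auto simp: S_def)
  have Sc: "S \<subseteq> commutant S"
    using B D_comm D_bounded by (auto simp: S_def commutant_def)
  define C where "C = commutant S"
  have Cb: "C \<subseteq> bounded_ops" by (auto simp: C_def commutant_def)
  have Cadj: "cadjoint Y \<in> C" if "Y \<in> C" for Y
    using cadjoint_commutant[OF Sb Sadj] that by (simp add: C_def)
  \<comment> \<open>A commutative \<open>S\<close> lies in its commutant \<open>C\<close>; passing
    to commutants reverses the inclusion, and this makes the double commutant abelian.\<close>
  have CC: "commutant C \<subseteq> C"
    using Sc by (auto simp: C_def commutant_def)
  have "abelian_sa_algebra (commutant C)"
    unfolding abelian_sa_algebra_def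
    using operator_algebra_commutant[OF Cb] cadjoint_commutant[OF Cb Cadj] CC
    by (auto simp: commutant_def)
  moreover have "S \<subseteq> commutant C"
    using Sb by (auto simp: C_def commutant_def)
  ultimately have "commutant C = D" "B \<in> commutant C"
    using masa by (auto simp: masa_def S_def)
  then show ?thesis by simp
qed

theorem commutant_D: "commutant D = D"
proof
  show "D \<subseteq> commutant D"
    using D_bounded D_comm by (auto simp: commutant_def)
  show "commutant D \<subseteq> D"
  proof
    fix X assume X: "X \<in> commutant D"
    have Db: "D \<subseteq> bounded_ops" using D_bounded by blast
    have Xb: "X \<in> bounded_ops" using X by (simp add: commutant_def)
    have sub: "complex_vector.subspace (commutant D)"
      using operator_algebra_commutant[OF Db] by (simp add: operator_algebra_def)
    have X': "cadjoint X \<in> commutant D"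
      using cadjoint_commutant[OF Db D_cadjoint X] .
    note dec = cartesian_decomposition[OF Xb]
    have "X + cadjoint X \<in> D" "\<i> *\<^sub>C (X - cadjoint X) \<in> D"
      by (intro self_adjoint_commutant_subset dec complex_vector.subspace_add[OF sub]
          complex_vector.subspace_scale[OF sub] complex_vector.subspace_diff[OF sub] X X')+
    then have "(1/2) *\<^sub>C ((X + cadjoint X) + (- \<i>) *\<^sub>C (\<i> *\<^sub>C (X - cadjoint X))) \<in> D"
      by (rule D_scaleC[OF D_add[OF _ D_scaleC]])
    then show "X \<in> D"
      by (simp only: dec(3)[symmetric])
  qed
qed

lemma D_I: "X \<in> bounded_ops \<Longrightarrow> (\<And>d x. d \<in> D \<Longrightarrow> X (d x) = d (X x)) \<Longrightarrow> X \<in> D"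
  by (subst commutant_D[symmetric]) (auto simp: commutant_def intro!: blinfun_eqI)

text \<open>Algebras need not be unital, but the identity commutes with everything, so maximality
  puts it into \<open>D\<close>.\<close>

lemma D_id: "id_blinfun \<in> D"
  by (rule D_I) auto

section \<open>Lattice operations on the projections of the masa\<close>

abbreviation PD :: "('a \<Rightarrow>\<^sub>L 'a) set" where "PD \<equiv> projections D"

lemma PD_iff:
  "P \<in> PD \<longleftrightarrow> P \<in> D \<and> (\<forall>x. P (P x) = P x) \<and> (\<forall>x y. inner (P x) y = inner x (P y))"
proof -
  have "P o\<^sub>L P = P \<longleftrightarrow> (\<forall>x. P (P x) = P x)"
    by (metis blinfun_apply_blinfun_compose blinfun_eqI)
  moreover have "cadjoint P = P \<longleftrightarrow> (\<forall>x y. inner (P x) y = inner x (P y))" if "P \<in> D"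
    using cadjoint_eq_selfD[OF D_bounded[OF that]] cadjoint_eqI_inner[OF D_bounded[OF that]]
    by blast
  ultimately show ?thesis by (auto simp: projections_def)
qed

lemma PD_D: "p \<in> PD \<Longrightarrow> p \<in> D"
  and PD_idem: "p \<in> PD \<Longrightarrow> p (p x) = p x"
  and PD_sa: "p \<in> PD \<Longrightarrow> inner (p x) y = inner x (p y)"
  by (auto simp: PD_iff)

lemma PD_bounded: "p \<in> PD \<Longrightarrow> p \<in> bounded_ops"
  by (simp add: PD_D D_bounded)

lemma PD_comm: "p \<in> PD \<Longrightarrow> q \<in> PD \<Longrightarrow> p (q x) = q (p x)"
  by (simp add: PD_D D_comm_apply)

lemma PD_cinner_sa:
  assumes "p \<in> PD"
  shows "cinner (p x) y = cinner x (p y)"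
  using bounded_ops_adjoint(2)[OF PD_sa[OF assms] PD_bounded[OF assms]] .

lemma PD_zero: "0 \<in> PD"
  by (simp add: PD_iff D_zero)

lemma PD_id: "id_blinfun \<in> PD"
  by (simp add: PD_iff D_id)

lemma PD_compl: "p \<in> PD \<Longrightarrow> id_blinfun - p \<in> PD"
  by (simp add: PD_iff D_diff D_id blinfun.diff_left blinfun.diff_right inner_simps)

lemma PD_compose: "p \<in> PD \<Longrightarrow> q \<in> PD \<Longrightarrow> p o\<^sub>L q \<in> PD"
  unfolding PD_iff[of "p o\<^sub>L q"]
  by (auto simp: D_compose PD_D PD_comm[of p q] PD_idem PD_sa)

lemma PD_diff: "p \<in> PD \<Longrightarrow> q \<in> PD \<Longrightarrow> (\<And>x. p (q x) = q x) \<Longrightarrow> p - q \<in> PD"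
  unfolding PD_iff[of "p - q"]
  by (auto simp: D_diff PD_D PD_comm[of q p] PD_idem PD_sa blinfun.diff_left blinfun.diff_right inner_simps)

lemma PD_add:
  assumes "p \<in> PD" "q \<in> PD" "\<And>x. p (q x) = 0"
  shows "p + q \<in> PD"
  using assms unfolding PD_iff[of "p + q"]
  by (auto simp: D_add PD_D PD_comm[of q p] PD_idem PD_sa blinfun.add_left blinfun.add_right inner_simps)

lemma PD_pythagoras:
  assumes "p \<in> PD"
  shows "(norm x)\<^sup>2 = (norm (p x))\<^sup>2 + (norm (x - p x))\<^sup>2"
proof -
  have "inner (p x) (p x) = inner x (p x)"
    using PD_sa[OF assms, of x "p x"] PD_idem[OF assms] by simp
  then show ?thesis
    by (simp add: power2_norm_eq_inner inner_simps inner_commute)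
qed

lemma PD_norm_le: "p \<in> PD \<Longrightarrow> norm (p x) \<le> norm x"
  using PD_pythagoras[of p x] by (simp add: power2_le_imp_le)

lemma PD_union:
  assumes "p \<in> PD" "q \<in> PD"
  shows "p + q - (p o\<^sub>L q) \<in> PD"
proof -
  have "p + ((id_blinfun - p) o\<^sub>L q) \<in> PD"
    by (intro PD_add PD_compose PD_compl assms)
      (simp add: blinfun.diff_left blinfun.diff_right PD_idem assms)
  also have "p + ((id_blinfun - p) o\<^sub>L q) = p + q - (p o\<^sub>L q)"
    by (rule blinfun_eqI) (simp add: blinfun.diff_left blinfun.add_left)
  finally show ?thesis .
qed

text \<open>As \<open>D\<close> is self-adjoint, an invariant subspace reduces it: taking adjoints
  in \<open>P d P = d P\<close> gives \<open>P d = P d P\<close>, so the projector commutes with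
  \<open>D\<close> and lies in \<open>D\<close> by maximality. Sign projections and infima of chains
  arise in this way.\<close>

lemma PD_subspace:
  assumes "complex_vector.subspace S" "closed S" "\<And>d x. d \<in> D \<Longrightarrow> x \<in> S \<Longrightarrow> d x \<in> S"
  obtains P where "P \<in> PD" "\<And>x. P x \<in> S" "\<And>x. x \<in> S \<Longrightarrow> P x = x"
proof -
  obtain P :: "'a \<Rightarrow>\<^sub>L 'a" where P: "P \<in> bounded_ops" "\<And>x y. inner (P x) y = inner x (P y)"
    "\<And>x. P x \<in> S" "\<And>x. x \<in> S \<Longrightarrow> P x = x"
    using closed_subspace_projector[OF assms(1,2)] by blast
  have inv: "P (d (P x)) = d (P x)" if "d \<in> D" for d x
    using P assms(3)[OF that] by blast
  have "P (d x) = P (d (P x))" if d: "d \<in> D" for d x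
  proof (rule vector_eq_ldot[THEN iffD1, rule_format])
    fix y
    have adj: "inner (d u) v = inner u (cadjoint d v)" for u v
      using adjoint_exists(3)[OF D_bounded[OF d]] .
    have adj': "inner u (d v) = inner (cadjoint d u) v" for u v
      using adj[of v u] by (simp add: inner_commute)
    have "inner y (P (d x)) = inner (P y) (d x)" by (simp add: P)
    also have "\<dots> = inner (cadjoint d (P y)) x" by (rule adj')
    also have "\<dots> = inner (P (cadjoint d (P y))) x" using inv[OF D_cadjoint[OF d]] by simp
    also have "\<dots> = inner (cadjoint d (P y)) (P x)" by (simp add: P)
    also have "\<dots> = inner (P y) (d (P x))" by (rule adj'[symmetric])
    also have "\<dots> = inner y (P (d (P x)))" by (simp add: P)
    finally show "inner y (P (d x)) = inner y (P (d (P x)))" .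
  qed
  then have "P \<in> D" using inv P(1) by (intro D_I) auto
  then show thesis
    using that[of P] P by (simp add: PD_iff)
qed

end

section \<open>Absolute values and spectral projections\<close>

text \<open>
  \<open>1 - |s|\<close> is the limit of the iteration \<open>y \<mapsto> (a + y\<^sup>2) / 2\<close> with \<open>a = 1 - s\<^sup>2\<close>; its steps are dominated in
  norm by those of the scalar iteration \<open>r \<mapsto> (1 + r\<^sup>2) / 2\<close>, which increases to \<open>1\<close>.
\<close>

lemma contraction_absolute_value:
  fixes s :: "'a::{real_inner,banach} \<Rightarrow>\<^sub>L 'a"
  assumes sa: "\<And>x y. inner (s x) y = inner x (s y)" and contr: "\<And>x. norm (s x) \<le> norm x"
  shows "\<exists>b :: 'a \<Rightarrow>\<^sub>L 'a. (\<forall>x y. inner (b x) y = inner x (b y)) \<and>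
    (\<forall>x. 0 \<le> inner (b x) x) \<and> (\<forall>x. b (b x) = s (s x)) \<and>
    (\<forall>X :: 'a \<Rightarrow>\<^sub>L 'a. (\<forall>x. X (s x) = s (X x)) \<longrightarrow> (\<forall>x. X (b x) = b (X x)))"
proof -
  define a where "a = id_blinfun - (s o\<^sub>L s)"
  have a_apply: "a x = x - s (s x)" for x
    by (simp add: a_def blinfun.diff_left)
  have a_norm: "norm a \<le> 1"
  proof (rule norm_blinfun_bound)
    fix x
    have "(norm (a x))\<^sup>2 = (norm x)\<^sup>2 - 2 * (norm (s x))\<^sup>2 + (norm (s (s x)))\<^sup>2"
      by (simp add: a_apply power2_norm_eq_inner inner_simps sa inner_commute)
    also have "\<dots> \<le> (norm x)\<^sup>2"
      using power_mono[OF contr[of "s x"] norm_ge_zero, of 2] zero_le_power2[of "norm (s x)"] by linarith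
    finally have "norm (a x) \<le> norm x" by (rule power2_le_imp_le) simp
    then show "norm (a x) \<le> 1 * norm x" by simp
  qed simp
  define y :: "nat \<Rightarrow> 'a \<Rightarrow>\<^sub>L 'a" where "y = rec_nat 0 (\<lambda>_ z. (1/2) *\<^sub>R (a + (z o\<^sub>L z)))"
  define r :: "nat \<Rightarrow> real" where "r = rec_nat 0 (\<lambda>_ z. (1/2) * (1 + z * z))"
  have y_simps: "y 0 = 0" "y (Suc n) = (1/2) *\<^sub>R (a + (y n o\<^sub>L y n))" for n
    by (simp_all add: y_def)
  have r_simps: "r 0 = 0" "r (Suc n) = (1/2) * (1 + r n * r n)" for n
    by (simp_all add: r_def)
  have y_apply: "y (Suc n) x = (1/2) *\<^sub>R (a x + y n (y n x))" for n x
    by (simp add: y_simps blinfun.scaleR_left blinfun.add_left)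
  \<comment> \<open>Whatever commutes with \<open>a\<close> commutes with every iterate; applied to
    \<open>a\<close> itself and then to the iterates, this makes the iterates commute with one
    another.\<close>
  have comm: "X (y n x) = y n (X x)" if "\<And>x. X (a x) = a (X x)" for X :: "'a \<Rightarrow>\<^sub>L 'a" and n x
    by (induction n arbitrary: x)
      (simp_all add: y_simps(1) y_apply blinfun.scaleR_right blinfun.add_right that)
  have comm_y: "y m (y n x) = y n (y m x)" for m n x
    by (rule comm) (rule comm[symmetric], rule refl)
  have r01: "0 \<le> r n \<and> r n \<le> 1" for n
  proof (induction n)
    case (Suc n)
    then have "r n * r n \<le> 1 * 1" by (intro mult_mono) auto
    with Suc show ?case by (simp add: r_simps)
  qed (simp add: r_simps)
  have y_norm: "norm (y n) \<le> r n" for n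
  proof (induction n)
    case (Suc n)
    have "norm (y n o\<^sub>L y n) \<le> norm (y n) * norm (y n)" by (rule norm_blinfun_compose)
    also have "\<dots> \<le> r n * r n" using Suc r01 by (intro mult_mono) auto
    finally show ?case
      using a_norm norm_triangle_ineq[of a "y n o\<^sub>L y n"] by (simp add: y_simps r_simps)
  qed (simp add: y_simps r_simps)
  have y_step: "norm (y (Suc n) - y n) \<le> r (Suc n) - r n" for n
  proof (induction n)
    case 0
    then show ?case using a_norm by (simp add: y_simps r_simps)
  next
    case (Suc n)
    define P Q where "P = y (Suc n)" and "Q = y n"
    have e1: "y (Suc (Suc n)) = (1/2) *\<^sub>R (a + (P o\<^sub>L P))" and e2: "P = (1/2) *\<^sub>R (a + (Q o\<^sub>L Q))"
      unfolding P_def Q_def by (rule y_simps(2))+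
    have "y (Suc (Suc n)) - P = (1/2) *\<^sub>R (a + (P o\<^sub>L P)) - (1/2) *\<^sub>R (a + (Q o\<^sub>L Q))"
      by (rule arg_cong2[OF e1 e2])
    also have "\<dots> = (1/2) *\<^sub>R ((P o\<^sub>L P) - (Q o\<^sub>L Q))"
      by (simp flip: scaleR_diff_right)
    \<comment> \<open>Since the iterates commute, the difference of squares factors as it does for
      the scalars, whose increments therefore stay dominant.\<close>
    also have "(P o\<^sub>L P) - (Q o\<^sub>L Q) = (P - Q) o\<^sub>L (P + Q)"
      by (rule blinfun_eqI)
        (simp add: blinfun.diff_left blinfun.add_left blinfun.add_right P_def Q_def comm_y[of "Suc n" n])
    finally have "y (Suc (Suc n)) - y (Suc n) = (1/2) *\<^sub>R ((y (Suc n) - y n) o\<^sub>L (y (Suc n) + y n))"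
      by (simp only: P_def Q_def)
    then have "norm (y (Suc (Suc n)) - y (Suc n))
        \<le> (1/2) * (norm (y (Suc n) - y n) * norm (y (Suc n) + y n))"
      using norm_blinfun_compose[of "y (Suc n) - y n" "y (Suc n) + y n"] by simp
    also have "\<dots> \<le> (1/2) * ((r (Suc n) - r n) * (r (Suc n) + r n))"
      using Suc y_norm[of n] y_norm[of "Suc n"] r01[of n] r01[of "Suc n"]
        norm_triangle_ineq[of "y (Suc n)" "y n"]
      by (intro mult_left_mono mult_mono order.trans[OF norm_ge_zero Suc]) auto
    also have "\<dots> = r (Suc (Suc n)) - r (Suc n)"
      by (simp add: r_simps(2)[of "Suc n"] r_simps(2)[of n] field_simps)
    finally show ?case .
  qed
  have y_diff: "norm (y (n + k) - y n) \<le> r (n + k) - r n" for n k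
  proof (induction k)
    case (Suc k)
    have "norm (y (n + Suc k) - y n) \<le> norm (y (Suc (n + k)) - y (n + k)) + norm (y (n + k) - y n)"
      by (rule order.trans[OF _ norm_triangle_ineq]) simp
    then show ?case using Suc y_step[of "n + k"] by simp
  qed simp
  \<comment> \<open>The increments of \<open>r\<close> dominate norms, so they are
    nonnegative.\<close>
  have "incseq r"
    using y_step order.trans[OF norm_ge_zero y_step] by (intro incseq_SucI) simp
  then have "convergent r"
    using r01 by (intro Bseq_mono_convergent BseqI'[of _ 1]) (auto simp: incseq_def)
  then have r_Cauchy: "Cauchy r" by (rule convergent_Cauchy)
  have "Cauchy y"
  proof (rule CauchyI)
    fix e :: real assume "e > 0"
    then obtain M where M: "\<And>m n. m \<ge> M \<Longrightarrow> n \<ge> M \<Longrightarrow> norm (r m - r n) < e"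
      using CauchyD[OF r_Cauchy] by blast
    have *: "norm (y n - y m) < e" if "m \<ge> M" "n \<ge> m" for m n
      using y_diff[of m "n - m"] M[of n m] that by simp
    have "norm (y m - y n) < e" if "m \<ge> M" "n \<ge> M" for m n
      using *[of m n] *[of n m] that by (cases "m \<le> n") (simp_all add: norm_minus_commute)
    then show "\<exists>M. \<forall>m\<ge>M. \<forall>n\<ge>M. norm (y m - y n) < e" by blast
  qed
  then obtain Y where Y: "y \<longlonglongrightarrow> Y"
    using Cauchy_convergent convergent_def by blast
  have Y_apply: "(\<lambda>n. y n x) \<longlonglongrightarrow> Y x" for x
    by (intro tendsto_intros Y)
  have Y_norm: "norm Y \<le> 1"
    by (rule LIMSEQ_le_const2[OF tendsto_norm[OF Y]]) (use y_norm r01 order.trans in blast)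
  \<comment> \<open>The limit satisfies \<open>2 Y = a + Y\<^sup>2\<close>, that is,
    \<open>(1 - Y)\<^sup>2 = 1 - a = s\<^sup>2\<close>; the operator sought is
    \<open>1 - Y\<close>.\<close>
  have Y_eq: "Y x + Y x = a x + Y (Y x)" for x
  proof -
    have "(\<lambda>n. y (Suc n) x) \<longlonglongrightarrow> Y x"
      using Y_apply by (rule LIMSEQ_Suc)
    moreover have "(\<lambda>n. (1/2) *\<^sub>R (a x + y n (y n x))) \<longlonglongrightarrow> (1/2) *\<^sub>R (a x + Y (Y x))"
      by (intro tendsto_intros blinfun.tendsto Y)
    ultimately have "Y x = (1/2) *\<^sub>R (a x + Y (Y x))"
      unfolding y_apply by (rule LIMSEQ_unique)
    from arg_cong[OF this, of "\<lambda>z. 2 *\<^sub>R z"] have "2 *\<^sub>R Y x = a x + Y (Y x)" by simp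
    then show ?thesis by (simp add: scaleR_2)
  qed
  have a_sa: "inner (a x) z = inner x (a z)" for x z
    by (simp add: a_apply inner_simps sa)
  have y_sa: "inner (y n x) z = inner x (y n z)" for n x z
    by (induction n arbitrary: x z) (simp_all add: y_simps(1) y_apply inner_simps a_sa)
  have Y_sa: "inner (Y x) z = inner x (Y z)" for x z
  proof (rule LIMSEQ_unique)
    show "(\<lambda>n. inner (y n x) z) \<longlonglongrightarrow> inner (Y x) z"
      by (intro tendsto_intros Y_apply)
    show "(\<lambda>n. inner (y n x) z) \<longlonglongrightarrow> inner x (Y z)"
      unfolding y_sa by (intro tendsto_intros Y_apply)
  qed
  have b_apply: "blinfun_apply (id_blinfun - Y) x = x - Y x" for x
    by (simp add: blinfun.diff_left)
  show ?thesis
  proof (intro exI[of _ "id_blinfun - Y"] conjI allI impI, unfold b_apply)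
    show "inner (x - Y x) z = inner x (z - Y z)" for x z
      by (simp add: inner_simps Y_sa)
    show "0 \<le> inner (x - Y x) x" for x
    proof -
      have "inner (Y x) x \<le> norm (Y x) * norm x" by (rule norm_cauchy_schwarz)
      also have "\<dots> \<le> (norm Y * norm x) * norm x"
        by (intro mult_right_mono norm_blinfun) simp
      also have "\<dots> \<le> (1 * norm x) * norm x"
        by (intro mult_right_mono Y_norm) simp_all
      finally show ?thesis
        by (simp add: inner_diff_left power2_norm_eq_inner[symmetric] power2_eq_square)
    qed
    show "x - Y x - Y (x - Y x) = s (s x)" for x
      using Y_eq[of x] by (simp add: blinfun.diff_right a_apply algebra_simps)
    show "X (x - Y x) = X x - Y (X x)" if X: "\<forall>x. X (s x) = s (X x)" for X :: "'a \<Rightarrow>\<^sub>L 'a" and x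
    proof -
      have Xy: "X (y n x) = y n (X x)" for n
        by (rule comm) (simp add: a_apply blinfun.diff_right X[rule_format])
      have "X (Y x) = Y (X x)"
      proof (rule LIMSEQ_unique)
        show "(\<lambda>n. X (y n x)) \<longlonglongrightarrow> X (Y x)"
          by (intro blinfun.tendsto tendsto_const Y_apply)
        show "(\<lambda>n. X (y n x)) \<longlonglongrightarrow> Y (X x)"
          unfolding Xy by (rule Y_apply)
      qed
      then show ?thesis by (simp add: blinfun.diff_right)
    qed
  qed
qed

text \<open>Rescaling reduces to contractions; the summand 1 in \<open>c\<close> keeps the scale
  positive when \<open>s = 0\<close>. The commutation clause ranges over all real-linear bounded
  operators, so that it covers multiplication by the imaginary unit as well as the elements of a
  masa.\<close>

lemma absolute_value:
  fixes s :: "'a::{real_inner,banach} \<Rightarrow>\<^sub>L 'a"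
  assumes sa: "\<And>x y. inner (s x) y = inner x (s y)"
  shows "\<exists>b :: 'a \<Rightarrow>\<^sub>L 'a. (\<forall>x y. inner (b x) y = inner x (b y)) \<and>
    (\<forall>x. 0 \<le> inner (b x) x) \<and> (\<forall>x. b (b x) = s (s x)) \<and>
    (\<forall>X :: 'a \<Rightarrow>\<^sub>L 'a. (\<forall>x. X (s x) = s (X x)) \<longrightarrow> (\<forall>x. X (b x) = b (X x)))"
proof -
  define c where "c = norm s + 1"
  have c: "c > 0" by (simp add: c_def add_nonneg_pos)
  define s' where "s' = (1 / c) *\<^sub>R s"
  have s'_apply: "s' x = (1 / c) *\<^sub>R s x" for x
    by (simp add: s'_def blinfun.scaleR_left)
  have "norm (s' x) \<le> norm x" for x
  proof -
    have "norm (s x) \<le> norm s * norm x" by (rule norm_blinfun)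
    also have "\<dots> \<le> c * norm x" by (intro mult_right_mono) (simp_all add: c_def)
    finally show ?thesis using c by (simp add: s'_apply field_simps)
  qed
  moreover have "inner (s' x) y = inner x (s' y)" for x y
    by (simp add: s'_apply sa)
  ultimately obtain b :: "'a \<Rightarrow>\<^sub>L 'a" where b: "\<And>x y. inner (b x) y = inner x (b y)"
    "\<And>x. 0 \<le> inner (b x) x" "\<And>x. b (b x) = s' (s' x)"
    and bX: "\<And>(X :: 'a \<Rightarrow>\<^sub>L 'a) x. \<forall>x. X (s' x) = s' (X x) \<Longrightarrow> X (b x) = b (X x)"
    using contraction_absolute_value[of s'] by blast
  show ?thesis
  proof (intro exI[of _ "c *\<^sub>R b"] conjI allI impI)
    show "blinfun_apply (c *\<^sub>R b) (blinfun_apply (c *\<^sub>R b) x) = s (s x)" for x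
      using c by (simp add: blinfun.scaleR_left blinfun.scaleR_right b(3) s'_apply)
    show "X ((c *\<^sub>R b) x) = (c *\<^sub>R b) (X x)" if "\<forall>x. X (s x) = s (X x)" for X :: "'a \<Rightarrow>\<^sub>L 'a" and x
      using bX[of X x] that by (simp add: blinfun.scaleR_left blinfun.scaleR_right s'_apply)
  qed (use b c in \<open>simp_all add: blinfun.scaleR_left\<close>)
qed

text \<open>This is \<open>t\<^sup>2 \<le> h t\<close> for a positive \<open>t\<close> of norm at
  most \<open>h\<close>; it comes from positivity of \<open>t\<close> at the vector
  \<open>h x - t x\<close>.\<close>

lemma positive_operator_square_le:
  fixes t :: "'a::real_inner \<Rightarrow>\<^sub>L 'a"
  assumes sa: "\<And>x y. inner (t x) y = inner x (t y)" and pos: "\<And>x. 0 \<le> inner (t x) x"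
    and bound: "\<And>x. norm (t x) \<le> h * norm x" and h: "0 \<le> h"
  shows "(norm (t x))\<^sup>2 \<le> h * inner (t x) x"
proof (cases "h = 0")
  case True
  then show ?thesis using bound[of x] by simp
next
  case False
  then have h: "h > 0" using h by simp
  have "inner (t (t x)) (t x) \<le> norm (t (t x)) * norm (t x)" by (rule norm_cauchy_schwarz)
  also have "\<dots> \<le> h * norm (t x) * norm (t x)" by (intro mult_right_mono bound) simp
  finally have 1: "inner (t (t x)) (t x) \<le> h * inner (t x) (t x)"
    by (simp add: power2_norm_eq_inner[symmetric] power2_eq_square)
  have 2: "0 \<le> inner (t (h *\<^sub>R x - t x)) (h *\<^sub>R x - t x)" by (rule pos)
  have "inner (t (h *\<^sub>R x - t x)) (h *\<^sub>R x - t x)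
      = h * (h * inner (t x) x) - 2 * h * inner (t x) (t x) + inner (t (t x)) (t x)"
    by (simp add: blinfun.diff_right blinfun.scaleR_right inner_simps sa algebra_simps)
  with 1 2 have "h * inner (t x) (t x) \<le> h * (h * inner (t x) x)" by linarith
  then have "inner (t x) (t x) \<le> h * inner (t x) x" using h by simp
  then show ?thesis by (simp add: power2_norm_eq_inner)
qed

section \<open>Sign projections and bisection of self-adjoint elements\<close>

context masa_algebra
begin

text \<open>With \<open>b\<close> the absolute value of \<open>s\<close>, the projection
  \<open>q\<close> is the one onto the kernel of \<open>b - s\<close>. Since
  \<open>(b - s)(b + s) = 0\<close>, the range of \<open>b + s\<close> lies in that kernel, whence
  \<open>s = - b\<close> on the complement.\<close>

lemma spectral_split:
  assumes s: "s \<in> D" and sa: "\<And>x y. inner (s x) y = inner x (s y)"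
  obtains q where "q \<in> PD" "\<And>x. 0 \<le> inner (s (q x)) (q x)"
    "\<And>x. inner (s (x - q x)) (x - q x) \<le> 0"
proof -
  obtain b :: "'a \<Rightarrow>\<^sub>L 'a" where b: "\<And>x y. inner (b x) y = inner x (b y)"
    "\<And>x. 0 \<le> inner (b x) x" "\<And>x. b (b x) = s (s x)"
    and bX: "\<And>(X :: 'a \<Rightarrow>\<^sub>L 'a) x. \<forall>x. X (s x) = s (X x) \<Longrightarrow> X (b x) = b (X x)"
    using absolute_value[OF sa] by blast
  \<comment> \<open>Complex linearity of \<open>b\<close> is the commutation clause for
    multiplication by \<open>\<i>\<close>.\<close>
  have "b (\<i> *\<^sub>C x) = \<i> *\<^sub>C b x" for x
    using bX[of "\<i> *\<^sub>C id_blinfun" x]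
    by (simp add: scaleC_blinfun.rep_eq bounded_opsD[OF D_bounded[OF s]])
  then have bb: "b \<in> bounded_ops" by (rule bounded_opsI_i)
  have db: "d (b x) = b (d x)" if "d \<in> D" for d x
    by (rule bX) (simp add: D_comm_apply[OF that s])
  then have bD: "b \<in> D" using bb by (intro D_I) simp_all
  define S where "S = {x. b x = s x}"
  have "complex_vector.subspace S"
    by (simp add: S_def complex_vector.subspace_def blinfun.add_right bounded_opsD[OF bb]
        bounded_opsD[OF D_bounded[OF s]])
  moreover have "closed S"
    unfolding S_def by (intro closed_Collect_eq continuous_intros)
  moreover have "d x \<in> S" if "d \<in> D" "x \<in> S" for d x
    using that by (simp add: S_def D_comm_apply[OF bD] D_comm_apply[OF s])
  ultimately obtain q where q: "q \<in> PD" "\<And>x. q x \<in> S" "\<And>x. x \<in> S \<Longrightarrow> q x = x"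
    using PD_subspace by blast
  show thesis
  proof (rule that[OF q(1)])
    show "0 \<le> inner (s (q x)) (q x)" for x
      using q(2)[of x] b(2)[of "q x"] by (simp add: S_def)
    fix x
    define v where "v = x - q x"
    have qv: "q v = 0" by (simp add: v_def blinfun.diff_right PD_idem q)
    have "b v + s v \<in> S"
      by (simp add: S_def blinfun.add_right b(3) db[OF s])
    then have "b v + s v = q (b v + s v)" using q(3) by simp
    also have "\<dots> = 0"
      using qv by (simp add: blinfun.add_right D_comm_apply[OF PD_D[OF q(1)] bD]
          D_comm_apply[OF PD_D[OF q(1)] s])
    finally have "s v = - b v" by (simp add: add_eq_0_iff)
    then show "inner (s (x - q x)) (x - q x) \<le> 0"
      using b(2)[of v] by (simp add: v_def)
  qed
qed

text \<open>On the range of \<open>E\<close> the operator \<open>t\<close> lies between 0 and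
  \<open>h\<close>, hence within \<open>h / 2\<close> of the midpoint. Expanding the square, this is
  exactly the quadratic estimate for positive operators.\<close>

lemma half_interval:
  assumes t: "t \<in> D" and sa: "\<And>x y. inner (t x) y = inner x (t y)" and E: "E \<in> PD"
    and pos: "\<And>x. 0 \<le> inner (t (E x)) (E x)" and bound: "\<And>x. norm (t (E x)) \<le> h * norm (E x)"
    and h: "0 \<le> h"
  shows "norm (t (E x) - (h / 2) *\<^sub>R E x) \<le> (h / 2) * norm (E x)"
proof -
  have tE: "t (E x) = E (t x)" for x by (rule D_comm_apply[OF t PD_D[OF E]])
  have "(norm ((t o\<^sub>L E) (E x)))\<^sup>2 \<le> h * inner ((t o\<^sub>L E) (E x)) (E x)"
  proof (rule positive_operator_square_le[OF _ _ _ h])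
    show "inner ((t o\<^sub>L E) x) y = inner x ((t o\<^sub>L E) y)" for x y
      using PD_sa[OF E, of "t x" y] by (simp add: tE[symmetric] sa)
    show "0 \<le> inner ((t o\<^sub>L E) x) x" for x
      using pos[of x] PD_sa[OF E, of "E (t x)" x] PD_idem[OF E] by (simp add: tE)
    show "norm ((t o\<^sub>L E) x) \<le> h * norm x" for x
      using order.trans[OF bound mult_left_mono[OF PD_norm_le[OF E] h]] by simp
  qed
  then have "(norm (t (E x)))\<^sup>2 \<le> h * inner (t (E x)) (E x)"
    by (simp add: PD_idem[OF E])
  moreover have "(norm (t (E x) - (h / 2) *\<^sub>R E x))\<^sup>2
      = (norm (t (E x)))\<^sup>2 - h * inner (t (E x)) (E x) + (h / 2) * (h / 2) * (norm (E x))\<^sup>2"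
    by (simp add: power2_norm_eq_inner inner_simps inner_commute algebra_simps)
  ultimately have "(norm (t (E x) - (h / 2) *\<^sub>R E x))\<^sup>2 \<le> ((h / 2) * norm (E x))\<^sup>2"
    by (simp add: power2_eq_square mult_ac)
  then show ?thesis by (rule power2_le_imp_le) (simp add: h)
qed

text \<open>On \<open>E\<close> the element \<open>s\<close> is within \<open>h\<close> of the
  scalar \<open>m\<close>, so the commutator \<open>Z\<close> of \<open>s\<close> and
  \<open>Y\<close> has norm at most \<open>2 * norm Y * h\<close> there. A sign projection of
  \<open>s - m\<close> cuts \<open>E\<close> into two parts on which \<open>h\<close> is halved. It
  commutes with \<open>Z\<close>, so the bounds on the two parts combine by Pythagoras without
  loss.\<close>

lemma bisection_commutator:
  fixes Y :: "'a \<Rightarrow>\<^sub>L 'a"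
  assumes s: "s \<in> D" and sa: "\<And>x y. inner (s x) y = inner x (s y)"
    and Y: "\<And>q x. q \<in> PD \<Longrightarrow> Y (q x) = q (Y x)"
    and "E \<in> PD" "0 \<le> h" "\<And>x. norm (s (E x) - m *\<^sub>R E x) \<le> h * norm (E x)"
  shows "norm (s (Y (E x)) - Y (s (E x))) \<le> 2 * norm Y * h / 2 ^ n * norm (E x)"
  using assms(4-)
proof (induction n arbitrary: E h m x)
  case 0
  let ?v = "E x"
  have "s (Y ?v) - Y (s ?v) = (s (E (Y x)) - m *\<^sub>R E (Y x)) - Y (s ?v - m *\<^sub>R ?v)"
    by (simp add: Y[OF 0(1)] blinfun.diff_right blinfun.scaleR_right)
  then have 1: "norm (s (Y ?v) - Y (s ?v)) \<le> norm (s (E (Y x)) - m *\<^sub>R E (Y x)) + norm (Y (s ?v - m *\<^sub>R ?v))"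
    by (metis norm_triangle_ineq4)
  have 2: "norm (Y (s ?v - m *\<^sub>R ?v)) \<le> norm Y * (h * norm ?v)"
    by (rule order.trans[OF norm_blinfun]) (intro mult_left_mono 0 norm_ge_zero)
  have "norm (s (E (Y x)) - m *\<^sub>R E (Y x)) \<le> h * norm (E (Y x))" by (rule 0)
  also have "\<dots> \<le> h * (norm Y * norm ?v)"
    by (intro mult_left_mono 0) (simp add: Y[OF 0(1), symmetric] norm_blinfun)
  finally show ?case using 1 2 by (simp add: mult_ac)
next
  case (Suc n)
  define t where "t = s - m *\<^sub>R id_blinfun"
  have t_apply: "t x = s x - m *\<^sub>R x" for x
    by (simp add: t_def blinfun.diff_left blinfun.scaleR_left)
  have tD: "t \<in> D" unfolding t_def by (intro D_diff s D_scaleR D_id)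
  have t_sa: "inner (t x) y = inner x (t y)" for x y
    by (simp add: t_apply inner_simps sa)
  obtain q where q: "q \<in> PD" "\<And>x. 0 \<le> inner (t (q x)) (q x)"
    "\<And>x. inner (t (x - q x)) (x - q x) \<le> 0"
    using spectral_split[OF tD t_sa] by blast
  have tE: "norm (t (E x)) \<le> h * norm (E x)" for x
    using Suc.prems(3) by (simp add: t_apply)
  define c where "c = 2 * norm Y * (h / 2) / 2 ^ n"
  have c: "0 \<le> c" using Suc.prems by (simp add: c_def)
  define Z where "Z = (s o\<^sub>L Y) - (Y o\<^sub>L s)"
  have Z_apply: "Z x = s (Y x) - Y (s x)" for x
    by (simp add: Z_def blinfun.diff_left)
  \<comment> \<open>The sign \<open>e\<close> treats both halves at once:
    \<open>e *\<^sub>R t\<close> is positive on the half under \<open>u\<close>, and the new centre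
    is \<open>m + e * h / 2\<close>.\<close>
  have Z: "norm (Z (E' x)) \<le> c * norm (E' x)"
    if E': "E' \<in> PD" "\<And>x. E (E' x) = E' x" and sign: "u \<in> PD" "\<And>x. u (E' x) = E' x"
      "e = 1 \<or> e = -1" "\<And>x. 0 \<le> e * inner (t (u x)) (u x)" for E' u x e
  proof -
    have *: "norm (s (E' x) - (m + e * h / 2) *\<^sub>R E' x) \<le> (h / 2) * norm (E' x)" for x
    proof -
      have "norm ((e *\<^sub>R t) (E' x) - (h / 2) *\<^sub>R E' x) \<le> (h / 2) * norm (E' x)"
      proof (rule half_interval)
        show "e *\<^sub>R t \<in> D" by (rule D_scaleR[OF tD])
        show "0 \<le> inner ((e *\<^sub>R t) (E' x)) (E' x)" for x
          using sign(4)[of "E' x"] by (simp add: blinfun.scaleR_left sign(2))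
        show "norm ((e *\<^sub>R t) (E' x)) \<le> h * norm (E' x)" for x
          using tE[of "E' x"] sign(3) by (auto simp: blinfun.scaleR_left E')
      qed (use E' Suc.prems in \<open>simp_all add: blinfun.scaleR_left t_sa\<close>)
      also have "norm ((e *\<^sub>R t) (E' x) - (h / 2) *\<^sub>R E' x) = norm (e *\<^sub>R ((e *\<^sub>R t) (E' x) - (h / 2) *\<^sub>R E' x))"
        using sign(3) by auto
      also have "e *\<^sub>R ((e *\<^sub>R t) (E' x) - (h / 2) *\<^sub>R E' x) = s (E' x) - (m + e * h / 2) *\<^sub>R E' x"
        using sign(3) by (auto simp: blinfun.scaleR_left t_apply algebra_simps)
      finally show ?thesis .
    qed
    show ?thesis
      unfolding c_def Z_apply by (rule Suc.IH[OF E'(1) _ *]) (use Suc.prems in simp)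
  qed
  have qZ: "q (Z x) = Z (q x)" for x
    by (simp add: Z_apply blinfun.diff_right Y[OF q(1)] D_comm_apply[OF s PD_D[OF q(1)]])
  have qE: "q (E x) = E (q x)" for x by (rule PD_comm[OF q(1) Suc.prems(1)])
  have 1: "norm (Z (q (E x))) \<le> c * norm (q (E x))"
    using Z[of "q o\<^sub>L E" q 1 x] q
    by (simp add: PD_compose Suc.prems PD_idem[OF q(1)] qE PD_idem[OF Suc.prems(1)])
  have 2: "norm (Z (E x - q (E x))) \<le> c * norm (E x - q (E x))"
    using Z[of "(id_blinfun - q) o\<^sub>L E" "id_blinfun - q" "-1" x] q
    by (simp add: PD_compose PD_compl Suc.prems PD_idem[OF q(1)] qE PD_idem[OF Suc.prems(1)]
        blinfun.diff_left blinfun.diff_right)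
  have "(norm (Z (E x)))\<^sup>2 = (norm (Z (q (E x))))\<^sup>2 + (norm (Z (E x - q (E x))))\<^sup>2"
    using PD_pythagoras[OF q(1), of "Z (E x)"] by (simp add: qZ blinfun.diff_right)
  also have "\<dots> \<le> (c * norm (q (E x)))\<^sup>2 + (c * norm (E x - q (E x)))\<^sup>2"
    using 1 2 by (intro add_mono power_mono) simp_all
  also have "\<dots> = (c * norm (E x))\<^sup>2"
    using PD_pythagoras[OF q(1), of "E x"] by (simp add: power_mult_distrib flip: distrib_left)
  finally have "norm (Z (E x)) \<le> c * norm (E x)"
    by (rule power2_le_imp_le) (simp add: c)
  then show ?case by (simp add: Z_apply c_def)
qed

text \<open>Bisection starts from the whole space with centre 0 and radius \<open>norm s\<close>; in
  the limit the commutator with a self-adjoint \<open>s\<close> vanishes, and a general element is a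
  combination of two self-adjoint ones.\<close>

theorem commutes_with_projections_imp_D:
  fixes Y :: "'a \<Rightarrow>\<^sub>L 'a"
  assumes Yb: "Y \<in> bounded_ops" and Y: "\<And>q x. q \<in> PD \<Longrightarrow> Y (q x) = q (Y x)"
  shows "Y \<in> D"
proof (rule D_I[OF Yb])
  have sa_case: "s (Y x) = Y (s x)" if s: "s \<in> D" "cadjoint s = s" for s x
  proof -
    have bound: "norm (s (Y x) - Y (s x)) \<le> 2 * norm Y * norm s / 2 ^ n * norm x" for n
      using bisection_commutator[OF s(1) cadjoint_eq_selfD[OF D_bounded[OF s(1)] s(2)] Y PD_id,
          of "norm s" 0 x n] by (simp add: norm_blinfun)
    have "(\<lambda>n. 2 * norm Y * norm s * norm x * (1 / 2) ^ n) \<longlonglongrightarrow> 2 * norm Y * norm s * norm x * 0"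
      by (intro tendsto_intros LIMSEQ_power_zero) simp
    then have "(\<lambda>n. 2 * norm Y * norm s / 2 ^ n * norm x) \<longlonglongrightarrow> 0"
      by (simp add: power_one_over field_simps)
    then have "norm (s (Y x) - Y (s x)) \<le> 0"
      by (rule LIMSEQ_le_const) (use bound in blast)
    then show ?thesis by simp
  qed
  fix d x assume d: "d \<in> D"
  note dec = cartesian_decomposition[OF D_bounded[OF d]]
  define H K where "H = d + cadjoint d" and "K = \<i> *\<^sub>C (d - cadjoint d)"
  have H: "H (Y x) = Y (H x)"
    unfolding H_def by (intro sa_case dec D_add D_cadjoint d)
  have K: "K (Y x) = Y (K x)"
    unfolding K_def by (intro sa_case dec D_diff D_scaleC D_cadjoint d)
  have "d z = (1/2) *\<^sub>C (H z + (- \<i>) *\<^sub>C K z)" for z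
    using arg_cong[OF dec(3), of "\<lambda>T. blinfun_apply T z"]
    unfolding H_def[symmetric] K_def[symmetric]
    by (simp only: scaleC_blinfun.rep_eq blinfun.add_left)
  then show "Y (d x) = d (Y x)"
    by (simp only: H K bounded_opsD[OF Yb] blinfun.add_right)
qed

end

section \<open>Fine partitions of the identity\<close>

lift_definition rank_one :: "'a::complex_inner \<Rightarrow> 'a \<Rightarrow> 'a \<Rightarrow>\<^sub>L 'a"
  is "\<lambda>u v x. cinner x u *\<^sub>C v"
proof (rule bounded_linear_intro)
  fix u v x y :: 'a and r :: real
  show "cinner (x + y) u *\<^sub>C v = cinner x u *\<^sub>C v + cinner y u *\<^sub>C v"
    by (simp add: cinner_add_left scaleC_add_left)
  show "cinner (r *\<^sub>R x) u *\<^sub>C v = r *\<^sub>R (cinner x u *\<^sub>C v)"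
    by (simp add: cinner_scaleC_left scaleC_scaleC flip: scaleC_of_real)
  show "norm (cinner x u *\<^sub>C v) \<le> norm x * (norm u * norm v)"
    using mult_right_mono[OF norm_cinner_le norm_ge_zero] by (simp add: norm_scaleC mult.assoc)
qed

lemma rank_one_apply: "rank_one u v x = cinner x u *\<^sub>C v"
  by (simp add: rank_one.rep_eq)

lemma rank_one_bounded_ops: "rank_one u v \<in> bounded_ops"
  by (simp add: bounded_ops_def rank_one_apply cinner_scaleC_left scaleC_scaleC)

context masa_algebra
begin

text \<open>
  All compressions \<open>pXp\<close> commute with the projections of \<open>D\<close>, so they lie in \<open>D\<close> and commute with each other.
\<close>

lemma minimal_projection_rank_one:
  assumes p: "p \<in> PD"
    and minimal: "\<And>q. q \<in> PD \<Longrightarrow> (\<And>x. p (q x) = q x) \<Longrightarrow> q = 0 \<or> q = p"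
  shows "\<exists>v. range p \<subseteq> complex_vector.span {v}"
proof (cases "p = 0")
  case True
  then show ?thesis by (auto simp: complex_vector.span_zero)
next
  case False
  have corner: "p o\<^sub>L X o\<^sub>L p \<in> D" if X: "X \<in> bounded_ops" for X
  proof (rule commutes_with_projections_imp_D)
    show "p o\<^sub>L X o\<^sub>L p \<in> bounded_ops"
      by (intro bounded_ops_compose X PD_bounded p)
    fix q x assume q: "q \<in> PD"
    have pq: "p (q x) = q (p x)" for x by (rule PD_comm[OF p q])
    have "q o\<^sub>L p = 0 \<or> q o\<^sub>L p = p"
      by (rule minimal) (simp_all add: PD_compose p q pq PD_idem)
    then have "(\<forall>x. q (p x) = 0) \<or> (\<forall>x. q (p x) = p x)"
      by (metis blinfun_apply_blinfun_compose zero_blinfun.rep_eq)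
    then show "(p o\<^sub>L X o\<^sub>L p) (q x) = q ((p o\<^sub>L X o\<^sub>L p) x)"
      by (auto simp: pq)
  qed
  obtain u where u: "p u = u" "u \<noteq> 0"
    using False PD_idem[OF p] by (metis blinfun_eqI zero_blinfun.rep_eq)
  define n where "n = cinner u u"
  have n: "n \<noteq> 0" using u by (simp add: n_def cinner_self)
  have "p x \<in> complex_vector.span {u}" for x
  proof -
    define v where "v = p x"
    have v: "p v = v" by (simp add: v_def PD_idem p)
    \<comment> \<open>Evaluated at \<open>u\<close>, commutativity of these two compressions equates
      \<open>n * n\<close> times \<open>v\<close> with a multiple of \<open>u\<close>.\<close>
    have "(p o\<^sub>L rank_one u v o\<^sub>L p) ((p o\<^sub>L rank_one u u o\<^sub>L p) u)
        = (p o\<^sub>L rank_one u u o\<^sub>L p) ((p o\<^sub>L rank_one u v o\<^sub>L p) u)"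
      by (intro D_comm_apply corner rank_one_bounded_ops)
    then have "(n * n) *\<^sub>C v = (n * cinner v u) *\<^sub>C u"
      by (simp add: rank_one_apply u v bounded_opsD[OF PD_bounded[OF p]] cinner_scaleC_left
          scaleC_scaleC mult.commute flip: n_def)
    then have "(1 / (n * n)) *\<^sub>C (n * n) *\<^sub>C v = (1 / (n * n)) *\<^sub>C (n * cinner v u) *\<^sub>C u"
      by simp
    then have "v = (cinner v u / n) *\<^sub>C u"
      using n by (simp add: scaleC_scaleC)
    then show ?thesis
      by (metis v_def complex_vector.span_base complex_vector.span_scale singletonI)
  qed
  then show ?thesis by blast
qed

text \<open>The infimum of a chain is its strong limit. Along the chain the squared norm of
  \<open>p y - q y\<close> is the difference of the squared norms of \<open>p y\<close> and
  \<open>q y\<close>, so vectors \<open>p y\<close> of almost minimal norm form a Cauchy sequence.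
  Their limit is fixed by all of \<open>C\<close>; as \<open>y\<close> is orthogonal to every such
  vector, the limit is 0.\<close>

lemma PD_chain_inf:
  assumes C: "C \<subseteq> PD" "C \<noteq> {}"
    and chain: "\<And>p q. p \<in> C \<Longrightarrow> q \<in> C \<Longrightarrow> (\<forall>x. p (q x) = q x) \<or> (\<forall>x. q (p x) = p x)"
  obtains p0 where "p0 \<in> PD" "\<And>p x. p \<in> C \<Longrightarrow> p (p0 x) = p0 x"
    "\<And>x e. 0 < e \<Longrightarrow> \<exists>p\<in>C. norm (p x - p0 x) < e"
proof -
  define S where "S = {x. \<forall>p\<in>C. p x = x}"
  have CP: "p \<in> PD" if "p \<in> C" for p using that C(1) by blast
  have C_lin: "p (a *\<^sub>C x) = a *\<^sub>C p x" if "p \<in> C" for p a x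
    by (rule bounded_opsD[OF PD_bounded[OF CP[OF that]]])
  have "complex_vector.subspace S"
    by (simp add: S_def complex_vector.subspace_def blinfun.add_right C_lin)
  moreover have "closed S"
  proof -
    have "S = (\<Inter>p\<in>C. {x. blinfun_apply p x = x})" by (auto simp: S_def)
    moreover have "closed {x. blinfun_apply p x = x}" for p :: "'a \<Rightarrow>\<^sub>L 'a"
      by (intro closed_Collect_eq continuous_intros)
    ultimately show ?thesis by (auto intro!: closed_INT)
  qed
  moreover have "d x \<in> S" if "d \<in> D" "x \<in> S" for d x
    unfolding S_def
  proof (intro CollectI ballI)
    fix p assume p: "p \<in> C"
    show "p (d x) = d x"
      using D_comm_apply[OF PD_D[OF CP[OF p]] that(1)] that(2) p by (simp add: S_def)
  qed
  ultimately obtain p0 where p0: "p0 \<in> PD" "\<And>x. p0 x \<in> S" "\<And>x. x \<in> S \<Longrightarrow> p0 x = x"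
    using PD_subspace by blast
  have pp0: "p (p0 x) = p0 x" if "p \<in> C" for p x
    using p0(2)[of x] that by (simp add: S_def)
  have "\<exists>p\<in>C. norm (p x - p0 x) < e" if e: "0 < e" for x e
  proof -
    define y where "y = x - p0 x"
    define s where "s = (INF p\<in>C. (norm (blinfun_apply p y))\<^sup>2)"
    have bdd: "bdd_below ((\<lambda>p. (norm (blinfun_apply p y))\<^sup>2) ` C)"
      by (rule bdd_belowI2[of _ 0]) simp
    have s_le: "s \<le> (norm (p y))\<^sup>2" if "p \<in> C" for p
      unfolding s_def using bdd that by (rule cINF_lower)
    have "\<exists>p\<in>C. (norm (p y))\<^sup>2 < s + 1 / real (Suc n)" for n
      using cINF_less_iff[OF C(2) bdd, of "s + 1 / real (Suc n)"] unfolding s_def[symmetric] by simp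
    then obtain P where P: "\<And>n. P n \<in> C" "\<And>n. (norm (P n y))\<^sup>2 < s + 1 / real (Suc n)"
      by metis
    have below: "(norm (p y - q y))\<^sup>2 = (norm (p y))\<^sup>2 - (norm (q y))\<^sup>2"
      if "p \<in> C" "q \<in> C" "\<forall>x. p (q x) = q x" for p q
    proof -
      have "q (p y) = q y"
        using that(3) PD_comm[OF CP CP, OF that(2,1)] by simp
      then show ?thesis using PD_pythagoras[OF CP[OF that(2)], of "p y"] by simp
    qed
    have close: "(norm (P n y - P m y))\<^sup>2 \<le> 1 / real (Suc n) + 1 / real (Suc m)" for m n
    proof (cases "\<forall>x. P n (P m x) = P m x")
      case True
      then show ?thesis
        using below[OF P(1) P(1) True] P(2)[of n] s_le[OF P(1)[of m]] by (simp add: add_increasing2)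
    next
      case False
      then have "\<forall>x. P m (P n x) = P n x" using chain[OF P(1) P(1)] by blast
      then show ?thesis
        using below[OF P(1) P(1)] P(2)[of m] s_le[OF P(1)[of n]]
        by (simp add: add_increasing norm_minus_commute)
    qed
    have "(norm (P n y - P m y))\<^sup>2 \<le> 2 / real (Suc n) + 2 / real (Suc m)" for m n
      by (rule order.trans[OF close]) (intro add_mono divide_right_mono; simp)
    then have "Cauchy (\<lambda>n. P n y)" by (rule Cauchy_square_boundI)
    then obtain z where z: "(\<lambda>n. P n y) \<longlonglongrightarrow> z"
      using Cauchy_convergent convergent_def by blast
    have "p z = z" if p: "p \<in> C" for p
    proof -
      have "(norm (p (P n y) - P n y))\<^sup>2 \<le> 1 / real (Suc n)" for n
      proof (cases "\<forall>x. p (P n x) = P n x")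
        case False
        then have *: "\<forall>x. P n (p x) = p x" using chain[OF p P(1)] by blast
        then have "p (P n y) = p y"
          using PD_comm[OF CP CP, OF p P(1)] by simp
        then show ?thesis
          using below[OF P(1) p *] P(2)[of n] s_le[OF p] by (simp add: norm_minus_commute)
      qed simp
      moreover have "(\<lambda>n. (norm (p (P n y) - P n y))\<^sup>2) \<longlonglongrightarrow> (norm (p z - z))\<^sup>2"
        by (intro tendsto_intros z)
      moreover have "(\<lambda>n. 1 / real (Suc n)) \<longlonglongrightarrow> 0"
        by (rule LIMSEQ_Suc[OF lim_1_over_n])
      ultimately have "(norm (p z - z))\<^sup>2 \<le> 0"
        by (intro LIMSEQ_le[of _ _ "\<lambda>n. 1 / real (Suc n)"]) auto
      then show ?thesis by simp
    qed
    then have p0z: "p0 z = z" by (intro p0) (simp add: S_def)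
    have zS: "P n z = z" for n using pp0[OF P(1), of n z] p0z by simp
    have "inner (P n y) z = 0" for n
    proof -
      have "inner (P n y) z = inner y z"
        using PD_sa[OF CP[OF P(1)], of n y z] zS by simp
      also have "\<dots> = inner (p0 y) z"
        using PD_sa[OF p0(1), of y z] p0z by simp
      also have "p0 y = 0" by (simp add: y_def blinfun.diff_right PD_idem p0(1))
      finally show ?thesis by simp
    qed
    moreover have "(\<lambda>n. inner (P n y) z) \<longlonglongrightarrow> inner z z"
      by (intro tendsto_intros z)
    ultimately have "z = 0"
      using LIMSEQ_unique[of "\<lambda>n. inner (P n y) z" "inner z z" 0] by simp
    then have "(\<lambda>n. norm (P n y)) \<longlonglongrightarrow> 0" using z tendsto_norm_zero by blast
    then obtain n where "norm (P n y) < e"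
      using order_tendstoD(2)[of _ 0 sequentially e] e eventually_happens'[OF sequentially_bot] by blast
    then show ?thesis
      using P(1)[of n] pp0[OF P(1), of n x] by (auto simp: y_def blinfun.diff_right)
  qed
  then show thesis using that[of p0] p0(1) pp0 by blast
qed

text \<open>The pieces form a set, so uniting two partitions must not merge pieces: mutually
  orthogonal projections can coincide only if they are 0, which is why 0 is excluded.\<close>

definition partitions :: "('a \<Rightarrow>\<^sub>L 'a) \<Rightarrow> ('a \<Rightarrow>\<^sub>L 'a) set \<Rightarrow> bool" where
  "partitions p K \<longleftrightarrow> finite K \<and> K \<subseteq> PD \<and> 0 \<notin> K \<and>
    (\<forall>a\<in>K. \<forall>b\<in>K. a \<noteq> b \<longrightarrow> (\<forall>x. blinfun_apply a (blinfun_apply b x) = 0)) \<and>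
    (\<forall>x. blinfun_apply p x = (\<Sum>a\<in>K. blinfun_apply a x))"

lemma partitions_absorb:
  assumes "partitions p K" "a \<in> K"
  shows "p (a x) = a x"
proof -
  have "p (a x) = (\<Sum>b\<in>K. blinfun_apply b (a x))" using assms by (simp add: partitions_def)
  also have "\<dots> = (\<Sum>b\<in>K. if b = a then a x else 0)"
    using assms by (intro sum.cong refl) (auto simp: partitions_def PD_idem subset_iff)
  also have "\<dots> = a x" using assms by (simp add: partitions_def)
  finally show ?thesis .
qed

lemma partitions_Un:
  assumes K: "partitions p K" and L: "partitions q L" and p: "p \<in> PD" and q: "q \<in> PD"
    and pq: "\<And>x. p (q x) = 0"
  shows "partitions (p + q) (K \<union> L)"
proof -
  have KP: "a \<in> PD" if "a \<in> K \<union> L" for a using that K L by (auto simp: partitions_def)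
  have 1: "a (b x) = 0" "b (a x) = 0" if "a \<in> K" "b \<in> L" for a b x
  proof -
    have "a (b x) = p (a (b x))" using partitions_absorb[OF K that(1)] by simp
    also have "\<dots> = p (a (q (b x)))" using partitions_absorb[OF L that(2)] by simp
    also have "\<dots> = 0" using PD_comm[OF KP q, of a] that pq by simp
    finally show *: "a (b x) = 0" .
    then show "b (a x) = 0" using PD_comm[OF KP KP, of a b x] that by simp
  qed
  have "K \<inter> L = {}"
  proof (rule ccontr)
    assume "K \<inter> L \<noteq> {}"
    then obtain a where a: "a \<in> K" "a \<in> L" by blast
    then have "a x = 0" for x
      using 1(1)[OF a, of x] PD_idem[OF KP, of a x] by simp
    then have "a = 0" by (intro blinfun_eqI) simp
    then show False using a K by (simp add: partitions_def)
  qed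
  then show ?thesis
    using K L 1 by (auto simp: partitions_def blinfun.add_left sum.union_disjoint)
qed

text \<open>The infimum \<open>p0\<close> of a chain of bad projections is bad, since a good
  \<open>p0\<close> could be completed by a difference \<open>p - p0\<close> that is small on
  \<open>V\<close>. So if the identity were bad, there would be a minimal bad projection. It cannot
  have rank at most one, and it cannot be split either, because its proper parts would be good and
  orthogonal good parts add up. This covers the atomic and the diffuse part of \<open>D\<close>
  alike.\<close>

theorem fine_partition:
  assumes V: "finite V" and e: "0 < e"
  obtains K where "partitions id_blinfun K"
    "\<And>a. a \<in> K \<Longrightarrow> (\<exists>v. range (blinfun_apply a) \<subseteq> complex_vector.span {v}) \<or> (\<forall>x\<in>V. norm (a x) < e)"
proof -
  define good where "good p \<longleftrightarrow> (\<exists>K. partitions p K \<and>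
    (\<forall>a\<in>K. (\<exists>v. range (blinfun_apply a) \<subseteq> complex_vector.span {v}) \<or> (\<forall>x\<in>V. norm (a x) < e)))" for p
  have good_add: "good (p + q)" if g: "good p" "good q" and pq: "p \<in> PD" "q \<in> PD" "\<And>x. p (q x) = 0" for p q
  proof -
    obtain K L where K: "partitions p K"
        "\<forall>a\<in>K. (\<exists>v. range (blinfun_apply a) \<subseteq> complex_vector.span {v}) \<or> (\<forall>x\<in>V. norm (blinfun_apply a x) < e)"
      and L: "partitions q L"
        "\<forall>a\<in>L. (\<exists>v. range (blinfun_apply a) \<subseteq> complex_vector.span {v}) \<or> (\<forall>x\<in>V. norm (blinfun_apply a x) < e)"
      using g unfolding good_def by blast
    show ?thesis
      unfolding good_def
      by (intro exI[of _ "K \<union> L"] conjI partitions_Un K(1) L(1) pq ballI)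
        (use K(2) L(2) in \<open>elim UnE; blast\<close>)
  qed
  have good_one: "good p"
    if "p \<in> PD" "(\<exists>v. range p \<subseteq> complex_vector.span {v}) \<or> (\<forall>x\<in>V. norm (p x) < e)" for p
  proof (cases "p = 0")
    case True
    then show ?thesis unfolding good_def by (intro exI[of _ "{}"]) (simp add: partitions_def)
  next
    case False
    then show ?thesis
      using that unfolding good_def by (intro exI[of _ "{p}"]) (simp add: partitions_def)
  qed
  have "good id_blinfun"
  proof (rule ccontr)
    assume bad_id: "\<not> good id_blinfun"
    \<comment> \<open>Complements of ranges reverse the order, so a maximal set obtained from Zorn's
      lemma is a minimal bad projection.\<close>
    define A where "A = (\<lambda>p. - range (blinfun_apply p)) ` {p \<in> PD. \<not> good p}"
    have "\<exists>U\<in>A. \<forall>X\<in>C. X \<subseteq> U" if C: "subset.chain A C" for C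
    proof (cases "C = {}")
      case True
      then show ?thesis using bad_id PD_id by (auto simp: A_def)
    next
      case False
      have CA: "C \<subseteq> A" using C by (simp add: subset_chain_def)
      define B where "B = {p \<in> PD. \<not> good p \<and> - range (blinfun_apply p) \<in> C}"
      have B: "B \<subseteq> PD" "B \<noteq> {}" using False CA by (auto simp: B_def A_def)
      have le: "\<forall>x. q (p x) = p x" if "- range q \<subseteq> - range p" "q \<in> PD" for p q :: "'a \<Rightarrow>\<^sub>L 'a"
      proof
        fix x
        have "range p \<subseteq> range q" using that(1) by (simp only: Compl_subset_Compl_iff)
        then have "p x \<in> range q" by (rule subsetD) (rule rangeI)
        then obtain z where "p x = q z" by (rule rangeE)
        then show "q (p x) = p x" using PD_idem[OF that(2)] by simp
      qed
      have chain: "(\<forall>x. p (q x) = q x) \<or> (\<forall>x. q (p x) = p x)" if "p \<in> B" "q \<in> B" for p q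
      proof -
        have C': "X \<subseteq> Y \<or> Y \<subseteq> X" if "X \<in> C" "Y \<in> C" for X Y
          using C that by (simp add: subset_chain_def)
        have "- range p \<subseteq> - range q \<or> - range q \<subseteq> - range p"
          using that by (intro C') (simp_all add: B_def)
        then show ?thesis using le[of p q] le[of q p] that B(1) by (elim disjE) auto
      qed
      obtain p0 where p0: "p0 \<in> PD" "\<And>p x. p \<in> B \<Longrightarrow> p (p0 x) = p0 x"
        "\<And>x d. 0 < d \<Longrightarrow> \<exists>p\<in>B. norm (p x - p0 x) < d"
        using PD_chain_inf[OF B chain] by blast
      have p0': "p0 (p x) = p0 x" if "p \<in> B" for p x
        using PD_comm[OF p0(1), of p x] B(1) that p0(2)[OF that] by auto
      \<comment> \<open>Smaller members of the chain are at least as close to \<open>p0\<close>, so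
        finitely many vectors can be served by one member.\<close>
      have "\<exists>p\<in>B. \<forall>x\<in>V. norm (p x - p0 x) < e"
        using V
      proof (induction V)
        case empty
        then show ?case using B(2) by blast
      next
        case (insert x V)
        then obtain p where p: "p \<in> B" "\<forall>x\<in>V. norm (p x - p0 x) < e" by blast
        obtain q where q: "q \<in> B" "norm (q x - p0 x) < e" using p0(3)[OF e] by blast
        have mono: "norm (r z - p0 z) \<le> norm (r' z - p0 z)"
          if "r \<in> B" "r' \<in> B" "\<forall>x. r' (r x) = r x" for r r' z
        proof -
          have "r (r' z) = r z"
            using that PD_comm[of r r'] B(1) by auto
          then have "r z - p0 z = r (r' z - p0 z)"
            using p0(2)[OF that(1)] by (simp add: blinfun.diff_right)
          then show ?thesis using PD_norm_le[of r] that B(1) by auto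
        qed
        from chain[OF p(1) q(1)] show ?case
        proof
          assume "\<forall>x. p (q x) = q x"
          then have "\<forall>z\<in>insert x V. norm (q z - p0 z) < e"
            using mono[OF q(1) p(1)] p(2) q(2) by (auto intro: le_less_trans)
          then show ?thesis using q(1) by blast
        next
          assume "\<forall>x. q (p x) = p x"
          then have "\<forall>z\<in>insert x V. norm (p z - p0 z) < e"
            using mono[OF p(1) q(1)] p(2) q(2) by (auto intro: le_less_trans)
          then show ?thesis using p(1) by blast
        qed
      qed
      then obtain p where p: "p \<in> B" "\<forall>x\<in>V. norm (p x - p0 x) < e" by blast
      have pP: "p \<in> PD" using p B by blast
      have bad_p0: "\<not> good p0"
      proof
        assume "good p0"
        moreover have "p - p0 \<in> PD" using p0 p pP by (intro PD_diff) auto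
        moreover from this have "good (p - p0)"
          using p(2) by (intro good_one) (auto simp: blinfun.diff_left)
        ultimately have "good (p0 + (p - p0))"
          using p0 p0'[OF p(1)] by (intro good_add) (auto simp: blinfun.diff_left blinfun.diff_right PD_idem)
        then show False using p(1) by (simp add: B_def)
      qed
      have "X \<subseteq> - range p0" if X: "X \<in> C" for X
      proof -
        obtain r where r: "r \<in> B" "X = - range r"
          using X CA by (auto simp: B_def A_def)
        have "range p0 \<subseteq> range r"
          using p0(2)[OF r(1)] by (metis image_subsetI rangeI)
        then show ?thesis using r(2) by blast
      qed
      then show ?thesis using bad_p0 p0(1) by (auto simp: A_def)
    qed
    from subset_Zorn[OF this] obtain M where "M \<in> A" "\<forall>X\<in>A. M \<subseteq> X \<longrightarrow> X = M" by blast
    then obtain m where m: "m \<in> PD" "\<not> good m"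
      and min: "\<And>p. p \<in> PD \<Longrightarrow> \<not> good p \<Longrightarrow> range p \<subseteq> range m \<Longrightarrow> range p = range m"
      by (auto simp: A_def)
    obtain q where q: "q \<in> PD" "\<And>x. m (q x) = q x" "q \<noteq> 0" "q \<noteq> m"
      using minimal_projection_rank_one[OF m(1)] good_one[OF m(1)] m(2) by blast
    have qm: "q (m x) = q x" for x using PD_comm[OF q(1) m(1), of x] q(2) by simp
    have q': "m - q \<in> PD" by (rule PD_diff[OF m(1) q(1,2)])
    have eq: "p x = m x" if p: "p \<in> PD" "\<not> good p" "\<And>x. m (p x) = p x" for p x
    proof -
      have "range p \<subseteq> range m" using p(3) by (metis image_subsetI rangeI)
      then have "range p = range m" using min p by blast
      then obtain z where "m x = p z" by (metis rangeE rangeI)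
      then have "p (m x) = m x" using PD_idem[OF p(1)] by simp
      then show ?thesis using PD_comm[OF p(1) m(1), of x] p(3) by simp
    qed
    have "good q"
      using eq[OF q(1) _ q(2)] q(4) by (metis blinfun_eqI)
    moreover have "good (m - q)"
    proof (rule ccontr)
      assume "\<not> good (m - q)"
      then have "(m - q) x = m x" for x
        by (rule eq[OF q']) (simp add: blinfun.diff_left blinfun.diff_right PD_idem m(1) q(2))
      then have "q x = 0" for x by (simp add: blinfun.diff_left)
      then show False using q(3) by (metis blinfun_eqI zero_blinfun.rep_eq)
    qed
    ultimately have "good (q + (m - q))"
      using q q' by (intro good_add) (auto simp: blinfun.diff_left blinfun.diff_right PD_idem qm)
    then show False using m(2) by simp
  qed
  then show thesis using that unfolding good_def by blast
qed

end

section \<open>Ranks\<close>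

definition rank_le :: "nat \<Rightarrow> ('a::chilbert_space \<Rightarrow>\<^sub>L 'a) \<Rightarrow> bool" where
  "rank_le r X \<longleftrightarrow> (\<exists>B. finite B \<and> card B \<le> r \<and> range (blinfun_apply X) \<subseteq> complex_vector.span B)"

text \<open>Independence in the form of a biorthogonal system: the matrix of \<open>X\<close>
  between the two families is the identity. Small errors do not destroy such a certificate, and
  exchanging the families yields one for the adjoint.\<close>

definition rank_ge :: "nat \<Rightarrow> ('a::chilbert_space \<Rightarrow>\<^sub>L 'a) \<Rightarrow> bool" where
  "rank_ge r X \<longleftrightarrow> (\<exists>u e. \<forall>i<r. \<forall>j<r. cinner (blinfun_apply X (u i)) (e j) = (if i = j then 1 else 0))"

text \<open>The vectors are indexed and may repeat: two equal ones already give a relation, and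
  distinct ones outnumber the spanning set.\<close>

lemma nontrivial_relation:
  fixes v :: "nat \<Rightarrow> 'a::complex_vector"
  assumes B: "finite B" "card B < n" and v: "\<And>i. i < n \<Longrightarrow> v i \<in> complex_vector.span B"
  obtains c j where "j < n" "c j \<noteq> 0" "(\<Sum>i<n. c i *\<^sub>C v i) = 0"
proof (cases "inj_on v {..<n}")
  case True
  define S where "S = v ` {..<n}"
  have "card S = n" using True by (simp add: S_def card_image)
  moreover have "S \<subseteq> complex_vector.span B" using v by (auto simp: S_def)
  ultimately have "complex_vector.dependent S"
    using complex_vector.independent_span_bound[OF B(1), of S] B(2) by auto
  moreover have "finite S" by (simp add: S_def)
  ultimately obtain u where u: "\<exists>x\<in>S. u x \<noteq> 0" "(\<Sum>x\<in>S. u x *\<^sub>C x) = 0"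
    using complex_vector.dependent_finite by blast
  have "(\<Sum>i<n. u (v i) *\<^sub>C v i) = 0"
    using u(2) True by (simp add: S_def sum.reindex)
  moreover obtain j where "j < n" "u (v j) \<noteq> 0" using u(1) by (auto simp: S_def)
  ultimately show thesis using that[of j "\<lambda>i. u (v i)"] by simp
next
  case False
  then obtain i j where ij: "i < n" "j < n" "i \<noteq> j" "v i = v j"
    by (auto simp: inj_on_def)
  define c :: "nat \<Rightarrow> complex" where "c = (\<lambda>k. (if k = i then 1 else 0) - (if k = j then 1 else 0))"
  have "(\<Sum>k<n. c k *\<^sub>C v k) = (\<Sum>k<n. if k = i then v k else 0) - (\<Sum>k<n. if k = j then v k else 0)"
    unfolding sum_subtractf[symmetric]
    by (rule sum.cong) (auto simp: c_def complex_vector.scale_left_diff_distrib)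
  also have "\<dots> = 0" using ij by simp
  finally show thesis using that[of i c] ij by (simp add: c_def)
qed

text \<open>A matrix with all entries within \<open>1 / n\<close> of the identity is nonsingular,
  since in a linear relation the coefficient of largest modulus would be smaller than itself. This
  is the lower semicontinuity of the rank.\<close>

lemma rank_le_perturbed_biorthogonal:
  assumes X: "rank_le m X"
    and bi: "\<And>i j. i < n \<Longrightarrow> j < n \<Longrightarrow>
      cmod ((if i = j then 1 else 0) - cinner (blinfun_apply X (u i)) (e j)) < 1 / real n"
  shows "n \<le> m"
proof (rule ccontr)
  assume "\<not> n \<le> m"
  then have mn: "m < n" by simp
  obtain B where B: "finite B" "card B \<le> m" "range X \<subseteq> complex_vector.span B"
    using X by (auto simp: rank_le_def)
  obtain c k where c: "k < n" "c k \<noteq> 0" "(\<Sum>i<n. c i *\<^sub>C X (u i)) = 0"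
    using nontrivial_relation[of B n "\<lambda>i. X (u i)"] B mn by (metis le_less_trans rangeI subsetD)
  define M where "M = Max ((\<lambda>i. cmod (c i)) ` {..<n})"
  have "M \<in> (\<lambda>i. cmod (c i)) ` {..<n}"
    unfolding M_def using mn by (intro Max_in) auto
  then obtain j where j: "j < n" "cmod (c j) = M" by auto
  have le: "cmod (c i) \<le> M" if "i < n" for i
    unfolding M_def using that by (intro Max_ge) auto
  have M: "M > 0" using le[OF c(1)] c(2) by (meson less_le_trans zero_less_norm_iff)
  have "cinner (\<Sum>i<n. c i *\<^sub>C X (u i)) (e j) = 0" by (simp add: c(3))
  then have *: "(\<Sum>i<n. c i * cinner (X (u i)) (e j)) = 0"
    by (simp add: cinner_sum_left cinner_scaleC_left)
  have "c j = (\<Sum>i<n. if i = j then c i else 0)" using j(1) by simp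
  also have "\<dots> = (\<Sum>i<n. if i = j then c i else 0) - (\<Sum>i<n. c i * cinner (X (u i)) (e j))"
    by (simp add: *)
  also have "\<dots> = (\<Sum>i<n. c i * ((if i = j then 1 else 0) - cinner (X (u i)) (e j)))"
    unfolding sum_subtractf[symmetric] by (rule sum.cong) (auto simp: right_diff_distrib)
  finally have "cmod (c j) = cmod (\<Sum>i<n. c i * ((if i = j then 1 else 0) - cinner (X (u i)) (e j)))"
    by (rule arg_cong)
  also have "\<dots> \<le> (\<Sum>i<n. cmod (c i * ((if i = j then 1 else 0) - cinner (X (u i)) (e j))))"
    by (rule norm_sum)
  also have "\<dots> < (\<Sum>i<n. M * (1 / real n))"
  proof (rule sum_strict_mono)
    fix i assume "i \<in> {..<n}"
    then have i: "i < n" by simp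
    have "cmod (c i * ((if i = j then 1 else 0) - cinner (X (u i)) (e j)))
        \<le> M * cmod ((if i = j then 1 else 0) - cinner (X (u i)) (e j))"
      unfolding norm_mult by (rule mult_right_mono[OF le[OF i] norm_ge_zero])
    also have "\<dots> < M * (1 / real n)"
      by (rule mult_strict_left_mono[OF bi[OF i j(1)] M])
    finally show "cmod (c i * ((if i = j then 1 else 0) - cinner (X (u i)) (e j))) < M * (1 / real n)" .
  qed (use mn in auto)
  also have "\<dots> = M" using mn by simp
  finally show False using j(2) by simp
qed

lemma rank_ge_le_rank_le:
  assumes "rank_ge n X" "rank_le m X"
  shows "n \<le> m"
proof -
  obtain u e where "\<forall>i<n. \<forall>j<n. cinner (blinfun_apply X (u i)) (e j) = (if i = j then 1 else 0)"
    using assms(1) unfolding rank_ge_def by blast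
  then show ?thesis
    by (intro rank_le_perturbed_biorthogonal[OF assms(2), of n u e]) simp
qed

text \<open>Gram-Schmidt on the images: the \<open>u i\<close> are chosen so that the vectors
  \<open>X (u i)\<close> are orthonormal, and these images serve as the second family.\<close>

lemma not_rank_le_imp_rank_ge:
  assumes Xb: "X \<in> bounded_ops" and X: "\<not> rank_le r X"
  shows "rank_ge (Suc r) X"
proof -
  have "n \<le> Suc r \<Longrightarrow> \<exists>u. \<forall>i<n. \<forall>j<n. cinner (X (u i)) (X (u j)) = (if i = j then 1 else 0)" for n
  proof (induction n)
    case (Suc n)
    then obtain u where u: "\<And>i j. i < n \<Longrightarrow> j < n \<Longrightarrow> cinner (X (u i)) (X (u j)) = (if i = j then 1 else 0)"
      by auto
    define W where "W = (\<lambda>i. X (u i)) ` {..<n}"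
    have W: "finite W" "card W \<le> r"
      using Suc.prems card_image_le[of "{..<n}" "\<lambda>i. X (u i)"] by (auto simp: W_def)
    then obtain z where z: "X z \<notin> complex_vector.span W"
      using X unfolding rank_le_def by blast
    define u' where "u' = z - (\<Sum>i<n. cinner (X z) (X (u i)) *\<^sub>C u i)"
    have Xu': "X u' = X z - (\<Sum>i<n. cinner (X z) (X (u i)) *\<^sub>C X (u i))"
      by (simp add: u'_def blinfun.diff_right blinfun.sum_right bounded_opsD[OF Xb])
    have "(\<Sum>i<n. cinner (X z) (X (u i)) *\<^sub>C X (u i)) \<in> complex_vector.span W"
      by (intro complex_vector.span_sum complex_vector.span_scale complex_vector.span_base)
        (auto simp: W_def)
    then have nz: "X u' \<noteq> 0" using z Xu' by auto
    have orth: "cinner (X u') (X (u j)) = 0" if j: "j < n" for j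
    proof -
      have "(\<Sum>i<n. cinner (X z) (X (u i)) * cinner (X (u i)) (X (u j)))
          = (\<Sum>i<n. if i = j then cinner (X z) (X (u i)) else 0)"
        by (rule sum.cong) (auto simp: u j)
      also have "\<dots> = cinner (X z) (X (u j))" using j by simp
      finally show ?thesis
        by (simp add: Xu' cinner_diff_left cinner_sum_left cinner_scaleC_left)
    qed
    have orth': "cinner (X (u j)) (X u') = 0" if j: "j < n" for j
      using orth[OF j] cinner_commute[of "X (u j)" "X u'"] by simp
    define a where "a = complex_of_real (1 / norm (X u'))"
    have norm1: "cinner (X (a *\<^sub>C u')) (X (a *\<^sub>C u')) = 1"
      using nz by (simp add: bounded_opsD[OF Xb] cinner_self norm_scaleC a_def norm_divide)
    show ?case
    proof (intro exI allI impI)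
      fix i j assume "i < Suc n" "j < Suc n"
      then show "cinner (X ((u(n := a *\<^sub>C u')) i)) (X ((u(n := a *\<^sub>C u')) j)) = (if i = j then 1 else 0)"
        using u orth orth' norm1
        by (auto simp: less_Suc_eq bounded_opsD[OF Xb] cinner_scaleC_left cinner_scaleC_right)
    qed
  qed simp
  from this[of "Suc r"] obtain u where
    u: "\<forall>i<Suc r. \<forall>j<Suc r. cinner (X (u i)) (X (u j)) = (if i = j then 1 else 0)" by blast
  show ?thesis
    unfolding rank_ge_def by (rule exI[of _ u], rule exI[of _ "\<lambda>j. X (u j)"]) (use u in blast)
qed

lemma rank_geI:
  assumes "X \<in> bounded_ops" "\<And>m. rank_le m X \<Longrightarrow> r \<le> m"
  shows "rank_ge r X"
proof (cases r)
  case 0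
  then show ?thesis by (simp add: rank_ge_def)
next
  case (Suc m)
  then have "\<not> rank_le m X" using assms(2)[of m] by auto
  then show ?thesis using not_rank_le_imp_rank_ge[OF assms(1)] Suc by simp
qed

lemma rank_ge_adjoint:
  assumes X: "X \<in> bounded_ops" and r: "rank_ge r X"
  shows "rank_ge r (cadjoint X)"
proof -
  obtain u e where u: "\<forall>i<r. \<forall>j<r. cinner (X (u i)) (e j) = (if i = j then 1 else 0)"
    using r unfolding rank_ge_def by blast
  have "cinner (cadjoint X (e i)) (u j) = (if i = j then 1 else 0)" if "i < r" "j < r" for i j
    using u that adjoint_exists(2)[OF X, of "u j" "e i"] cinner_commute[of "cadjoint X (e i)" "u j"]
    by auto
  then show ?thesis unfolding rank_ge_def by blast
qed

lemma rank_le_mono: "rank_le a X \<Longrightarrow> a \<le> b \<Longrightarrow> rank_le b X"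
  unfolding rank_le_def by (meson order.trans)

lemma rank_le_zero: "rank_le a 0"
  unfolding rank_le_def by (rule exI[of _ "{}"]) auto

lemma rank_le_add:
  assumes "rank_le a X" "rank_le b Y"
  shows "rank_le (a + b) (X + Y)"
proof -
  obtain B where B: "finite B" "card B \<le> a" "range X \<subseteq> complex_vector.span B"
    using assms(1) by (auto simp: rank_le_def)
  obtain C where C: "finite C" "card C \<le> b" "range Y \<subseteq> complex_vector.span C"
    using assms(2) by (auto simp: rank_le_def)
  have "card (B \<union> C) \<le> a + b" using card_Un_le[of B C] B(2) C(2) by linarith
  moreover have "(X + Y) x \<in> complex_vector.span (B \<union> C)" for x
    unfolding blinfun.add_left
    by (rule complex_vector.span_add)
      (use B(3) C(3) complex_vector.span_mono[of B "B \<union> C"] complex_vector.span_mono[of C "B \<union> C"] in auto)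
  ultimately show ?thesis
    unfolding rank_le_def using B(1) C(1) by (intro exI[of _ "B \<union> C"]) auto
qed

lemma rank_le_compose_right: "rank_le a X \<Longrightarrow> rank_le a (X o\<^sub>L Y)"
  unfolding rank_le_def by force

lemma rank_le_compose_left:
  assumes Y: "Y \<in> bounded_ops" and X: "rank_le a X"
  shows "rank_le a (Y o\<^sub>L X)"
proof -
  obtain B where B: "finite B" "card B \<le> a" "range X \<subseteq> complex_vector.span B"
    using X by (auto simp: rank_le_def)
  have "Y v \<in> complex_vector.span (Y ` B)" if "v \<in> complex_vector.span B" for v
    using that
  proof (induction rule: complex_vector.span_induct_alt)
    case base
    then show ?case by (simp add: complex_vector.span_zero)
  next
    case (step c x y)
    then show ?case
      by (simp add: blinfun.add_right bounded_opsD[OF Y] complex_vector.span_add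
          complex_vector.span_scale complex_vector.span_base)
  qed
  then have "range (Y o\<^sub>L X) \<subseteq> complex_vector.span (Y ` B)" using B(3) by auto
  moreover have "card (Y ` B) \<le> a" using card_image_le[OF B(1), of "blinfun_apply Y"] B(2) by linarith
  ultimately show ?thesis unfolding rank_le_def using B(1) by blast
qed

lemma rank_le_uminus: "rank_le a X \<Longrightarrow> rank_le a (- X)"
  unfolding rank_le_def by (auto simp: blinfun.minus_left intro!: complex_vector.span_neg)

lemma rank_le_diff: "rank_le a X \<Longrightarrow> rank_le b Y \<Longrightarrow> rank_le (a + b) (X - Y)"
  using rank_le_add[of a X b "- Y"] rank_le_uminus[of b Y] by simp

lemma rank_le_scaleR:
  assumes "rank_le a X"
  shows "rank_le a (c *\<^sub>R X)"
proof -
  have "rank_le a ((complex_of_real c *\<^sub>C id_blinfun) o\<^sub>L X)"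
    by (intro rank_le_compose_left bounded_ops_scaleC bounded_ops_id assms)
  also have "(complex_of_real c *\<^sub>C id_blinfun) o\<^sub>L X = c *\<^sub>R X"
    by (rule blinfun_eqI) (simp add: scaleC_blinfun.rep_eq scaleC_of_real blinfun.scaleR_left)
  finally show ?thesis .
qed

lemma rank_le_sum:
  assumes "finite I" "\<And>i. i \<in> I \<Longrightarrow> rank_le c (f i)"
  shows "rank_le (card I * c) (sum f I)"
  using assms by (induction I) (simp_all add: rank_le_zero rank_le_add)

lemma finite_rank_ops_imp_rank_le:
  assumes "T \<in> finite_rank_ops"
  obtains r where "rank_le r T"
  using assms by (auto simp: finite_rank_ops_def rank_le_def)

lemma rank_le_imp_rank_le_ops:
  assumes "T \<in> bounded_ops" "rank_le r T"
  shows "T \<in> rank_le_ops r"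
  using assms complex_vector.dim_le_card
  unfolding rank_le_ops_def finite_rank_ops_def rank_le_def by (blast intro: order.trans)

section \<open>Few pieces of a partition that carry the rank\<close>

context masa_algebra
begin

lemma partitions_sum_PD:
  assumes "partitions p K" "J \<subseteq> K"
  shows "sum id J \<in> PD" "a \<in> J \<Longrightarrow> (sum id J) (a x) = a x"
proof -
  have J: "finite J" using assms finite_subset by (auto simp: partitions_def)
  have "partitions (sum id J) J"
    using assms J by (auto simp: partitions_def blinfun.sum_left subset_iff)
  from partitions_absorb[OF this] show "a \<in> J \<Longrightarrow> (sum id J) (a x) = a x" by simp
  show "sum id J \<in> PD"
    using J assms(2)
  proof (induction J)
    case (insert a J)
    have "blinfun_apply a (blinfun_apply b x) = 0" if "b \<in> J" for b x
    proof -
      have "a \<noteq> b" "a \<in> K" "b \<in> K" using insert that by auto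
      then show ?thesis using assms(1) unfolding partitions_def by blast
    qed
    then have "blinfun_apply a ((sum id J) x) = 0" for x
      by (simp add: blinfun.sum_left blinfun.sum_right)
    then show ?case
      using insert assms(1) by (auto simp: partitions_def intro!: PD_add)
  qed (simp add: PD_zero)
qed

lemma partitions_sum_absorb:
  assumes "partitions p K" "L \<subseteq> K" "J \<subseteq> L"
  shows "(sum id L) ((sum id J) x) = (sum id J) x"
proof -
  define s where "s = sum id L"
  have "s (blinfun_apply a x) = a x" if "a \<in> J" for a
    unfolding s_def using partitions_sum_PD(2)[OF assms(1,2)] that assms(3) by blast
  then have "s ((sum id J) x) = (sum id J) x"
    by (simp add: blinfun.sum_left blinfun.sum_right)
  then show ?thesis by (simp only: s_def)
qed

text \<open>
  A basis of the range of \<open>X\<close> can be picked among the vectors \<open>X (a x)\<close> with \<open>a \<in> K\<close>.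
\<close>

lemma rank_ge_select:
  assumes X: "X \<in> bounded_ops" "rank_ge r X" and K: "partitions id_blinfun K"
  obtains J where "J \<subseteq> K" "card J \<le> r" "rank_ge r (X o\<^sub>L sum id J)"
proof -
  have K': "finite K" "K \<subseteq> PD" using K by (auto simp: partitions_def)
  define U where "U = (\<Union>a\<in>K. range (\<lambda>x. X (blinfun_apply a x)))"
  obtain B where B: "B \<subseteq> U" "complex_vector.independent B" "U \<subseteq> complex_vector.span B"
    using complex_vector.maximal_independent_subset[of U] by blast
  have XB: "range X \<subseteq> complex_vector.span B"
  proof
    fix y assume "y \<in> range X"
    then obtain x where "y = X x" by blast
    also have "x = (\<Sum>a\<in>K. blinfun_apply a x)"
    proof -
      have "id_blinfun x = (\<Sum>a\<in>K. blinfun_apply a x)"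
        using K unfolding partitions_def by blast
      then show ?thesis by simp
    qed
    finally have "y = (\<Sum>a\<in>K. X (blinfun_apply a x))" by (simp only: blinfun.sum_right)
    also have "\<dots> \<in> complex_vector.span B"
      using B(3) by (intro complex_vector.span_sum) (auto simp: U_def)
    finally show "y \<in> complex_vector.span B" .
  qed
  have "\<exists>B0\<subseteq>B. finite B0 \<and> card B0 = r"
  proof (cases "finite B")
    case True
    then have "r \<le> card B"
      using XB by (intro rank_ge_le_rank_le[OF X(2)]) (auto simp: rank_le_def)
    then show ?thesis
      by (meson obtain_subset_with_card_n)
  next
    case False
    then show ?thesis using infinite_arbitrarily_large by blast
  qed
  then obtain B0 where B0: "B0 \<subseteq> B" "finite B0" "card B0 = r" by blast
  have "\<exists>ax. fst ax \<in> K \<and> b = X (blinfun_apply (fst ax) (snd ax))" if "b \<in> B0" for b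
  proof -
    have "b \<in> U" using that B0(1) B(1) by blast
    then obtain a x where "a \<in> K" "b = X (blinfun_apply a x)" unfolding U_def by blast
    then show ?thesis by (intro exI[of _ "(a, x)"]) simp
  qed
  then have "\<exists>h. \<forall>b\<in>B0. fst (h b) \<in> K \<and> b = X (blinfun_apply (fst (h b)) (snd (h b)))"
    by (intro bchoice) blast
  then obtain h where h: "\<forall>b\<in>B0. fst (h b) \<in> K \<and> b = X (blinfun_apply (fst (h b)) (snd (h b)))" ..
  define f g where "f = (\<lambda>b. fst (h b))" and "g = (\<lambda>b. snd (h b))"
  have fg: "f b \<in> K" "b = X (blinfun_apply (f b) (g b))" if "b \<in> B0" for b
    using h that unfolding f_def g_def by blast+
  define J where "J = f ` B0"
  have J: "J \<subseteq> K" using fg(1) by (auto simp: J_def)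
  have "B0 \<subseteq> range (X o\<^sub>L sum id J)"
  proof
    fix b assume b: "b \<in> B0"
    then have "f b \<in> J" by (simp add: J_def)
    then have "(X o\<^sub>L sum id J) (f b (g b)) = X (f b (g b))"
      using partitions_sum_PD(2)[OF K J] by simp
    then have "b = (X o\<^sub>L sum id J) (f b (g b))" using fg(2)[OF b] by (simp only:)
    then show "b \<in> range (X o\<^sub>L sum id J)" by (rule range_eqI)
  qed
  moreover have "complex_vector.independent B0"
    using B(2) B0(1) complex_vector.independent_mono by blast
  ultimately have "r \<le> m" if m: "rank_le m (X o\<^sub>L sum id J)" for m
  proof -
    obtain C where C: "finite C" "card C \<le> m" "range (X o\<^sub>L sum id J) \<subseteq> complex_vector.span C"
      using m unfolding rank_le_def by blast
    then have "card B0 \<le> card C"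
      using complex_vector.independent_span_bound[of C B0] \<open>B0 \<subseteq> range (X o\<^sub>L sum id J)\<close>
        \<open>complex_vector.independent B0\<close> by (meson order.trans)
    then show ?thesis using C(2) B0(3) by linarith
  qed
  then have "rank_ge r (X o\<^sub>L sum id J)"
    by (intro rank_geI bounded_ops_compose X PD_bounded partitions_sum_PD(1)[OF K J])
  moreover have "card J \<le> r" using card_image_le[OF B0(2), of f] B0(3) by (simp add: J_def)
  ultimately show thesis using that J by blast
qed

text \<open>Selecting for \<open>X\<close> fixes pieces on the right, and selecting for the adjoint
  of the result fixes pieces on the left. Passing to the union on both sides preserves the
  biorthogonal system.\<close>

lemma rank_ge_select_both:
  assumes X: "X \<in> bounded_ops" "rank_ge r X" and K: "partitions id_blinfun K"
  obtains J where "J \<subseteq> K" "card J \<le> 2 * r" "rank_ge r (sum id J o\<^sub>L X o\<^sub>L sum id J)"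
proof -
  have Kfin: "finite K" using K by (simp add: partitions_def)
  obtain J where J: "J \<subseteq> K" "card J \<le> r" "rank_ge r (X o\<^sub>L sum id J)"
    using rank_ge_select[OF X K] by blast
  define Y where "Y = X o\<^sub>L sum id J"
  have Yb: "Y \<in> bounded_ops"
    unfolding Y_def by (intro bounded_ops_compose X PD_bounded partitions_sum_PD(1)[OF K J(1)])
  have "rank_ge r (cadjoint Y)" using rank_ge_adjoint[OF Yb] J(3) by (simp add: Y_def)
  then obtain L where L: "L \<subseteq> K" "card L \<le> r" "rank_ge r (cadjoint Y o\<^sub>L sum id L)"
    using rank_ge_select[OF _ _ K] adjoint_exists(1)[OF Yb] by blast
  define p q s where "p = sum id L" and "q = sum id J" and "s = sum id (J \<union> L)"
  have JL: "J \<union> L \<subseteq> K" using J L by blast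
  have P: "p \<in> PD" "q \<in> PD" "s \<in> PD"
    unfolding p_def q_def s_def by (rule partitions_sum_PD(1)[OF K]; use J L in blast)+
  have sp: "s (p x) = p x" and sq: "s (q x) = q x" for x
    unfolding p_def q_def s_def by (rule partitions_sum_absorb[OF K JL]; blast)+
  obtain u e where ue: "\<forall>i<r. \<forall>j<r. cinner ((cadjoint Y o\<^sub>L p) (u i)) (e j) = (if i = j then 1 else 0)"
    using L(3) unfolding rank_ge_def p_def by blast
  have bi: "cinner ((s o\<^sub>L X o\<^sub>L s) (q (e i))) (p (u j)) = (if i = j then 1 else 0)" if "i < r" "j < r" for i j
  proof -
    have "cinner ((s o\<^sub>L X o\<^sub>L s) (q (e i))) (p (u j)) = cinner (s (X (q (e i)))) (p (u j))"
      by (simp add: sq)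
    also have "\<dots> = cinner (X (q (e i))) (s (p (u j)))" by (rule PD_cinner_sa[OF P(3)])
    also have "\<dots> = cinner (Y (e i)) (p (u j))" by (simp add: sp Y_def q_def)
    also have "\<dots> = cinner (e i) (cadjoint Y (p (u j)))" by (rule adjoint_exists(2)[OF Yb])
    also have "\<dots> = cnj (cinner ((cadjoint Y o\<^sub>L p) (u j)) (e i))"
      using cinner_commute by simp
    finally show ?thesis using ue that by auto
  qed
  have "rank_ge r (s o\<^sub>L X o\<^sub>L s)"
    unfolding rank_ge_def
    by (rule exI[of _ "\<lambda>i. q (e i)"], rule exI[of _ "\<lambda>j. p (u j)"]) (intro allI impI bi)
  moreover have "card (J \<union> L) \<le> 2 * r"
    using card_Un_le[of J L] J(2) L(2) by linarith
  ultimately show thesis using that[of "J \<union> L"] JL by (simp add: s_def)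
qed

end

section \<open>Uniform bounds by Baire category\<close>

text \<open>A closed subset of a complete space is completely metrizable, so Baire's theorem applies
  within \<open>S\<close>; the relatively open set it yields is the trace of an open
  \<open>U\<close>.\<close>

lemma Baire_closed_cover:
  fixes S :: "'b::complete_space set" and F :: "nat \<Rightarrow> 'b set"
  assumes S: "closed S" "S \<noteq> {}" and F: "\<And>k. closed (F k)" "S = (\<Union>k. F k)"
  obtains k x U where "open U" "x \<in> S" "x \<in> U" "S \<inter> U \<subseteq> F k"
proof -
  have "\<exists>k. top_of_set S interior_of F k \<noteq> {}"
  proof (rule ccontr)
    assume contra: "\<not> ?thesis"
    have "top_of_set S interior_of \<Union> (range F) = {}"
    proof (rule Baire_category_alt)
      show "completely_metrizable_space (top_of_set S) \<or>
          locally_compact_space (top_of_set S) \<and> regular_space (top_of_set S)"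
        using S(1) closed_closedin completely_metrizable_space_closedin
          completely_metrizable_space_euclidean by blast
      fix T assume "T \<in> range F"
      then obtain k where T: "T = F k" by blast
      have "F k \<subseteq> S" using F(2) by blast
      then show "closedin (top_of_set S) T \<and> top_of_set S interior_of T = {}"
        using contra T F(1)[of k] by (simp add: closed_subset)
    qed simp
    then show False
      using S(2) F(2) interior_of_topspace[of "top_of_set S"] by simp
  qed
  then obtain k x where "x \<in> top_of_set S interior_of F k" by blast
  then obtain W where W: "openin (top_of_set S) W" "x \<in> W" "W \<subseteq> F k"
    by (auto simp: interior_of_def)
  then obtain U where U: "open U" "W = S \<inter> U"
    by (auto simp: openin_open)
  have "x \<in> S" "x \<in> U" "S \<inter> U \<subseteq> F k" using W(2,3) unfolding U(2) by simp_all
  then show thesis by (rule that[OF U(1)])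
qed

section \<open>Strong limits of projections and of corners\<close>

context masa_algebra
begin

text \<open>The projections are contractions, so convergence spreads from a dense set to all
  vectors; the limit commutes with \<open>D\<close> and lies in it by maximality. This supplies the
  completeness behind the Baire argument.\<close>

lemma PD_strong_limit:
  assumes P: "\<And>m. P m \<in> PD" and dense: "closure X = UNIV"
    and conv: "\<And>x. x \<in> X \<Longrightarrow> convergent (\<lambda>m. P m x)"
  obtains Q where "Q \<in> PD" "\<And>u. (\<lambda>m. P m u) \<longlonglongrightarrow> Q u"
proof -
  have "Cauchy (\<lambda>m. P m u)" for u
  proof (rule CauchyI)
    fix e :: real assume e: "0 < e"
    have "u \<in> closure X" using dense by simp
    then obtain x where x: "x \<in> X" "dist x u < e / 4"
      using closure_approachable[of u X] e by (metis divide_pos_pos zero_less_numeral)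
    have "Cauchy (\<lambda>m. P m x)" by (rule convergent_Cauchy[OF conv[OF x(1)]])
    then obtain M where M: "\<And>m n. m \<ge> M \<Longrightarrow> n \<ge> M \<Longrightarrow> norm (P m x - P n x) < e / 2"
      using CauchyD[of "\<lambda>m. P m x" "e / 2"] e by auto
    have "norm (P m u - P n u) < e" if "m \<ge> M" "n \<ge> M" for m n
    proof -
      have *: "norm (P k (u - x)) \<le> e / 4" for k
        using PD_norm_le[OF P, of k "u - x"] x(2) by (simp add: dist_norm norm_minus_commute)
      have "P m u - P n u = P m (u - x) - P n (u - x) + (P m x - P n x)"
        by (simp add: blinfun.diff_right)
      also have "norm \<dots> \<le> norm (P m (u - x)) + norm (P n (u - x)) + norm (P m x - P n x)"
        by (meson add_mono_thms_linordered_semiring(3) norm_triangle_ineq norm_triangle_ineq4 order.trans)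
      also have "\<dots> < e / 4 + e / 4 + e / 2"
        using M[OF that] by (intro add_le_less_mono add_mono *)
      finally show ?thesis by simp
    qed
    then show "\<exists>M. \<forall>m\<ge>M. \<forall>n\<ge>M. norm (P m u - P n u) < e" by blast
  qed
  then have "\<exists>z. (\<lambda>m. P m u) \<longlonglongrightarrow> z" for u
    using Cauchy_convergent convergent_def by blast
  then obtain q where q: "\<And>u. (\<lambda>m. P m u) \<longlonglongrightarrow> q u" by metis
  have "bounded_linear q"
  proof (rule bounded_linear_intro[where K = 1])
    show "q (x + y) = q x + q y" for x y
      using q[of "x + y"] by (intro LIMSEQ_unique[OF _ tendsto_add[OF q q]]) (simp add: blinfun.add_right)
    show "q (r *\<^sub>R x) = r *\<^sub>R q x" for r x
      using q[of "r *\<^sub>R x"]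
      by (intro LIMSEQ_unique[OF _ tendsto_scaleR[OF tendsto_const q]]) (simp add: blinfun.scaleR_right)
    show "norm (q x) \<le> norm x * 1" for x
      using LIMSEQ_le_const2[OF tendsto_norm[OF q], of x "norm x"] PD_norm_le[OF P] by auto
  qed
  then have Q: "blinfun_apply (Blinfun q) = q" by (rule bounded_linear_Blinfun_apply)
  have comm: "q (d x) = d (q x)" if "d \<in> D" for d x
    using q[of "d x"]
    by (intro LIMSEQ_unique[OF _ blinfun.tendsto[OF tendsto_const q]])
      (simp add: D_comm_apply[OF PD_D[OF P] that])
  have comp: "q (a *\<^sub>C x) = a *\<^sub>C q x" for a x
    using q[of "a *\<^sub>C x"]
    by (intro LIMSEQ_unique[OF _ bounded_linear.tendsto[OF bounded_linear_scaleC_right q]])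
      (simp add: bounded_opsD[OF PD_bounded[OF P]])
  have sa: "inner (q x) y = inner x (q y)" for x y
  proof (rule LIMSEQ_unique)
    show "(\<lambda>m. inner (P m x) y) \<longlonglongrightarrow> inner (q x) y" by (intro tendsto_intros q)
    show "(\<lambda>m. inner (P m x) y) \<longlonglongrightarrow> inner x (q y)"
      unfolding PD_sa[OF P] by (intro tendsto_intros q)
  qed
  \<comment> \<open>Products pass to strong limits here because the left factors are contractions:
    \<open>P m (P m x - q x)\<close> tends to 0.\<close>
  have idem: "q (q x) = q x" for x
  proof (rule LIMSEQ_unique)
    have "(\<lambda>m. norm (P m x - q x)) \<longlonglongrightarrow> 0"
      using q by (intro tendsto_norm_zero) (simp add: LIM_zero_iff)
    then have "(\<lambda>m. P m (P m x - q x)) \<longlonglongrightarrow> 0"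
      by (rule Lim_null_comparison[rotated]) (simp add: PD_norm_le P)
    from tendsto_add[OF this q[of "q x"]] show "(\<lambda>m. P m x) \<longlonglongrightarrow> q (q x)"
      by (simp add: blinfun.diff_right PD_idem[OF P])
  qed (rule q)
  have "Blinfun q \<in> bounded_ops" by (simp add: bounded_ops_def Q comp)
  then have "Blinfun q \<in> D" by (rule D_I) (simp add: Q comm)
  then have "Blinfun q \<in> PD" by (simp add: PD_iff Q sa idem)
  then show thesis using that[of "Blinfun q"] q by (simp add: Q)
qed

definition corner :: "('a \<Rightarrow>\<^sub>L 'a) \<Rightarrow> ('a \<Rightarrow>\<^sub>L 'a) \<Rightarrow> 'a \<Rightarrow>\<^sub>L 'a" where
  "corner T P = (id_blinfun - P) o\<^sub>L T o\<^sub>L P"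

lemma corner_apply: "corner T P x = T (P x) - P (T (P x))"
  by (simp add: corner_def blinfun.diff_left)

lemma corner_bounded_ops: "T \<in> bounded_ops \<Longrightarrow> P \<in> PD \<Longrightarrow> corner T P \<in> bounded_ops"
  by (simp add: corner_def bounded_ops_compose bounded_ops_diff PD_bounded)

text \<open>Corners converge pointwise, so a biorthogonal system of size \<open>Suc r\<close> for
  the limit would almost be one for a late corner, contradicting its rank bound.\<close>

lemma rank_le_corner_limit:
  fixes P :: "nat \<Rightarrow> 'a \<Rightarrow>\<^sub>L 'a" and P' :: "'a \<Rightarrow>\<^sub>L 'a"
  assumes T: "\<And>m. T m \<in> bounded_ops" "T \<longlonglongrightarrow> T'" "T' \<in> bounded_ops"
    and P: "\<And>m. P m \<in> PD" "\<And>u. (\<lambda>m. P m u) \<longlonglongrightarrow> P' u" "P' \<in> PD"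
    and r: "\<And>m. rank_le r (corner (T m) (P m))"
  shows "rank_le r (corner T' P')"
proof (rule ccontr)
  assume "\<not> rank_le r (corner T' P')"
  then have "rank_ge (Suc r) (corner T' P')"
    by (intro not_rank_le_imp_rank_ge corner_bounded_ops T P)
  then obtain u e where ue: "\<forall>i<Suc r. \<forall>j<Suc r.
      cinner (corner T' P' (u i)) (e j) = (if i = j then 1 else 0)"
    unfolding rank_ge_def by blast
  have lim: "(\<lambda>m. corner (T m) (P m) x) \<longlonglongrightarrow> corner T' P' x" for x
  proof -
    have y: "(\<lambda>m. T m (P m x)) \<longlonglongrightarrow> T' (P' x)"
      by (intro blinfun.tendsto T P)
    have "(\<lambda>m. norm (T m (P m x) - T' (P' x))) \<longlonglongrightarrow> 0"
      using y by (intro tendsto_norm_zero) (simp add: LIM_zero_iff)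
    then have "(\<lambda>m. P m (T m (P m x) - T' (P' x))) \<longlonglongrightarrow> 0"
      by (rule Lim_null_comparison[rotated]) (simp add: PD_norm_le P)
    from tendsto_add[OF this P(2)[of "T' (P' x)"]]
    have "(\<lambda>m. P m (T m (P m x))) \<longlonglongrightarrow> P' (T' (P' x))"
      by (simp add: blinfun.diff_right)
    with y show ?thesis unfolding corner_apply by (rule tendsto_diff)
  qed
  have "\<forall>\<^sub>F m in sequentially. \<forall>i\<in>{..<Suc r}. \<forall>j\<in>{..<Suc r}.
      cmod ((if i = j then 1 else 0) - cinner (corner (T m) (P m) (u i)) (e j)) < 1 / real (Suc r)"
  proof (intro eventually_ball_finite ballI finite_lessThan)
    fix i j assume "i \<in> {..<Suc r}" "j \<in> {..<Suc r}"
    then have *: "cinner (corner T' P' (u i)) (e j) = (if i = j then 1 else 0)" using ue by simp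
    have "(\<lambda>m. cmod ((if i = j then 1 else 0) - cinner (corner (T m) (P m) (u i)) (e j)))
        \<longlonglongrightarrow> cmod ((if i = j then 1 else 0) - cinner (corner T' P' (u i)) (e j))"
      by (intro tendsto_norm tendsto_diff tendsto_const tendsto_cinner lim)
    then show "\<forall>\<^sub>F m in sequentially.
        cmod ((if i = j then 1 else 0) - cinner (corner (T m) (P m) (u i)) (e j)) < 1 / real (Suc r)"
      by (rule order_tendstoD(2)) (simp add: *)
  qed
  then obtain m where "\<forall>i\<in>{..<Suc r}. \<forall>j\<in>{..<Suc r}.
      cmod ((if i = j then 1 else 0) - cinner (corner (T m) (P m) (u i)) (e j)) < 1 / real (Suc r)"
    using eventually_happens'[OF sequentially_bot] by blast
  then have "Suc r \<le> r"
    by (intro rank_le_perturbed_biorthogonal[OF r[of m], of "Suc r" u e]) auto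
  then show False by simp
qed

text \<open>Coordinatewise convergence of the samples along a dense sequence is strong convergence
  of the projections. The relation \<open>R\<close> is left open to serve both for the whole space
  and for the sets of bounded rank that cover it.\<close>

lemma closed_sampled_pairs:
  fixes x :: "nat \<Rightarrow> 'a" and R :: "('a \<Rightarrow>\<^sub>L 'a) \<Rightarrow> ('a \<Rightarrow>\<^sub>L 'a) \<Rightarrow> bool"
  assumes dense: "closure (range x) = UNIV" and A: "closed A"
    and R: "\<And>T P T' P'. \<lbrakk>\<And>m. T m \<in> A; T \<longlonglongrightarrow> T'; T' \<in> A; \<And>m. P m \<in> PD;
      \<And>u. (\<lambda>m. blinfun_apply (P m) u) \<longlonglongrightarrow> blinfun_apply P' u; P' \<in> PD; \<And>m. R (T m) (P m)\<rbrakk> \<Longrightarrow> R T' P'"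
  shows "closed {(T, \<lambda>n. blinfun_apply P (x n)) | T P. T \<in> A \<and> P \<in> PD \<and> R T P}" (is "closed ?S")
  unfolding closed_sequential_limits
proof (intro allI impI, elim conjE)
  fix s l assume s: "\<forall>m. s m \<in> ?S" and l: "s \<longlonglongrightarrow> l"
  have "\<exists>T P. s m = (T, \<lambda>n. blinfun_apply P (x n)) \<and> T \<in> A \<and> P \<in> PD \<and> R T P" for m
    using s[rule_format, of m] by simp
  then obtain T P where TP: "\<And>m. s m = (T m, \<lambda>n. blinfun_apply (P m) (x n))"
    "\<And>m. T m \<in> A" "\<And>m. P m \<in> PD" "\<And>m. R (T m) (P m)"
    by metis
  have T: "T \<longlonglongrightarrow> fst l" using tendsto_fst[OF l] by (simp add: TP(1))
  then have TA: "fst l \<in> A" using closed_sequentially[OF A] TP(2) by blast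
  have snd: "(\<lambda>m. snd (s m)) \<longlonglongrightarrow> snd l" by (rule tendsto_snd[OF l])
  have coord: "(\<lambda>m. P m (x n)) \<longlonglongrightarrow> snd l n" for n
  proof -
    have "(\<lambda>m. snd (s m) n) \<longlonglongrightarrow> snd l n"
      by (rule continuous_on_tendsto_compose[OF continuous_on_product_coordinates snd]) auto
    then show ?thesis by (simp add: TP(1))
  qed
  have conv: "convergent (\<lambda>m. P m y)" if "y \<in> range x" for y
    using that coord by (auto intro: convergentI)
  obtain Q where Q: "Q \<in> PD" "\<And>u. (\<lambda>m. P m u) \<longlonglongrightarrow> Q u"
    using PD_strong_limit[OF TP(3) dense conv] by blast
  have "snd l = (\<lambda>n. Q (x n))"
    by (rule ext) (rule LIMSEQ_unique[OF coord Q(2)])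
  moreover have "R (fst l) Q"
    by (rule R[OF TP(2) T TA TP(3) Q(2,1) TP(4)])
  ultimately have "l = (fst l, \<lambda>n. Q (x n)) \<and> fst l \<in> A \<and> Q \<in> PD \<and> R (fst l) Q"
    using TA Q(1) by (simp add: prod_eq_iff)
  then show "l \<in> ?S" by blast
qed

end

section \<open>Basic neighbourhoods in the space of sampled pairs\<close>

lemma open_prod_fun_basis:
  fixes U :: "('b::metric_space \<times> (nat \<Rightarrow> 'c::metric_space)) set"
  assumes "open U" "(a, f) \<in> U"
  obtains e I where "0 < e" "finite I"
    "\<And>b g. dist b a < e \<Longrightarrow> (\<And>n. n \<in> I \<Longrightarrow> dist (g n) (f n) < e) \<Longrightarrow> (b, g) \<in> U"
proof -
  obtain A B where AB: "open A" "open B" "(a, f) \<in> A \<times> B" "A \<times> B \<subseteq> U"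
    using open_prod_elim[OF assms] by blast
  obtain r where r: "0 < r" "ball a r \<subseteq> A" using AB openE by blast
  have "openin (product_topology (\<lambda>i. euclidean) UNIV) B" using AB(2) by (simp add: open_fun_def)
  then obtain Z where Z: "f \<in> Pi\<^sub>E UNIV Z" "\<And>i. openin euclidean (Z i)"
    "finite {i. Z i \<noteq> topspace euclidean}" "Pi\<^sub>E UNIV Z \<subseteq> B"
    using product_topology_open_contains_basis[of "\<lambda>i. euclidean" UNIV B f] AB(3) by auto
  define I where "I = {i. Z i \<noteq> UNIV}"
  have I: "finite I" using Z(3) by (simp add: I_def)
  have "\<exists>d>0. ball (f i) d \<subseteq> Z i" for i
    using Z(1) Z(2)[of i] open_contains_ball by (auto simp: PiE_iff)
  then obtain d where d: "\<And>i. 0 < d i" "\<And>i. ball (f i) (d i) \<subseteq> Z i" by metis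
  define e where "e = Min (insert r (d ` I))"
  have e: "0 < e" "e \<le> r" "\<And>i. i \<in> I \<Longrightarrow> e \<le> d i"
    using I r(1) d(1) by (auto simp: e_def)
  show thesis
  proof (rule that[OF e(1) I])
    fix b g assume b: "dist b a < e" and g: "\<And>n. n \<in> I \<Longrightarrow> dist (g n) (f n) < e"
    have "b \<in> A" using b e(2) r(2) by (auto simp: subset_iff dist_commute)
    moreover have "g i \<in> Z i" for i
    proof (cases "i \<in> I")
      case True
      then have "g i \<in> ball (f i) (d i)" using g[OF True] e(3)[OF True] by (simp add: dist_commute)
      then show ?thesis using d(2) by blast
    qed (simp add: I_def)
    then have "g \<in> B" using Z(4) by (auto simp: PiE_iff)
    ultimately show "(b, g) \<in> U" using AB(4) by blast
  qed
qed

lemma separable_space_euclidean_dense_sequence: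
  assumes "separable_space (euclidean :: 'a::metric_space topology)"
  obtains x :: "nat \<Rightarrow> 'a::metric_space" where "closure (range x) = UNIV"
proof -
  obtain C :: "'a::metric_space set" where C: "countable C" "closure C = UNIV"
    using assms by (auto simp: separable_space_def)
  then have "C \<noteq> {}" by auto
  then have "range (from_nat_into C) = C" using C(1) by (rule range_from_nat_into)
  then show thesis using that C(2) by metis
qed

context masa_algebra
begin

lemma corner_add: "corner (S + T) P = corner S P + corner T P"
  by (rule blinfun_eqI) (simp add: corner_apply blinfun.add_left blinfun.add_right)

lemma corner_scaleR: "corner (c *\<^sub>R T) P = c *\<^sub>R corner T P"
  by (rule blinfun_eqI)
    (simp add: corner_apply blinfun.scaleR_left blinfun.scaleR_right scaleR_diff_right)

lemma partitions_decompose: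
  assumes "partitions id_blinfun K"
  shows "X = (\<Sum>a\<in>K. \<Sum>b\<in>K. a o\<^sub>L X o\<^sub>L b)"
proof (rule blinfun_eqI)
  fix x
  have id: "y = (\<Sum>a\<in>K. blinfun_apply a y)" for y
  proof -
    have "id_blinfun y = (\<Sum>a\<in>K. blinfun_apply a y)"
      using assms unfolding partitions_def by blast
    then show ?thesis by simp
  qed
  have Xx: "X x = (\<Sum>b\<in>K. X (blinfun_apply b x))"
    by (subst id[of x]) (rule blinfun.sum_right)
  have "X x = (\<Sum>a\<in>K. blinfun_apply a (X x))" by (rule id)
  also have "\<dots> = (\<Sum>a\<in>K. \<Sum>b\<in>K. blinfun_apply a (X (blinfun_apply b x)))"
    by (simp only: Xx blinfun.sum_right)
  finally have "X x = (\<Sum>a\<in>K. \<Sum>b\<in>K. blinfun_apply a (X (blinfun_apply b x)))" .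
  then show "X x = (\<Sum>a\<in>K. \<Sum>b\<in>K. a o\<^sub>L X o\<^sub>L b) x"
    by (simp add: blinfun.sum_left)
qed

lemma rank_le_one:
  assumes "\<exists>v. range (blinfun_apply p) \<subseteq> complex_vector.span {v}"
  shows "rank_le 1 p"
proof -
  obtain v where "range (blinfun_apply p) \<subseteq> complex_vector.span {v}" using assms by blast
  then show ?thesis unfolding rank_le_def by (intro exI[of _ "{v}"]) simp
qed

text \<open>Baire's theorem bounds the rank only for operators near some \<open>T0\<close>. By
  linearity of corners an arbitrary \<open>T\<close> is handled as a multiple of the difference of
  \<open>T0 + t *\<^sub>R T\<close> and \<open>T0\<close>, at the price of doubling the
  bound.\<close>

lemma locally_uniform_corner_rank:
  assumes sep: "separable_space (euclidean :: 'a topology)"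
    and A: "complex_vector.subspace A" "closed A"
    and A_bounded: "A \<subseteq> bounded_ops"
    and fin: "\<And>T P. T \<in> A \<Longrightarrow> P \<in> PD \<Longrightarrow> corner T P \<in> finite_rank_ops"
  shows "\<exists>k. \<exists>Q\<in>PD. \<exists>V e. finite V \<and> 0 < e \<and>
    (\<forall>T\<in>A. \<forall>P\<in>PD. (\<forall>v\<in>V. norm (blinfun_apply P v - blinfun_apply Q v) < e) \<longrightarrow> rank_le k (corner T P))"
proof -
  obtain x :: "nat \<Rightarrow> 'a" where x: "closure (range x) = UNIV"
    using separable_space_euclidean_dense_sequence[OF sep] by blast
  define S where "S R = {(T, \<lambda>n. blinfun_apply P (x n)) | T P. T \<in> A \<and> P \<in> PD \<and> R T P}" for R
  have "closed (S (\<lambda>_ _. True))"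
    unfolding S_def by (rule closed_sampled_pairs[OF x A(2)]) simp
  moreover have "(0, \<lambda>n. blinfun_apply 0 (x n)) \<in> S (\<lambda>_ _. True)"
    unfolding S_def using complex_vector.subspace_0[OF A(1)] PD_zero by blast
  then have "S (\<lambda>_ _. True) \<noteq> {}" by blast
  moreover have "closed (S (\<lambda>T P. rank_le k (corner T P)))" for k
    unfolding S_def
  proof (rule closed_sampled_pairs[OF x A(2)])
    show "rank_le k (corner T' P')"
      if "\<And>m. T m \<in> A" "T \<longlonglongrightarrow> T'" "T' \<in> A" "\<And>m. P m \<in> PD" "\<And>u. (\<lambda>m. P m u) \<longlonglongrightarrow> P' u" "P' \<in> PD"
        "\<And>m. rank_le k (corner (T m) (P m))"
      for T T' and P :: "nat \<Rightarrow> 'a \<Rightarrow>\<^sub>L 'a" and P' :: "'a \<Rightarrow>\<^sub>L 'a"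
      by (rule rank_le_corner_limit[OF _ that(2) _ that(4,5,6,7)]) (use that A_bounded in blast)+
  qed
  moreover have "S (\<lambda>_ _. True) = (\<Union>k. S (\<lambda>T P. rank_le k (corner T P)))"
  proof -
    have "\<exists>k. rank_le k (corner T P)" if "T \<in> A" "P \<in> PD" for T P
      using finite_rank_ops_imp_rank_le[OF fin[OF that]] by metis
    then show ?thesis unfolding S_def by blast
  qed
  ultimately obtain k z U where U: "open U" "z \<in> S (\<lambda>_ _. True)" "z \<in> U"
    "S (\<lambda>_ _. True) \<inter> U \<subseteq> S (\<lambda>T P. rank_le k (corner T P))"
    by (rule Baire_closed_cover)
  obtain T0 Q where z: "z = (T0, \<lambda>n. blinfun_apply Q (x n))" "T0 \<in> A" "Q \<in> PD"
    using U(2) unfolding S_def by blast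
  obtain e I where e: "0 < e" "finite I" and
    near: "\<And>T g. dist T T0 < e \<Longrightarrow> (\<And>n. n \<in> I \<Longrightarrow> dist (g n) (Q (x n)) < e) \<Longrightarrow> (T, g) \<in> U"
    using open_prod_fun_basis[OF U(1) U(3)[unfolded z(1)]] by blast
  have near_rank: "rank_le k (corner T P)"
    if T: "T \<in> A" "dist T T0 < e" and P: "P \<in> PD" "\<And>v. v \<in> x ` I \<Longrightarrow> norm (P v - Q v) < e" for T P
  proof -
    have "(T, \<lambda>n. blinfun_apply P (x n)) \<in> U"
      using T(2) P(2) by (intro near) (simp_all add: dist_norm)
    moreover have "(T, \<lambda>n. blinfun_apply P (x n)) \<in> S (\<lambda>_ _. True)"
      unfolding S_def using T P by blast
    ultimately have "(T, \<lambda>n. blinfun_apply P (x n)) \<in> S (\<lambda>T P. rank_le k (corner T P))"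
      using U(4) by blast
    then obtain P' where P': "(\<lambda>n. blinfun_apply P (x n)) = (\<lambda>n. blinfun_apply P' (x n))"
      "rank_le k (corner T P')"
      unfolding S_def by auto
    \<comment> \<open>Samples on a dense sequence determine a projection, so the one witnessing
      membership is \<open>P\<close> itself.\<close>
    have "P u = P' u" for u
    proof -
      have "closed {u. P u = P' u}" by (intro closed_Collect_eq continuous_intros)
      moreover have "range x \<subseteq> {u. P u = P' u}" using fun_cong[OF P'(1)] by auto
      ultimately have "closure (range x) \<subseteq> {u. P u = P' u}" by (rule closure_minimal[rotated])
      then show ?thesis using x by auto
    qed
    then have "P = P'" by (rule blinfun_eqI)
    then show ?thesis using P'(2) by simp
  qed
  have final: "rank_le (k + k) (corner T P)"
    if T: "T \<in> A" and P: "P \<in> PD" "\<And>v. v \<in> x ` I \<Longrightarrow> norm (P v - Q v) < e" for T P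
  proof -
    \<comment> \<open>Chosen so that \<open>t * norm T < e\<close>; the summand 1 covers
      \<open>T = 0\<close>.\<close>
    define t where "t = e / (2 * (norm T + 1))"
    have t: "t > 0" using e(1) by (simp add: t_def add_nonneg_pos)
    have "t * norm T < e"
    proof -
      have "norm T + 1 \<noteq> 0" using norm_ge_zero[of T] by linarith
      then have "t * (2 * (norm T + 1)) = e" by (simp add: t_def)
      then have "2 * (t * norm T) + 2 * t = e" by (simp add: algebra_simps)
      then show ?thesis using t e(1) by linarith
    qed
    then have "dist (T0 + t *\<^sub>R T) T0 < e" using t by (simp add: dist_norm)
    moreover have "T0 + t *\<^sub>R T \<in> A"
      using complex_vector.subspace_add[OF A(1) z(2) complex_vector.subspace_scale[OF A(1) T, of "complex_of_real t"]]
      by (simp add: scaleC_of_real)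
    ultimately have "rank_le k (corner (T0 + t *\<^sub>R T) P)" by (intro near_rank P)
    moreover have "rank_le k (corner T0 P)" by (intro near_rank P z) (simp add: e)
    ultimately have "rank_le (k + k) ((1 / t) *\<^sub>R (corner (T0 + t *\<^sub>R T) P - corner T0 P))"
      by (intro rank_le_scaleR rank_le_diff)
    then show ?thesis using t by (simp add: corner_add corner_scaleR)
  qed
  show ?thesis
  proof (rule exI[of _ "k + k"], rule bexI[OF _ z(3)], rule exI[of _ "x ` I"], rule exI[of _ e],
      intro conjI ballI impI)
    fix T P assume "T \<in> A" "P \<in> PD" and "\<forall>v\<in>x ` I. norm (blinfun_apply P v - blinfun_apply Q v) < e"
    then show "rank_le (k + k) (corner T P)" by (intro final) blast+
  qed (use e in auto)
qed

text \<open>The partition depends only on the neighbourhood of \<open>Q\<close>, not on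
  \<open>T\<close> or \<open>P\<close>, so the number of blocks is uniform. A block has rank at most
  \<open>k\<close>, or at most 1 if one of its sides does, whence \<open>k + 1\<close>.\<close>

theorem uniform_corner_rank:
  assumes "separable_space (euclidean :: 'a topology)"
    and "complex_vector.subspace A" "closed A" and A: "A \<subseteq> bounded_ops"
    and "\<And>T P. T \<in> A \<Longrightarrow> P \<in> PD \<Longrightarrow> corner T P \<in> finite_rank_ops"
  obtains r where "\<And>T P. T \<in> A \<Longrightarrow> P \<in> PD \<Longrightarrow> rank_le r (corner T P)"
proof -
  have "\<exists>k. \<exists>Q\<in>PD. \<exists>V e. finite V \<and> 0 < e \<and>
    (\<forall>T\<in>A. \<forall>P\<in>PD. (\<forall>v\<in>V. norm (blinfun_apply P v - blinfun_apply Q v) < e) \<longrightarrow> rank_le k (corner T P))"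
    by (rule locally_uniform_corner_rank) (fact assms)+
  then obtain k Q V e where Q: "Q \<in> PD" and V: "finite V" and e: "0 < e"
    and near: "\<forall>T\<in>A. \<forall>P\<in>PD. (\<forall>v\<in>V. norm (blinfun_apply P v - blinfun_apply Q v) < e) \<longrightarrow>
      rank_le k (corner T P)"
    by (elim exE bexE conjE)
  \<comment> \<open>With \<open>e / 4\<close> for each piece, the union of two small pieces is below
    \<open>e / 2\<close> on \<open>V\<close>, and exchanging \<open>Q\<close> for \<open>P\<close>
    there costs at most twice as much.\<close>
  obtain K where K: "partitions id_blinfun K"
    "\<And>a. a \<in> K \<Longrightarrow> (\<exists>v. range a \<subseteq> complex_vector.span {v}) \<or> (\<forall>x\<in>V. norm (a x) < e / 4)"
    using fine_partition[OF V, of "e / 4"] e by auto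
  have Kfin: "finite K" and KP: "\<And>a. a \<in> K \<Longrightarrow> a \<in> PD"
    using K(1) by (auto simp: partitions_def)
  have "rank_le (card K * (card K * (k + 1))) (corner T P)" if T: "T \<in> A" and P: "P \<in> PD" for T P
  proof -
    have Tb: "T \<in> bounded_ops" using T A by blast
    have block: "rank_le (k + 1) (a o\<^sub>L corner T P o\<^sub>L b)" if ab: "a \<in> K" "b \<in> K" for a b
    proof -
      note aP = KP[OF ab(1)] and bP = KP[OF ab(2)]
      consider "\<exists>v. range (blinfun_apply a) \<subseteq> complex_vector.span {v}"
        | "\<exists>v. range (blinfun_apply b) \<subseteq> complex_vector.span {v}"
        | "\<forall>x\<in>V. norm (a x) < e / 4" "\<forall>x\<in>V. norm (b x) < e / 4"
        using K(2) ab by blast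
      then show ?thesis
      proof cases
        case 1
        then have "rank_le 1 (a o\<^sub>L corner T P o\<^sub>L b)"
          by (intro rank_le_compose_right rank_le_one)
        then show ?thesis by (rule rank_le_mono) simp
      next
        case 2
        then have "rank_le 1 (a o\<^sub>L corner T P o\<^sub>L b)"
          by (intro rank_le_compose_left rank_le_one bounded_ops_compose PD_bounded aP
              corner_bounded_ops Tb P)
        then show ?thesis by (rule rank_le_mono) simp
      next
        case 3
        define q where "q = a + b - (a o\<^sub>L b)"
        have q: "q \<in> PD" unfolding q_def by (rule PD_union[OF aP bP])
        have q_apply: "q x = a x + b x - a (b x)" for x
          by (simp add: q_def blinfun.add_left blinfun.diff_left)
        \<comment> \<open>\<open>P\<close> under \<open>q\<close> and \<open>Q\<close> outside it:
          close to \<open>Q\<close> on \<open>V\<close>, yet indistinguishable from \<open>P\<close>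
          in the block given by \<open>a\<close> and \<open>b\<close>.\<close>
        define P' where "P' = (P o\<^sub>L q) + (Q o\<^sub>L (id_blinfun - q))"
        have P': "P' \<in> PD"
          unfolding P'_def
          by (intro PD_add PD_compose P Q q PD_compl)
            (simp add: blinfun.diff_left blinfun.diff_right PD_comm[OF q Q] PD_idem[OF q])
        have P'_apply: "P' x = P (q x) + Q (x - q x)" for x
          by (simp add: P'_def blinfun.add_left blinfun.diff_left)
        have P'_near: "norm (P' v - Q v) < e" if v: "v \<in> V" for v
        proof -
          have "norm (q v) \<le> norm (a v) + norm (b v - a (b v))"
            unfolding q_apply by (rule order.trans[OF _ norm_triangle_ineq]) (simp add: algebra_simps)
          also have "norm (b v - a (b v)) \<le> norm (b v)"
            using PD_norm_le[OF PD_compl[OF aP], of "b v"] by (simp add: blinfun.diff_left)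
          also have "norm (a v) + norm (b v) < e / 4 + e / 4"
            using 3 v by (intro add_strict_mono) blast+
          finally have "norm (q v) < e / 2" by simp
          moreover have "norm (P' v - Q v) \<le> norm (P (q v)) + norm (Q (q v))"
            using norm_triangle_ineq4[of "P (q v)" "Q (q v)"] by (simp add: P'_apply blinfun.diff_right)
          ultimately show ?thesis
            using PD_norm_le[OF P, of "q v"] PD_norm_le[OF Q, of "q v"] by linarith
        qed
        have "rank_le k (corner T P')"
          by (rule near[rule_format, OF T P']) (rule P'_near)
        then have "rank_le k (a o\<^sub>L corner T P' o\<^sub>L b)"
          by (intro rank_le_compose_right rank_le_compose_left PD_bounded aP)
        also have "a o\<^sub>L corner T P' o\<^sub>L b = a o\<^sub>L corner T P o\<^sub>L b"
        proof (rule blinfun_eqI)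
          fix x
          have qb: "q (b x) = b x" for x
            by (simp add: q_apply PD_idem[OF bP])
          have qa: "a (q x) = a x" for x
            by (simp add: q_apply blinfun.diff_right blinfun.add_right PD_idem[OF aP])
          have 1: "P' (b x) = P (b x)" by (simp add: P'_apply qb)
          have 2: "a (P' y) = a (P y)" for y
          proof -
            have "a (P' y) = a (q (P' y))" by (simp add: qa)
            also have "q (P' y) = q (P y)"
              by (simp add: P'_apply blinfun.add_right blinfun.diff_right PD_comm[OF q P]
                  PD_comm[OF q Q] PD_idem[OF q])
            finally show ?thesis by (simp add: qa)
          qed
          show "(a o\<^sub>L corner T P' o\<^sub>L b) x = (a o\<^sub>L corner T P o\<^sub>L b) x"
            by (simp add: corner_apply blinfun.diff_right 1 2)
        qed
        finally show ?thesis by (rule rank_le_mono) simp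
      qed
    qed
    have "rank_le (card K * (card K * (k + 1))) (\<Sum>a\<in>K. \<Sum>b\<in>K. a o\<^sub>L corner T P o\<^sub>L b)"
      by (intro rank_le_sum Kfin block)
    then show ?thesis using partitions_decompose[OF K(1), of "corner T P"] by simp
  qed
  then show thesis using that by blast
qed

end

section \<open>Distance to the masa\<close>

context masa_algebra
begin

text \<open>Distance to \<open>D\<close> measured in rank; it is subadditive, so the blocks of an
  operator can be treated separately.\<close>

definition near_masa :: "nat \<Rightarrow> ('a \<Rightarrow>\<^sub>L 'a) \<Rightarrow> bool" where
  "near_masa r X \<longleftrightarrow> (\<exists>d\<in>D. rank_le r (X - d))"

lemma near_masa_mono: "near_masa a X \<Longrightarrow> a \<le> b \<Longrightarrow> near_masa b X"
  unfolding near_masa_def using rank_le_mono by blast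

lemma rank_le_imp_near_masa: "rank_le r X \<Longrightarrow> near_masa r X"
  unfolding near_masa_def by (rule bexI[of _ 0]) (simp_all add: D_zero)

lemma near_masa_add:
  assumes "near_masa a X" "near_masa b Y"
  shows "near_masa (a + b) (X + Y)"
proof -
  obtain d e where de: "d \<in> D" "e \<in> D" "rank_le a (X - d)" "rank_le b (Y - e)"
    using assms by (auto simp: near_masa_def)
  have "rank_le (a + b) ((X - d) + (Y - e))" using de by (intro rank_le_add)
  also have "(X - d) + (Y - e) = (X + Y) - (d + e)" by simp
  finally show ?thesis unfolding near_masa_def using D_add[OF de(1,2)] by blast
qed

lemma near_masa_sum:
  assumes "finite I" "\<And>i. i \<in> I \<Longrightarrow> near_masa c (f i)"
  shows "near_masa (card I * c) (sum f I)"
  using assms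
proof (induction I)
  case empty
  then show ?case using rank_le_imp_near_masa[OF rank_le_zero] by simp
next
  case (insert i I)
  then have "near_masa (c + card I * c) (f i + sum f I)" by (intro near_masa_add) auto
  then show ?case using insert by simp
qed

text \<open>The vectors \<open>w i\<close> and \<open>f j\<close> exhibit a nonsingular minor of the
  corner and lie in the range of \<open>M\<close>, so they survive a change of \<open>P\<close>
  inside \<open>L\<close>. For each part \<open>R\<close> of \<open>L\<close>, maximality of
  \<open>r\<close> makes the Schur complement of this minor vanish between \<open>R\<close> and
  \<open>L - R\<close>. The correction \<open>G\<close> involves only \<open>w\<close> and
  \<open>f\<close>, hence is the same for all \<open>R\<close>, and \<open>Y\<close> leaves the
  range of every projection of \<open>D\<close> invariant.\<close>

lemma compression_near_masa:
  assumes T: "T \<in> bounded_ops" and P: "P \<in> PD" and L: "L \<in> PD"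
    and max: "\<And>P. P \<in> PD \<Longrightarrow> rank_le r (corner T P)"
    and ge: "rank_ge r ((id_blinfun - L) o\<^sub>L corner T P o\<^sub>L (id_blinfun - L))"
  shows "near_masa r (L o\<^sub>L T o\<^sub>L L)"
proof -
  define M where "M = id_blinfun - L"
  have M: "M \<in> PD" unfolding M_def by (rule PD_compl[OF L])
  have M_apply: "M x = x - L x" for x by (simp add: M_def blinfun.diff_left)
  obtain u e where ue: "\<And>i j. i < r \<Longrightarrow> j < r \<Longrightarrow>
      cinner (M (corner T P (M (u i)))) (e j) = (if i = j then 1 else 0)"
    using ge unfolding rank_ge_def M_def[symmetric] by auto
  define w where "w i = P (M (u i))" for i
  define f where "f j = M (e j) - P (M (e j))" for j
  have bi: "cinner (T (w i)) (f j) = (if i = j then 1 else 0)" if "i < r" "j < r" for i j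
  proof -
    have "cinner (M (corner T P (M (u i)))) (e j) = cinner (corner T P (M (u i))) (M (e j))"
      by (rule PD_cinner_sa[OF M])
    also have "\<dots> = cinner ((id_blinfun - P) (T (w i))) (M (e j))"
      by (simp add: corner_apply w_def blinfun.diff_left)
    also have "\<dots> = cinner (T (w i)) ((id_blinfun - P) (M (e j)))"
      by (rule PD_cinner_sa[OF PD_compl[OF P]])
    also have "\<dots> = cinner (T (w i)) (f j)" by (simp add: f_def blinfun.diff_left)
    finally show ?thesis using ue[OF that] by simp
  qed
  have vanish: "(L - R) (T z) = (\<Sum>i<r. cinner (T z) (f i) *\<^sub>C (L - R) (T (w i)))"
    if R: "R \<in> PD" "\<And>x. L (R x) = R x" and z: "R z = z" for R z
  proof -
    have RL: "R (L x) = R x" for x using PD_comm[OF L R(1), of x] R(2) by simp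
    \<comment> \<open>\<open>P\<close> outside \<open>L\<close> and \<open>R\<close> inside it: each
      \<open>w i\<close> is fixed and each \<open>f j\<close> annihilated, so the old minor is also
      a minor of the new corner.\<close>
    define P' where "P' = (P o\<^sub>L M) + R"
    have P': "P' \<in> PD"
      unfolding P'_def by (intro PD_add PD_compose P M R) (simp add: M_apply R(2))
    have P'_apply: "P' x = P (M x) + R x" for x by (simp add: P'_def blinfun.add_left)
    have Lz: "L z = z" using R(2)[of z] z by simp
    have P'z: "P' z = z" by (simp add: P'_apply M_apply Lz z)
    have RM: "R (M x) = 0" for x by (simp add: M_apply blinfun.diff_right RL)
    have P'w: "P' (w i) = w i" for i
      by (simp add: P'_apply w_def PD_comm[OF M P] PD_idem[OF P] PD_idem[OF M] PD_comm[OF R(1) P] RM)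
    have P'f: "P' (f j) = 0" for j
      by (simp add: P'_apply f_def blinfun.diff_right PD_comm[OF M P] PD_idem[OF P] PD_idem[OF M]
          PD_comm[OF R(1) P] RM)
    have test: "cinner (corner T P' x) (f j) = cinner (T x) (f j)" if "P' x = x" for x j
    proof -
      have "cinner (corner T P' x) (f j) = cinner ((id_blinfun - P') (T x)) (f j)"
        by (simp add: corner_apply that blinfun.diff_left)
      also have "\<dots> = cinner (T x) ((id_blinfun - P') (f j))"
        by (rule PD_cinner_sa[OF PD_compl[OF P']])
      finally show ?thesis by (simp add: blinfun.diff_left P'f)
    qed
    \<comment> \<open>Column elimination: the multiples of the \<open>w i\<close> are chosen to make
      \<open>T y\<close> orthogonal to every \<open>f j\<close> with \<open>j < r\<close>.\<close>
    define y where "y = z - (\<Sum>i<r. cinner (T z) (f i) *\<^sub>C w i)"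
    have P'y: "P' y = y"
      by (simp add: y_def blinfun.diff_right blinfun.sum_right P'z P'w bounded_opsD[OF PD_bounded[OF P']])
    have Ty: "T y = T z - (\<Sum>i<r. cinner (T z) (f i) *\<^sub>C T (w i))"
      by (simp add: y_def blinfun.diff_right blinfun.sum_right bounded_opsD[OF T])
    have Tyf: "cinner (T y) (f j) = 0" if j: "j < r" for j
    proof -
      have "(\<Sum>i<r. cinner (T z) (f i) * cinner (T (w i)) (f j))
          = (\<Sum>i<r. if i = j then cinner (T z) (f i) else 0)"
        by (rule sum.cong) (auto simp: bi j)
      also have "\<dots> = cinner (T z) (f j)" using j by simp
      finally show ?thesis
        by (simp add: Ty cinner_diff_left cinner_sum_left cinner_scaleC_left)
    qed
    \<comment> \<open>otherwise \<open>y\<close> and the \<open>w i\<close> would give \<open>r + 1\<close> independent vectors in the range of \<open>corner T P'\<close>\<close>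
    have zero: "corner T P' y = 0"
    proof (rule ccontr)
      assume nz: "corner T P' y \<noteq> 0"
      define x where "x i = (if i < r then w i else y)" for i
      obtain B where B: "finite B" "card B \<le> r" "range (corner T P') \<subseteq> complex_vector.span B"
        using max[OF P'] unfolding rank_le_def by blast
      obtain c k where c: "k < Suc r" "c k \<noteq> 0" "(\<Sum>i<Suc r. c i *\<^sub>C corner T P' (x i)) = 0"
      proof (rule nontrivial_relation)
        show "card B < Suc r" using B(2) by simp
        show "corner T P' (x i) \<in> complex_vector.span B" for i using B(3) by blast
      qed (use B(1) in auto)
      have c0: "c j = 0" if j: "j < r" for j
      proof -
        have "0 = cinner (\<Sum>i<Suc r. c i *\<^sub>C corner T P' (x i)) (f j)" by (simp only: c(3) cinner_zero_left)
        also have "\<dots> = (\<Sum>i<Suc r. c i * cinner (corner T P' (x i)) (f j))"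
          by (simp only: cinner_sum_left cinner_scaleC_left)
        also have "\<dots> = (\<Sum>i<r. c i * cinner (corner T P' (x i)) (f j))"
          by (simp add: x_def test P'y Tyf j)
        also have "\<dots> = (\<Sum>i<r. if i = j then c i else 0)"
          by (rule sum.cong) (auto simp: x_def test P'w bi j)
        also have "\<dots> = c j" using j by simp
        finally show ?thesis by simp
      qed
      then have "k = r" using c(1,2) less_Suc_eq by auto
      moreover have "c r *\<^sub>C corner T P' y = 0" using c(3) c0 by (simp add: x_def)
      ultimately show False using c(2) nz by simp
    qed
    then have "T y = P' (T y)" by (simp add: corner_apply P'y)
    moreover have "(L - R) (P' x) = 0" for x
    proof -
      have "L (P (M x)) = 0"
        by (simp add: PD_comm[OF L P] M_apply blinfun.diff_right PD_idem[OF L])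
      moreover have "R (P (M x)) = 0" by (simp add: PD_comm[OF R(1) P] RM)
      ultimately show ?thesis
        by (simp add: P'_apply blinfun.diff_left blinfun.add_right R(2) PD_idem[OF R(1)])
    qed
    ultimately have LRy: "(L - R) (T y) = 0" by metis
    have LRb: "L - R \<in> bounded_ops" by (intro bounded_ops_diff PD_bounded L R)
    have "(L - R) (T y) = (L - R) (T z) - (\<Sum>i<r. cinner (T z) (f i) *\<^sub>C (L - R) (T (w i)))"
      by (simp only: Ty blinfun.diff_right blinfun.sum_right bounded_opsD[OF LRb])
    then show ?thesis using LRy by simp
  qed
  \<comment> \<open>The correction from \<open>vanish\<close>, compressed to \<open>L\<close>; its
    range is spanned by the vectors \<open>L (T (w i))\<close>.\<close>
  define G where "G = (\<Sum>i<r. rank_one (f i) (L (T (w i))) o\<^sub>L T o\<^sub>L L)"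
  have G_apply: "G x = (\<Sum>i<r. cinner (T (L x)) (f i) *\<^sub>C L (T (w i)))" for x
    by (simp add: G_def blinfun.sum_left rank_one_apply)
  have Gb: "G \<in> bounded_ops"
    unfolding G_def by (intro bounded_ops_sum bounded_ops_compose rank_one_bounded_ops T PD_bounded L)
  have G_rank: "rank_le r G"
    unfolding rank_le_def
  proof (intro exI conjI)
    show "card ((\<lambda>i. L (T (w i))) ` {..<r}) \<le> r"
      using card_image_le[of "{..<r}" "\<lambda>i. L (T (w i))"] by simp
    show "range G \<subseteq> complex_vector.span ((\<lambda>i. L (T (w i))) ` {..<r})"
    proof (rule image_subsetI)
      fix x
      show "G x \<in> complex_vector.span ((\<lambda>i. L (T (w i))) ` {..<r})"
        unfolding G_apply
        by (intro complex_vector.span_sum complex_vector.span_scale complex_vector.span_base imageI)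
    qed
  qed simp
  define Y where "Y = (L o\<^sub>L T o\<^sub>L L) - G"
  have Y_apply: "Y x = L (T (L x)) - (\<Sum>i<r. cinner (T (L x)) (f i) *\<^sub>C L (T (w i)))" for x
    by (simp add: Y_def blinfun.diff_left G_apply)
  have Yb: "Y \<in> bounded_ops"
    unfolding Y_def by (intro bounded_ops_diff bounded_ops_compose PD_bounded L T Gb)
  have LY: "L (Y x) = Y x" for x
    by (simp add: Y_apply blinfun.diff_right blinfun.sum_right bounded_opsD[OF PD_bounded[OF L]] PD_idem[OF L])
  have YL: "Y (L x) = Y x" for x
    by (simp add: Y_apply PD_idem[OF L])
  have invariant: "q (Y (q x)) = Y (q x)" if q: "q \<in> PD" for q x
  proof -
    define R where "R = L o\<^sub>L q"
    have R: "R \<in> PD" "\<And>x. L (R x) = R x"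
      by (simp_all add: R_def PD_compose L q PD_idem)
    have R_apply: "R x = L (q x)" for x by (simp add: R_def)
    define z where "z = L (q x)"
    have z: "R z = z"
      by (simp add: z_def R_apply PD_comm[OF q L] PD_idem[OF L] PD_idem[OF q])
    have Lz: "L z = z" by (simp add: z_def PD_idem[OF L])
    have RL: "R (L x) = R x" for x by (simp add: R_apply PD_comm[OF q L] PD_idem[OF L])
    have LRL: "(L - R) (L x) = (L - R) x" for x
      by (simp add: blinfun.diff_left PD_idem[OF L] RL)
    have LRb: "L - R \<in> bounded_ops" by (intro bounded_ops_diff PD_bounded L R)
    have "(L - R) (Y z) = (L - R) (T z) - (\<Sum>i<r. cinner (T z) (f i) *\<^sub>C (L - R) (T (w i)))"
      by (simp only: Y_apply Lz blinfun.diff_right blinfun.sum_right bounded_opsD[OF LRb] LRL)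
    then have "(L - R) (Y z) = 0" using vanish[OF R z] by simp
    then have "L (Y z) = L (q (Y z))" by (simp add: blinfun.diff_left R_apply)
    then have "Y z = q (Y z)" by (simp add: LY PD_comm[OF L q])
    moreover have "Y z = Y (q x)" by (simp add: z_def YL)
    ultimately show ?thesis by simp
  qed
  have "Y \<in> D"
  proof (rule commutes_with_projections_imp_D[OF Yb])
    fix q x assume q: "q \<in> PD"
    \<comment> \<open>Invariance for the complement of \<open>q\<close>; together with that for
      \<open>q\<close> it gives commutation.\<close>
    have "q (Y (x - q x)) = 0"
      using invariant[OF PD_compl[OF q], of x] by (simp add: blinfun.diff_left)
    then have "q (Y x) = q (Y (q x))" by (simp add: blinfun.diff_right)
    then show "Y (q x) = q (Y x)" using invariant[OF q, of x] by simp
  qed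
  moreover have "(L o\<^sub>L T o\<^sub>L L) - Y = G" by (simp add: Y_def)
  ultimately show ?thesis unfolding near_masa_def using G_rank by metis
qed

text \<open>Cutting off a projection that is small on the vectors of a biorthogonal system perturbs
  its matrix only slightly.\<close>

lemma rank_ge_small_cut:
  assumes C: "C \<in> bounded_ops" "rank_ge r C"
  obtains V e where "finite V" "0 < e"
    "\<And>L. L \<in> PD \<Longrightarrow> (\<forall>v\<in>V. norm (blinfun_apply L v) < e) \<Longrightarrow>
      rank_ge r ((id_blinfun - L) o\<^sub>L C o\<^sub>L (id_blinfun - L))"
proof -
  obtain u f where uf: "\<And>i j. i < r \<Longrightarrow> j < r \<Longrightarrow> cinner (C (u i)) (f j) = (if i = j then 1 else 0)"
    using C(2) unfolding rank_ge_def by auto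
  define N where "N = (\<Sum>i<r. norm (u i) + norm (f i)) + 1"
  have N: "norm (u i) \<le> N" "norm (f i) \<le> N" if "i < r" for i
  proof -
    have "norm (u i) + norm (f i) \<le> (\<Sum>i<r. norm (u i) + norm (f i))"
      using that by (intro member_le_sum) auto
    then show "norm (u i) \<le> N" "norm (f i) \<le> N"
      using norm_ge_zero[of "u i"] norm_ge_zero[of "f i"] unfolding N_def by linarith+
  qed
  have N0: "N > 0" unfolding N_def by (intro add_nonneg_pos sum_nonneg) auto
  define c where "c = norm C + 1"
  have c: "c > 0" "norm C \<le> c" by (simp_all add: c_def add_nonneg_pos)
  \<comment> \<open>An entry changes by at most \<open>2 * c * N * e = 1 / real (Suc r)\<close>,
    strictly below the admissible \<open>1 / real r\<close>; using \<open>Suc r\<close> also keeps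
    \<open>e\<close> well defined for \<open>r = 0\<close>.\<close>
  define e where "e = 1 / (2 * c * N * real (Suc r))"
  have e: "e > 0" using N0 c by (simp add: e_def)
  show thesis
  proof (rule that[of "u ` {..<r} \<union> f ` {..<r}" e])
    fix L assume L: "L \<in> PD" and small: "\<forall>v\<in>u ` {..<r} \<union> f ` {..<r}. norm (blinfun_apply L v) < e"
    define M where "M = id_blinfun - L"
    have M: "M \<in> PD" unfolding M_def by (rule PD_compl[OF L])
    have M_apply: "M x = x - L x" for x by (simp add: M_def blinfun.diff_left)
    show "rank_ge r ((id_blinfun - L) o\<^sub>L C o\<^sub>L (id_blinfun - L))"
      unfolding M_def[symmetric]
    proof (rule rank_geI)
      show "M o\<^sub>L C o\<^sub>L M \<in> bounded_ops" by (intro bounded_ops_compose PD_bounded M C)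
      fix m assume m: "rank_le m (M o\<^sub>L C o\<^sub>L M)"
      show "r \<le> m"
      proof (rule rank_le_perturbed_biorthogonal[OF m, of r u f])
        fix i j assume ij: "i < r" "j < r"
        have "(if i = j then 1 else 0) - cinner ((M o\<^sub>L C o\<^sub>L M) (u i)) (f j)
            = cinner (C (u i)) (f j) - cinner (C (M (u i))) (M (f j))"
          using uf[OF ij] PD_cinner_sa[OF M] by simp
        also have "\<dots> = cinner (C (L (u i))) (f j) + cinner (C (M (u i))) (L (f j))"
          by (simp add: M_apply cinner_diff_left cinner_diff_right blinfun.diff_right)
        also have "cmod \<dots> \<le> norm (C (L (u i))) * norm (f j) + norm (C (M (u i))) * norm (L (f j))"
          by (rule order.trans[OF norm_triangle_ineq add_mono[OF norm_cinner_le norm_cinner_le]])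
        also have "\<dots> \<le> (c * e) * N + (c * N) * e"
        proof (intro add_mono mult_mono)
          have "norm (L (u i)) \<le> e" using small ij by (auto intro: less_imp_le)
          then show "norm (C (L (u i))) \<le> c * e"
            by (rule order.trans[OF norm_blinfun mult_mono[OF c(2)]]) (use c(1) in simp_all)
          have "norm (M (u i)) \<le> N" by (rule order.trans[OF PD_norm_le[OF M] N(1)[OF ij(1)]])
          then show "norm (C (M (u i))) \<le> c * N"
            by (rule order.trans[OF norm_blinfun mult_mono[OF c(2)]]) (use c(1) in simp_all)
          show "norm (L (f j)) \<le> e" using small ij by (auto intro: less_imp_le)
        qed (use N[OF ij(2)] c e N0 in auto)
        also have "\<dots> = 2 * c * N * e" by (simp add: mult_ac)
        also have "\<dots> = 1 / real (Suc r)" using c N0 by (simp add: e_def del: of_nat_Suc)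
        also have "\<dots> < 1 / real r" using ij by (simp add: field_simps)
        finally show "cmod ((if i = j then 1 else 0) - cinner ((M o\<^sub>L C o\<^sub>L M) (u i)) (f j)) < 1 / real r" .
      qed
    qed
  qed (use e in auto)
qed

text \<open>At most \<open>2 * R\<close> selected pieces and their complement give at most
  \<open>2 * R + 1\<close> projections, and the square of this number bounds the number of blocks.
  Off-diagonal blocks have rank at most \<open>R\<close>; a diagonal block is within rank
  \<open>r\<close> of \<open>D\<close> or has rank at most 1, whence the factor
  \<open>R + 1\<close>.\<close>

theorem uniform_corner_rank_imp_near_masa:
  assumes T: "T \<in> bounded_ops" and R: "\<And>P. P \<in> PD \<Longrightarrow> rank_le R (corner T P)"
  shows "near_masa ((2 * R + 1) * ((2 * R + 1) * (R + 1))) T"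
proof -
  define Q where "Q r \<longleftrightarrow> (\<exists>P\<in>PD. rank_ge r (corner T P))" for r
  have Q_le: "r \<le> R" if "Q r" for r
    using that rank_ge_le_rank_le[OF _ R] by (auto simp: Q_def)
  have "Q 0" unfolding Q_def using PD_zero by (auto simp: rank_ge_def)
  \<comment> \<open>The bordering argument needs a rank that is attained by some corner and exceeded
    by none; the given \<open>R\<close> is only an upper bound for it.\<close>
  define r where "r = Greatest Q"
  have "Q r" unfolding r_def by (rule GreatestI_nat[of Q 0 R]) (use \<open>Q 0\<close> Q_le in auto)
  then obtain P where P: "P \<in> PD" "rank_ge r (corner T P)" by (auto simp: Q_def)
  have rR: "r \<le> R" by (rule Q_le[OF \<open>Q r\<close>])
  have max: "rank_le r (corner T P)" if "P \<in> PD" for P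
  proof (rule ccontr)
    assume "\<not> rank_le r (corner T P)"
    then have "Q (Suc r)"
      unfolding Q_def using not_rank_le_imp_rank_ge corner_bounded_ops[OF T that] that by blast
    then have "Suc r \<le> r" unfolding r_def by (rule Greatest_le_nat) (use Q_le in auto)
    then show False by simp
  qed
  define C where "C = corner T P"
  have C: "C \<in> bounded_ops" "rank_ge r C" unfolding C_def by (rule corner_bounded_ops[OF T P(1)], rule P)
  obtain V e where V: "finite V" "0 < e" and small: "\<And>L. L \<in> PD \<Longrightarrow>
      (\<forall>v\<in>V. norm (blinfun_apply L v) < e) \<Longrightarrow> rank_ge r ((id_blinfun - L) o\<^sub>L C o\<^sub>L (id_blinfun - L))"
    using rank_ge_small_cut[OF C] by blast
  obtain K where K: "partitions id_blinfun K"
    "\<And>a. a \<in> K \<Longrightarrow> (\<exists>v. range a \<subseteq> complex_vector.span {v}) \<or> (\<forall>x\<in>V. norm (a x) < e)"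
    using fine_partition[OF V] by blast
  have KP: "\<And>a. a \<in> K \<Longrightarrow> a \<in> PD" using K(1) by (auto simp: partitions_def)
  have good: "near_masa (R + 1) (L o\<^sub>L T o\<^sub>L L)"
    if "L \<in> PD" "rank_ge r ((id_blinfun - L) o\<^sub>L C o\<^sub>L (id_blinfun - L))" for L
    using near_masa_mono[OF compression_near_masa[OF T P(1) that(1) max that(2)[unfolded C_def]]] rR by simp
  have piece: "near_masa (R + 1) (a o\<^sub>L T o\<^sub>L a)" if a: "a \<in> K" for a
    using K(2)[OF a]
  proof
    assume "\<exists>v. range (blinfun_apply a) \<subseteq> complex_vector.span {v}"
    then have "rank_le 1 (a o\<^sub>L T o\<^sub>L a)"
      by (intro rank_le_compose_right rank_le_one)
    then show ?thesis by (intro rank_le_imp_near_masa) (rule rank_le_mono, auto)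
  next
    assume "\<forall>x\<in>V. norm (a x) < e"
    then show ?thesis by (intro good KP[OF a] small)
  qed
  obtain J where J: "J \<subseteq> K" "card J \<le> 2 * r" "rank_ge r (sum id J o\<^sub>L C o\<^sub>L sum id J)"
    using rank_ge_select_both[OF C K(1)] by blast
  have Jfin: "finite J" using J(1) K(1) finite_subset by (auto simp: partitions_def)
  have JP: "sum id J \<in> PD" by (rule partitions_sum_PD(1)[OF K(1) J(1)])
  define L where "L = id_blinfun - sum id J"
  have L: "L \<in> PD" unfolding L_def by (rule PD_compl[OF JP])
  \<comment> \<open>The complement of \<open>L\<close> is the sum over \<open>J\<close>, which was
    selected so that the corner keeps rank \<open>r\<close> there.\<close>
  have L_good: "near_masa (R + 1) (L o\<^sub>L T o\<^sub>L L)"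
    using J(3) by (intro good L) (simp add: L_def)
  \<comment> \<open>The complement \<open>L\<close> may be 0, which \<open>partitions\<close>
    excludes, so the decomposition is indexed separately with \<open>None\<close> for
    \<open>L\<close>.\<close>
  define F where "F i = (case i of None \<Rightarrow> L | Some a \<Rightarrow> a)" for i :: "('a \<Rightarrow>\<^sub>L 'a) option"
  define I where "I = insert None (Some ` J)"
  have I: "finite I" using Jfin by (simp add: I_def)
  have cardI: "card I \<le> 2 * R + 1"
    using J(2) rR Jfin by (simp add: I_def card_image)
  have F_simps: "F None = L" "F (Some a) = a" for a by (simp_all add: F_def)
  have F_sum: "sum F I = id_blinfun"
  proof -
    have "sum F I = F None + sum F (Some ` J)" using Jfin by (simp add: I_def)
    also have "sum F (Some ` J) = sum id J" by (simp add: sum.reindex F_simps o_def)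
    finally show ?thesis by (simp add: F_simps L_def)
  qed
  have FP: "F i \<in> PD" if "i \<in> I" for i
    using that L KP J(1) by (auto simp: I_def F_simps)
  have Lorth: "L (a x) = 0" if "a \<in> J" for a x
    using partitions_sum_PD(2)[OF K(1) J(1) that, of x] by (simp add: L_def blinfun.diff_left)
  have orth: "F i (F j x) = 0" if ij: "i \<in> I" "j \<in> I" "i \<noteq> j" for i j x
  proof (cases i)
    case None
    then show ?thesis using ij Lorth by (auto simp: I_def F_simps)
  next
    case (Some a)
    then have a: "a \<in> J" using ij by (auto simp: I_def)
    show ?thesis
    proof (cases j)
      case None
      then show ?thesis
        using Lorth[OF a, of x] PD_comm[OF L KP, of a x] a J(1) Some by (auto simp: F_simps)
    next
      case (Some b)
      have "b \<in> K" "a \<in> K" "a \<noteq> b" using ij Some \<open>i = Some a\<close> a J(1) by (auto simp: I_def)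
      then have "blinfun_apply a (blinfun_apply b x) = 0"
        using K(1) unfolding partitions_def by blast
      then show ?thesis by (simp add: F_simps Some \<open>i = Some a\<close>)
    qed
  qed
  have block: "near_masa (R + 1) (F i o\<^sub>L T o\<^sub>L F j)" if ij: "i \<in> I" "j \<in> I" for i j
  proof (cases "i = j")
    case True
    then show ?thesis using ij L_good piece J(1) by (auto simp: I_def F_simps)
  next
    case False
    \<comment> \<open>Since \<open>F i\<close> and \<open>F j\<close> are orthogonal,
      \<open>F i\<close> absorbs the factor \<open>id_blinfun - F j\<close> of the corner, so the
      block is a left multiple of that corner.\<close>
    have "rank_le R (F i o\<^sub>L corner T (F j))"
      by (intro rank_le_compose_left PD_bounded FP R ij)
    also have "F i o\<^sub>L corner T (F j) = F i o\<^sub>L T o\<^sub>L F j"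
      by (rule blinfun_eqI) (simp add: corner_apply blinfun.diff_right orth[OF ij False])
    finally show ?thesis by (intro rank_le_imp_near_masa) (rule rank_le_mono, auto)
  qed
  have "T = (\<Sum>i\<in>I. \<Sum>j\<in>I. F i o\<^sub>L T o\<^sub>L F j)"
  proof (rule blinfun_eqI)
    fix x
    have id: "y = (\<Sum>i\<in>I. F i y)" for y
      using F_sum by (metis blinfun.sum_left blinfun_apply_id_blinfun id_apply)
    have "T x = T (\<Sum>j\<in>I. F j x)" using id[of x] by simp
    also have "\<dots> = (\<Sum>i\<in>I. F i (T (\<Sum>j\<in>I. F j x)))" by (rule id)
    also have "\<dots> = (\<Sum>i\<in>I. \<Sum>j\<in>I. F i (T (F j x)))" by (simp only: blinfun.sum_right)
    finally show "T x = (\<Sum>i\<in>I. \<Sum>j\<in>I. F i o\<^sub>L T o\<^sub>L F j) x" by (simp add: blinfun.sum_left)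
  qed
  moreover have "near_masa (card I * (card I * (R + 1))) (\<Sum>i\<in>I. \<Sum>j\<in>I. F i o\<^sub>L T o\<^sub>L F j)"
    by (intro near_masa_sum I block)
  ultimately have "near_masa (card I * (card I * (R + 1))) T" by simp
  then show ?thesis
    by (rule near_masa_mono) (intro mult_le_mono cardI order_refl)
qed

end

theorem corollary4p10:
  fixes A D :: "('a::chilbert_space \<Rightarrow>\<^sub>L 'a) set"
  assumes "separable_space (euclidean :: 'a topology)"
    and "operator_algebra A" and "closed A"
    and "masa D"
    and "\<And>T P. T \<in> A \<Longrightarrow> P \<in> projections D \<Longrightarrow>
          (id_blinfun - P) o\<^sub>L T o\<^sub>L P \<in> finite_rank_ops"
  shows "\<exists>k :: nat. A \<subseteq> D + rank_le_ops k"
proof -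
  interpret masa_algebra D by unfold_locales (rule assms(4))
  have A: "A \<subseteq> bounded_ops" "complex_vector.subspace A"
    using assms(2) by (simp_all add: operator_algebra_def)
  obtain R where R: "\<And>T P. T \<in> A \<Longrightarrow> P \<in> PD \<Longrightarrow> rank_le R (corner T P)"
    using uniform_corner_rank[OF assms(1) A(2) assms(3) A(1)] assms(5) unfolding corner_def by blast
  \<comment> \<open>Depends only on the common bound \<open>R\<close>, hence serves all
    \<open>T\<close> in \<open>A\<close> at once.\<close>
  define k where "k = (2 * R + 1) * ((2 * R + 1) * (R + 1))"
  have "A \<subseteq> D + rank_le_ops k"
  proof
    fix T assume T: "T \<in> A"
    then have Tb: "T \<in> bounded_ops" using A by blast
    obtain d where d: "d \<in> D" "rank_le k (T - d)"
      using uniform_corner_rank_imp_near_masa[OF Tb R[OF T]] unfolding near_masa_def k_def by blast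
    then have "T - d \<in> rank_le_ops k"
      by (intro rank_le_imp_rank_le_ops bounded_ops_diff Tb D_bounded)
    then have "d + (T - d) \<in> D + rank_le_ops k" by (rule set_plus_intro[OF d(1)])
    then show "T \<in> D + rank_le_ops k" by simp
  qed
  then show ?thesis by blast
qed

end
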